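(* Let $f\in L^1(-\pi,\pi)$ with $\hat f_k\in\mathbb R$ for every integer $k$. Let $D=[0,\pi]$, $p=\pi$, $D_p=p+D=[\pi,2\pi]$, $\widetilde D=D\cup D_p=[0,2\pi]$. Then $$\{T_n(f)\}\sim_\sigma(f,[0,\pi]),\qquad \{H_n(f)\}\sim_\sigma(f,[0,\pi]),$$ and furthermore $$\{H_n(f)\}\sim_\lambda(\psi_{|f|},\widetilde D).$$ If in addition $\hat f_k=\hat f_{-k}\in\mathbb R$ for every integer $k$, then $$\{T_n(f)\}\sim_\lambda(f,[0,\pi]),\qquad \{H_n(f)\}\sim_\lambda(\psi_f,\widetilde D),\qquad \{H_n(f)\}\sim_\lambda(\psi_{|f|},\widetilde D).$$
   Context: For $f\in L^1(-\pi,\pi)$, with Fourier coefficients $\hat f_k=\frac1{2\pi}\int_{-\pi}^{\pi}f(\theta)e^{-\mathbf{i}k\theta}\,d\theta$, $k\in\mathbb Z$, $T_n(f)$ is the $n\times n$ Toeplitz matrix $(T_n(f))_{s,t}=\hat f_{s-t}$, $s,t=1,\dots,n$. $Y_n$ is the $n\times n$ flip matrix ($(Y_n)_{i,j}=1$ if $i+j=n+1$, $0$ otherwise), and $H_n(f)=Y_nT_n(f)$. For a measurable function $g$ on $D$, the function $\psi_g$ on $\widetilde D=D\cup D_p$ is defined by $\psi_g(x)=g(x)$ for $x\in D$ and $\psi_g(x)=-g(x-p)$ for $x\in D_p$, $x\notin D$. Let $\{A_n\}$ be a sequence of matrices of size $d_n$ (with $d_n<d_{n+1}$) and $\psi$ a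 measurable function on a measurable set $K\subset\mathbb R$ with Lebesgue measure $0<\mu(K)<\infty$. We write $\{A_n\}\sim_\lambda(\psi,K)$ if for every continuous $F$ with bounded support on $\mathbb C$ one has $\lim_{n\to\infty}\frac1{d_n}\sum_{j=1}^{d_n}F(\lambda_j(A_n))=\frac1{\mu(K)}\int_KF(\psi(x))\,dx$, where $\lambda_j(A_n)$ are the eigenvalues; and $\{A_n\}\sim_\sigma(\psi,K)$ if for every such $F$ one has $\lim_{n\to\infty}\frac1{d_n}\sum_{j=1}^{d_n}F(\sigma_j(A_n))=\frac1{\mu(K)}\int_KF(|\psi(x)|)\,dx$, where $\sigma_j(A_n)$ are the singular values. *)

theory Defs
  imports
    "HOL-Analysis.Analysis"
    "Jordan_Normal_Form.Schur_Decomposition"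
begin

definition fourier_coeff :: "(real \<Rightarrow> complex) \<Rightarrow> int \<Rightarrow> complex" where
  "fourier_coeff f k =
     (1 / (2 * of_real pi)) *
     (LINT \<theta>:{-pi<..<pi}|lebesgue. f \<theta> * exp (- \<i> * of_int k * of_real \<theta>))"

(* Matrix indices start at 0: only the difference of the two indices matters for the
   Toeplitz matrix, and i + j = n + 1 becomes i + j + 1 = n for the flip matrix. *)

definition toeplitz_mat :: "(real \<Rightarrow> complex) \<Rightarrow> nat \<Rightarrow> complex mat" where
  "toeplitz_mat f n = Matrix.mat n n (\<lambda>(s, t). fourier_coeff f (int s - int t))"

definition flip_mat :: "nat \<Rightarrow> complex mat" where
  "flip_mat n = Matrix.mat n n (\<lambda>(i, j). if i + j + 1 = n then 1 else 0)"

definition hankel_mat :: "(real \<Rightarrow> complex) \<Rightarrow> nat \<Rightarrow> complex mat" where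
  "hankel_mat f n = flip_mat n * toeplitz_mat f n"

(* The value 0 outside of D and its translate is a dummy. *)

definition psi_ext :: "real set \<Rightarrow> real \<Rightarrow> (real \<Rightarrow> complex) \<Rightarrow> real \<Rightarrow> complex" where
  "psi_ext D p g x =
     (if x \<in> D then g x else if x \<in> (+) p ` D then - g (x - p) else 0)"

(* Eigenvalues with algebraic multiplicity. *)

definition eigvals_mset :: "complex mat \<Rightarrow> complex multiset" where
  "eigvals_mset A = proots (char_poly A)"

(* The matrix A* A is positive semidefinite, so its eigenvalues are real and nonnegative
   and taking real parts loses nothing. *)

definition singvals_mset :: "complex mat \<Rightarrow> real multiset" where
  "singvals_mset A = image_mset (\<lambda>z. sqrt (Re z)) (eigvals_mset (mat_adjoint A * A))"

definition test_fun :: "(complex \<Rightarrow> complex) \<Rightarrow> bool" where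
  "test_fun F \<longleftrightarrow> continuous_on UNIV F \<and> bounded {z. F z \<noteq> 0}"

definition admissible :: "(nat \<Rightarrow> complex mat) \<Rightarrow> (real \<Rightarrow> complex) \<Rightarrow> real set \<Rightarrow> bool" where
  "admissible A \<psi> K \<longleftrightarrow>
     (\<forall>n. square_mat (A n)) \<and> strict_mono (\<lambda>n. dim_row (A n)) \<and>
     K \<in> lmeasurable \<and> 0 < measure lebesgue K \<and> set_borel_measurable lebesgue K \<psi>"

definition eig_distr :: "(nat \<Rightarrow> complex mat) \<Rightarrow> (real \<Rightarrow> complex) \<Rightarrow> real set \<Rightarrow> bool" where
  "eig_distr A \<psi> K \<longleftrightarrow> admissible A \<psi> K \<and>
     (\<forall>F. test_fun F \<longrightarrow>
       (\<lambda>n. (\<Sum>z\<in>#eigvals_mset (A n). F z) / of_nat (dim_row (A n)))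
         \<longlonglongrightarrow> (LINT x:K|lebesgue. F (\<psi> x)) / of_real (measure lebesgue K))"

definition sv_distr :: "(nat \<Rightarrow> complex mat) \<Rightarrow> (real \<Rightarrow> complex) \<Rightarrow> real set \<Rightarrow> bool" where
  "sv_distr A \<psi> K \<longleftrightarrow> admissible A \<psi> K \<and>
     (\<forall>F. test_fun F \<longrightarrow>
       (\<lambda>n. (\<Sum>s\<in>#singvals_mset (A n). F (of_real s)) / of_nat (dim_row (A n)))
         \<longlonglongrightarrow> (LINT x:K|lebesgue. F (of_real (cmod (\<psi> x)))) / of_real (measure lebesgue K))"

end

theory Submission
  imports Defs
begin

text \<open>
  For real Fourier coefficients the flipped matrix \<open>H\<^sub>n(f) = Y\<^sub>n T\<^sub>n(f)\<close> is real symmetric and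
  \<open>T\<^sub>n(f)\<^sup>* T\<^sub>n(f) = H\<^sub>n(f)\<^sup>2\<close>, so everything follows from the eigenvalues of \<open>H\<^sub>n(f)\<close> and, in the even
  case, of \<open>T\<^sub>n(f)\<close>. It suffices to treat the test functions \<open>x \<mapsto> \<bar>x - c\<bar>\<close>, because hat functions are
  combinations of them and approximate every continuous function with compact support uniformly.

  For these test functions, comparing the expansion of \<open>\<langle>(A - c) u\<^sub>i, u\<^sub>i\<rangle>\<close> in two orthonormal bases
  \<open>u\<close>, \<open>v\<close> shows that \<open>\<Sum>\<bar>\<lambda>\<^sub>i - c\<bar>\<close> and \<open>\<Sum>\<bar>\<mu>\<^sub>j - c\<bar>\<close> differ by at most
  \<open>\<Sum>\<bar>\<langle>(A - B) u\<^sub>i, u\<^sub>i\<rangle>\<bar>\<close> (or the same sum over \<open>v\<close>) plus the residuals of \<open>(v\<^sub>j, \<mu>\<^sub>j)\<close> as approximate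
  eigenpairs of \<open>B\<close>. If \<open>A - B\<close> is a Toeplitz or flipped Toeplitz matrix with symbol \<open>h\<close>, Parseval's identity
  bounds the former by \<open>n\<parallel>h\<parallel>\<^sub>1 / 2\<pi>\<close>, which reduces the claim to trigonometric polynomials \<open>g\<close>, dense in
  \<open>L\<^sup>1\<close>. For such a \<open>g\<close> there are explicit orthonormal bases with residuals \<open>O(n\<^sup>-\<^sup>1\<^sup>/\<^sup>2)\<close>: the Fourier vectors for
  \<open>T\<^sub>n(g)\<close>, and for \<open>H\<^sub>n(g)\<close> pairs of Fourier vectors supported on the two halves of the index range, with
  eigenvalues \<open>\<plusminus>\<bar>g\<bar>\<close>. The empirical means of these values converge because equidistant sampling integrates
  trigonometric polynomials exactly.
\<close>

section \<open>Finite-dimensional linear algebra\<close>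

text \<open>Since the symbol is only integrable, \<open>f - g\<close> cannot be made small in
  operator norm. What the \<open>L^1\<close> norm does control is the sum of the absolute diagonal
  entries of the matrix difference in an arbitrary orthonormal basis. This dictates the test
  functions: \<open>|x - c|\<close> is convex and 1-Lipschitz, and the squared moduli of the
  coefficients between two orthonormal bases are doubly stochastic. Neither an ordering of the
  eigenvalues nor a min-max principle enters. The limits first appear as averages of
  \<open>F(a) + F(b)\<close> over the whole circle, with \<open>a = |f|\<close>,
  \<open>b = -|f|\<close> for \<open>H_n\<close> and \<open>a = b = f\<close> for
  \<open>T_n\<close>. Folding them onto \<open>[0, pi]\<close> needs symmetry of the function, while
  the hypotheses speak of its coefficients. Uniqueness of Fourier coefficients bridges this:
  \<open>f(-x) = cnj (f x)\<close> almost everywhere, so \<open>|f|\<close> is even although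
  \<open>f\<close> need not be. The translated part of \<open>psi\<close> supplies the negative half
  of the spectrum. With even coefficients \<open>f\<close> is real and
  \<open>{f, -f} = {|f|, -|f|}\<close> almost everywhere, so both versions of \<open>psi\<close>
  give the same limit.\<close>

definition cdot :: "nat \<Rightarrow> (nat \<Rightarrow> complex) \<Rightarrow> (nat \<Rightarrow> complex) \<Rightarrow> complex" where
  "cdot n x y = (\<Sum>s<n. x s * cnj (y s))"

definition mat_app :: "nat \<Rightarrow> (nat \<Rightarrow> nat \<Rightarrow> complex) \<Rightarrow> (nat \<Rightarrow> complex) \<Rightarrow> nat \<Rightarrow> complex" where
  "mat_app n A x s = (\<Sum>t<n. A s t * x t)"

definition l2 :: "nat \<Rightarrow> (nat \<Rightarrow> complex) \<Rightarrow> real" where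
  "l2 n x = L2_set (\<lambda>s. cmod (x s)) {..<n}"

text \<open>The length \<open>k\<close> of the family is kept apart from the dimension
  \<open>n\<close> so that incomplete families can be extended one vector at a time.\<close>

definition orthonormal :: "nat \<Rightarrow> nat \<Rightarrow> (nat \<Rightarrow> nat \<Rightarrow> complex) \<Rightarrow> bool" where
  "orthonormal n k u \<longleftrightarrow> (\<forall>i<k. \<forall>j<k. cdot n (u i) (u j) = (if i = j then 1 else 0))"

text \<open>Orthonormality of the rows says \<open>U * V = 1\<close>. For square matrices a
  one-sided inverse is two-sided, and \<open>V * U = 1\<close> is the relation between the
  columns.\<close>

lemma orthonormal_complete:
  assumes "orthonormal n n u" "s < n" "t < n"
  shows "(\<Sum>i<n. u i s * cnj (u i t)) = (if s = t then 1 else 0)"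
proof -
  define U where "U = Matrix.mat n n (\<lambda>(i,s). u i s)"
  define V where "V = Matrix.mat n n (\<lambda>(s,j). cnj (u j s))"
  have U: "U \<in> carrier_mat n n" and V: "V \<in> carrier_mat n n" by (auto simp: U_def V_def)
  have "U * V = 1\<^sub>m n"
    by (rule eq_matI) (use assms(1) in \<open>auto simp: U_def V_def scalar_prod_def orthonormal_def cdot_def atLeast0LessThan\<close>)
  then have VU: "V * U = 1\<^sub>m n"
    using mat_mult_left_right_inverse[OF U V] by simp
  have "(V * U) $$ (t, s) = (\<Sum>i<n. u i s * cnj (u i t))"
    using assms(2,3) by (auto simp: U_def V_def scalar_prod_def atLeast0LessThan mult.commute)
  then show ?thesis using assms(2,3) by (auto simp: VU)
qed

lemma cdot_commute: "cdot n y x = cnj (cdot n x y)"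
  by (simp add: cdot_def mult.commute)

lemma orthonormal_expansion:
  assumes "orthonormal n n u" "s < n"
  shows "(\<Sum>i<n. cdot n x (u i) * u i s) = x s"
proof -
  have "(\<Sum>i<n. cdot n x (u i) * u i s) = (\<Sum>t<n. x t * (\<Sum>i<n. u i s * cnj (u i t)))"
    unfolding cdot_def sum_distrib_left sum_distrib_right
    by (subst sum.swap) (simp add: mult_ac)
  also have "\<dots> = (\<Sum>t<n. x t * (if s = t then 1 else 0))"
    by (intro sum.cong refl arg_cong2[where f="(*)"]) (use assms orthonormal_complete in auto)
  also have "\<dots> = x s" using assms(2) by (simp add: if_distrib cong: if_cong)
  finally show ?thesis .
qed

lemma cdot_expansion:
  assumes "orthonormal n n u"
  shows "(\<Sum>i<n. cdot n x (u i) * cdot n (u i) y) = cdot n x y"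
proof -
  have 1: "(\<Sum>i<n. a i * cdot n (u i) y) = (\<Sum>s<n. (\<Sum>i<n. a i * u i s) * cnj (y s))" for a :: "nat \<Rightarrow> complex"
    unfolding cdot_def sum_distrib_left sum_distrib_right
    by (subst sum.swap) (simp add: mult_ac)
  show ?thesis unfolding 1 by (simp add: orthonormal_expansion[OF assms]) (simp add: cdot_def)
qed

lemma l2_square: "(l2 n x)\<^sup>2 = (\<Sum>s<n. (cmod (x s))\<^sup>2)"
  by (simp add: l2_def L2_set_def sum_nonneg)

lemma l2_nonneg: "0 \<le> l2 n x"
  by (simp add: l2_def)

lemma cdot_self: "cdot n x x = of_real ((l2 n x)\<^sup>2)"
  unfolding l2_square cdot_def by (simp only: complex_norm_square of_real_sum)

lemma parseval:
  assumes "orthonormal n n u"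
  shows "L2_set (\<lambda>i. cmod (cdot n x (u i))) {..<n} = l2 n x"
proof -
  have "of_real (\<Sum>i<n. (cmod (cdot n x (u i)))\<^sup>2) = (\<Sum>i<n. cdot n x (u i) * cdot n (u i) x)"
    by (simp only: complex_norm_square of_real_sum cdot_commute[of n _ x])
  also have "\<dots> = of_real ((l2 n x)\<^sup>2)" by (simp add: cdot_expansion[OF assms] cdot_self)
  finally have "(\<Sum>i<n. (cmod (cdot n x (u i)))\<^sup>2) = (l2 n x)\<^sup>2" using of_real_eq_iff by blast
  then show ?thesis by (simp add: L2_set_def l2_nonneg)
qed

lemma orthonormal_l2: "orthonormal n k u \<Longrightarrow> i < k \<Longrightarrow> l2 n (u i) = 1"
  using cdot_self[of n "u i"] l2_nonneg[of n "u i"]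
  by (auto simp: orthonormal_def power2_eq_1_iff simp flip: of_real_power)

lemma cdot_le: "cmod (cdot n x y) \<le> l2 n x * l2 n y"
proof -
  have "cmod (cdot n x y) \<le> (\<Sum>s<n. \<bar>cmod (x s)\<bar> * \<bar>cmod (y s)\<bar>)"
    unfolding cdot_def by (rule order_trans[OF norm_sum]) (simp add: norm_mult)
  also have "\<dots> \<le> l2 n x * l2 n y" unfolding l2_def by (rule L2_set_mult_ineq)
  finally show ?thesis .
qed

lemma cdot_add_left: "cdot n (\<lambda>s. x s + y s) z = cdot n x z + cdot n y z"
  by (simp add: cdot_def ring_distribs sum.distrib)
lemma cdot_diff_left: "cdot n (\<lambda>s. x s - y s) z = cdot n x z - cdot n y z"
  by (simp add: cdot_def ring_distribs sum_subtractf)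
lemma cdot_scale_left: "cdot n (\<lambda>s. a * x s) z = a * cdot n x z"
  by (simp add: cdot_def sum_distrib_left mult_ac)
lemma cdot_sum_left: "cdot n (\<lambda>s. \<Sum>i\<in>I. x i s) z = (\<Sum>i\<in>I. cdot n (x i) z)"
  unfolding cdot_def sum_distrib_right by (rule sum.swap)

text \<open>The weights \<open>|w i j|^2\<close> between the two bases are doubly stochastic. Up to
  error terms \<open>lam i - c\<close> is the average of the \<open>mu j - c\<close> with the
  weights of row \<open>i\<close>; the triangle inequality bounds its modulus, and summing over
  \<open>i\<close> makes the column sums 1 collapse the double sum. The difference of the matrices
  is tested on \<open>u\<close> only, so exchanging the roles of the two sides gives the opposite
  estimate with the difference tested on \<open>v\<close>.\<close>

lemma sum_abs_eigen_compare:
  fixes A B :: "nat \<Rightarrow> nat \<Rightarrow> complex" and lam mu :: "nat \<Rightarrow> real"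
  assumes u: "orthonormal n n u" and v: "orthonormal n n v"
  shows "(\<Sum>i<n. \<bar>lam i - c\<bar>) \<le> (\<Sum>j<n. \<bar>mu j - c\<bar>)
    + (\<Sum>i<n. cmod (cdot n (\<lambda>s. mat_app n A (u i) s - mat_app n B (u i) s) (u i)))
    + (\<Sum>i<n. l2 n (\<lambda>s. mat_app n A (u i) s - of_real (lam i) * u i s))
    + (\<Sum>j<n. l2 n (\<lambda>s. mat_app n B (v j) s - of_real (mu j) * v j s))"
proof -
  define p where "p i s = mat_app n A (u i) s - of_real (lam i) * u i s" for i s
  define r where "r j s = mat_app n B (v j) s - of_real (mu j) * v j s" for j s
  define d where "d i = cdot n (\<lambda>s. mat_app n A (u i) s - mat_app n B (u i) s) (u i)" for i
  define w where "w i j = cdot n (u i) (v j)" for i j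
  define q where "q i j = w i j * cdot n (r j) (u i)" for i j
  have uu: "cdot n (u i) (u i) = 1" if "i < n" for i using u that by (auto simp: orthonormal_def)
  have Bu: "mat_app n B (u i) s = (\<Sum>j<n. w i j * mat_app n B (v j) s)" if "s < n" for i s
  proof -
    have "mat_app n B (u i) s = (\<Sum>t<n. B s t * (\<Sum>j<n. w i j * v j t))"
      unfolding mat_app_def w_def by (intro sum.cong refl) (simp add: orthonormal_expansion[OF v])
    also have "\<dots> = (\<Sum>j<n. w i j * mat_app n B (v j) s)"
      unfolding mat_app_def sum_distrib_left by (subst sum.swap) (simp add: mult_ac)
    finally show ?thesis .
  qed
  have w1: "(\<Sum>j<n. of_real ((cmod (w i j))\<^sup>2)) = (1::complex)" if "i < n" for i
    using cdot_expansion[OF v, of "u i" "u i"] uu[OF that]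
    by (simp add: complex_norm_square w_def cdot_commute[of n "v _" "u i"] del: of_real_power)
  \<comment> \<open>Replace \<open>A\<close> by \<open>B\<close> at the cost of \<open>d i\<close>,
    then expand \<open>B u_i\<close> in the basis \<open>v\<close>. The row sums of the weights are
    1, which lets \<open>c\<close> move inside the sum.\<close>
  have key: "of_real (lam i - c) = d i - cdot n (p i) (u i)
      + (\<Sum>j<n. of_real ((cmod (w i j))\<^sup>2 * (mu j - c))) + (\<Sum>j<n. q i j)" if i: "i < n" for i
  proof -
    have "cdot n (mat_app n B (u i)) (u i) = cdot n (\<lambda>s. \<Sum>j<n. w i j * mat_app n B (v j) s) (u i)"
      unfolding cdot_def by (intro sum.cong refl) (simp add: Bu)
    also have "\<dots> = (\<Sum>j<n. w i j * cdot n (mat_app n B (v j)) (u i))"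
      by (simp add: cdot_sum_left cdot_scale_left)
    also have "\<dots> = (\<Sum>j<n. w i j * (cdot n (r j) (u i) + mu j * cnj (w i j)))"
      by (simp add: r_def[abs_def] cdot_diff_left cdot_scale_left w_def cdot_commute[of n "v _" "u i"])
    also have "\<dots> = (\<Sum>j<n. q i j) + (\<Sum>j<n. of_real ((cmod (w i j))\<^sup>2 * mu j))"
      by (simp add: ring_distribs sum.distrib q_def mult_ac complex_norm_square del: of_real_power)
    finally have 1: "cdot n (mat_app n B (u i)) (u i) = (\<Sum>j<n. q i j) + (\<Sum>j<n. of_real ((cmod (w i j))\<^sup>2 * mu j))" .
    have 2: "cdot n (p i) (u i) = cdot n (mat_app n A (u i)) (u i) - of_real (lam i)"
      by (simp add: p_def[abs_def] cdot_diff_left cdot_scale_left uu[OF i])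
    have 3: "d i = cdot n (mat_app n A (u i)) (u i) - cdot n (mat_app n B (u i)) (u i)"
      by (simp add: d_def cdot_diff_left)
    have 4: "(\<Sum>j<n. complex_of_real ((cmod (w i j))\<^sup>2 * (mu j - c))) = (\<Sum>j<n. of_real ((cmod (w i j))\<^sup>2 * mu j)) - of_real c"
      using w1[OF i] by (simp add: ring_distribs sum_subtractf flip: sum_distrib_right)
    show ?thesis using 1 2 3 4 by simp
  qed
  have bound: "\<bar>lam i - c\<bar> \<le> cmod (d i) + l2 n (p i) + (\<Sum>j<n. (cmod (w i j))\<^sup>2 * \<bar>mu j - c\<bar>) + (\<Sum>j<n. cmod (q i j))"
    if i: "i < n" for i
  proof -
    have "\<bar>lam i - c\<bar> = cmod (of_real (lam i - c))" by (simp only: norm_of_real)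
    also have "\<dots> \<le> cmod (d i) + cmod (cdot n (p i) (u i))
      + cmod (\<Sum>j<n. of_real ((cmod (w i j))\<^sup>2 * (mu j - c))) + cmod (\<Sum>j<n. q i j)"
      unfolding key[OF i] by (intro norm_triangle_mono norm_triangle_ineq4 order_refl)
    also have "cmod (\<Sum>j<n. of_real ((cmod (w i j))\<^sup>2 * (mu j - c))) \<le> (\<Sum>j<n. (cmod (w i j))\<^sup>2 * \<bar>mu j - c\<bar>)"
      by (rule order_trans[OF norm_sum]) (simp only: norm_of_real abs_mult, simp)
    also have "cmod (\<Sum>j<n. q i j) \<le> (\<Sum>j<n. cmod (q i j))" by (rule norm_sum)
    also have "cmod (cdot n (p i) (u i)) \<le> l2 n (p i)"
      using cdot_le[of n "p i" "u i"] orthonormal_l2[OF u i] by simp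
    finally show ?thesis by simp
  qed
  have col: "(\<Sum>i<n. (cmod (w i j))\<^sup>2) = 1" if "j < n" for j
  proof -
    have "L2_set (\<lambda>i. cmod (w i j)) {..<n} = 1"
      using parseval[OF u, of "v j"] orthonormal_l2[OF v that]
      by (simp add: w_def cdot_commute[of n "v j" "u _"])
    then show ?thesis by (simp add: L2_set_def)
  qed
  have "(\<Sum>i<n. \<bar>lam i - c\<bar>) \<le> (\<Sum>i<n. cmod (d i) + l2 n (p i) + (\<Sum>j<n. (cmod (w i j))\<^sup>2 * \<bar>mu j - c\<bar>) + (\<Sum>j<n. cmod (q i j)))"
    by (rule sum_mono) (use bound in auto)
  also have "\<dots> = (\<Sum>i<n. cmod (d i)) + (\<Sum>i<n. l2 n (p i)) + (\<Sum>i<n. \<Sum>j<n. (cmod (w i j))\<^sup>2 * \<bar>mu j - c\<bar>) + (\<Sum>i<n. \<Sum>j<n. cmod (q i j))"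
    by (simp only: sum.distrib)
  also have "(\<Sum>i<n. \<Sum>j<n. (cmod (w i j))\<^sup>2 * \<bar>mu j - c\<bar>) = (\<Sum>j<n. \<Sum>i<n. (cmod (w i j))\<^sup>2 * \<bar>mu j - c\<bar>)"
    by (rule sum.swap)
  also have "(\<Sum>i<n. \<Sum>j<n. cmod (q i j)) = (\<Sum>j<n. \<Sum>i<n. cmod (q i j))"
    by (rule sum.swap)
  also have "(\<Sum>j<n. \<Sum>i<n. (cmod (w i j))\<^sup>2 * \<bar>mu j - c\<bar>) = (\<Sum>j<n. \<bar>mu j - c\<bar>)"
    by (intro sum.cong refl) (simp add: col flip: sum_distrib_right)
  \<comment> \<open>Cauchy-Schwarz is applied in \<open>i\<close> for fixed \<open>j\<close>: both
    factors of \<open>q i j\<close> are, up to conjugation, coefficients in the basis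
    \<open>u\<close>, of the unit vector \<open>v j\<close> and of the residual \<open>r j\<close>.
    Summing over \<open>i\<close> therefore costs no power of \<open>n\<close>.\<close>
  also have "(\<Sum>j<n. \<Sum>i<n. cmod (q i j)) \<le> (\<Sum>j<n. l2 n (r j))"
  proof (rule sum_mono)
    fix j assume "j \<in> {..<n}"
    then have j: "j < n" by simp
    have "(\<Sum>i<n. cmod (q i j)) = (\<Sum>i<n. \<bar>cmod (w i j)\<bar> * \<bar>cmod (cdot n (r j) (u i))\<bar>)"
      by (simp add: q_def norm_mult)
    also have "\<dots> \<le> L2_set (\<lambda>i. cmod (w i j)) {..<n} * L2_set (\<lambda>i. cmod (cdot n (r j) (u i))) {..<n}"
      by (rule L2_set_mult_ineq)
    also have "\<dots> = l2 n (r j)" using col[OF j] by (simp add: parseval[OF u]) (simp add: L2_set_def)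
    finally show "(\<Sum>i<n. cmod (q i j)) \<le> l2 n (r j)" .
  qed
  finally show ?thesis by (simp add: d_def p_def[abs_def] r_def[abs_def])
qed

section \<open>Spectral theorem for hermitian matrices\<close>

lemma sum_delta_left: "(s::nat) < n \<Longrightarrow> (\<Sum>t<n. (if s = t then 1 else 0) * y t) = (y s :: complex)"
  by (simp add: if_distrib[of "\<lambda>x. x * _"] cong: if_cong)

text \<open>The trace is invariant under the similarity of the Schur decomposition, so it is the sum
  of the eigenvalues on the diagonal of the triangular factor. A nonzero sum has a nonzero
  term.\<close>

lemma nonzero_eigenvalue_of_trace:
  fixes C :: "nat \<Rightarrow> nat \<Rightarrow> complex"
  assumes "(\<Sum>s<n. C s s) \<noteq> 0"
  obtains x e where "e \<noteq> 0" "\<exists>s<n. x s \<noteq> 0" "\<And>s. s < n \<Longrightarrow> mat_app n C x s = e * x s"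
proof -
  define M where "M = Matrix.mat n n (\<lambda>(s,t). C s t)"
  have M: "M \<in> carrier_mat n n" by (simp add: M_def)
  obtain es where es: "char_poly M = (\<Prod>e\<leftarrow>es. [:- e, 1:])"
    using char_poly_factorized[OF M] by blast
  obtain U P Q where schur: "schur_decomposition M es = (U, P, Q)" by (metis prod_cases3)
  have wit: "similar_mat_wit M U P Q" and diag: "diag_mat U = es"
    using schur_decomposition[OF M es schur] by auto
  note w = similar_mat_witD2[OF M wit]
  have dims: "dim_row U = n" "dim_col U = n" "dim_row P = n" "dim_col P = n" "dim_row Q = n" "dim_col Q = n"
    using w by auto
  have "(\<Sum>s<n. C s s) = (\<Sum>s<n. M $$ (s,s))" by (simp add: M_def)
  also have "\<dots> = (\<Sum>s<n. \<Sum>k<n. \<Sum>j<n. P $$ (s,j) * U $$ (j,k) * Q $$ (k,s))"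
    unfolding w(3)
    by (intro sum.cong refl) (simp add: dims scalar_prod_def atLeast0LessThan sum_distrib_right)
  also have "\<dots> = (\<Sum>k<n. \<Sum>j<n. \<Sum>s<n. P $$ (s,j) * U $$ (j,k) * Q $$ (k,s))"
    by (subst sum.swap) (intro sum.cong refl sum.swap)
  also have "\<dots> = (\<Sum>k<n. \<Sum>j<n. U $$ (j,k) * (Q * P) $$ (k,j))"
    by (intro sum.cong refl) (simp add: dims scalar_prod_def atLeast0LessThan sum_distrib_left mult_ac)
  also have "\<dots> = (\<Sum>k<n. U $$ (k,k))"
    by (simp add: w(2) if_distrib cong: if_cong)
  also have "\<dots> = sum_list es"
    by (simp add: diag[symmetric] diag_mat_def dims sum_list_distinct_conv_sum_set atLeast0LessThan)
  finally have "sum_list es \<noteq> 0" using assms by simp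
  then obtain e where e: "e \<in> set es" "e \<noteq> 0" using sum_list_0[of es] sum_list_nonneg_eq_0_iff
    by (metis (no_types, lifting) map_idI map_eq_conv sum_list_0)
  have "poly (char_poly M) e = 0" using e(1) by (auto simp: es poly_prod_list prod_list_zero_iff)
  then have "eigenvalue M e" by (simp add: eigenvalue_root_char_poly[OF M])
  then obtain v where v: "v \<in> carrier_vec n" "v \<noteq> 0\<^sub>v n" "M *\<^sub>v v = e \<cdot>\<^sub>v v"
    using M by (auto simp: eigenvalue_def eigenvector_def)
  show thesis
  proof (rule that[of e "\<lambda>s. v $ s"])
    show "\<exists>s<n. v $ s \<noteq> 0" using v(1,2) by (auto intro!: eq_vecI)
    fix s assume "s < n"
    with arg_cong[OF v(3), of "\<lambda>w. w $ s"] v(1) show "mat_app n C (($) v) s = e * v $ s"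
      by (simp add: mat_app_def M_def scalar_prod_def atLeast0LessThan)
  qed (use e in auto)
qed

lemma hermitian_cdot:
  assumes "\<And>s t. s < n \<Longrightarrow> t < n \<Longrightarrow> A s t = cnj (A t s)"
  shows "cdot n (mat_app n A x) y = cdot n x (mat_app n A y)"
proof -
  have "cdot n (mat_app n A x) y = (\<Sum>s<n. \<Sum>t<n. x t * cnj (A t s * y s))"
    unfolding cdot_def mat_app_def sum_distrib_right
    by (intro sum.cong refl) (subst assms, auto simp: mult_ac)
  also have "\<dots> = cdot n x (mat_app n A y)"
    unfolding cdot_def mat_app_def cnj_sum sum_distrib_left by (rule sum.swap)
  finally show ?thesis .
qed

text \<open>
  Let \<open>P\<close> be the orthogonal projection onto the complement of the eigenvectors found so far. For a suitable
  shift \<open>\<sigma>\<close> the matrix \<open>P (A + \<sigma>)\<close> has nonzero trace, hence an eigenvector for a nonzero eigenvalue; it lies in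
  the range of \<open>P\<close>, which commutes with \<open>A\<close>, and so is an eigenvector of \<open>A\<close>.
\<close>

lemma orthonormal_eigenvectors_extend:
  assumes herm: "\<And>s t. s < n \<Longrightarrow> t < n \<Longrightarrow> A s t = cnj (A t s)"
    and u: "orthonormal n k u" and k: "k < n"
    and eig: "\<And>i s. i < k \<Longrightarrow> s < n \<Longrightarrow> mat_app n A (u i) s = of_real (lam i) * u i s"
  obtains w :: "nat \<Rightarrow> complex" and m :: real where "cdot n w w = 1" "\<And>i. i < k \<Longrightarrow> cdot n w (u i) = 0"
    "\<And>s. s < n \<Longrightarrow> mat_app n A w s = of_real m * w s"
proof -
  define P where "P s t = (if s = t then 1 else 0) - (\<Sum>i<k. u i s * cnj (u i t))" for s t
  define a where "a = (\<Sum>s<n. \<Sum>r<n. P s r * A r s)"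
  \<comment> \<open>Here \<open>a\<close> is the trace of \<open>P A\<close>. If it vanishes, the
    shift 1 adds the trace of \<open>P\<close>, which is \<open>n - k\<close> and nonzero.\<close>
  define \<sigma> :: real where "\<sigma> = (if a = 0 then 1 else 0)"
  define C where "C s t = (\<Sum>r<n. P s r * (A r t + (if r = t then of_real \<sigma> else 0)))" for s t
  have Papp: "(\<Sum>r<n. P s r * y r) = y s - (\<Sum>i<k. cdot n y (u i) * u i s)" if "s < n" for s y
  proof -
    have "(\<Sum>r<n. (\<Sum>i<k. u i s * cnj (u i r)) * y r) = (\<Sum>i<k. cdot n y (u i) * u i s)"
      unfolding cdot_def sum_distrib_left sum_distrib_right by (subst sum.swap) (simp add: mult_ac)
    then show ?thesis
      by (simp add: P_def ring_distribs sum_subtractf sum_delta_left[OF that])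
  qed
  have "(\<Sum>s<n. P s s) = of_nat n - (\<Sum>i<k. cdot n (u i) (u i))"
    unfolding P_def sum_subtractf cdot_def by (subst sum.swap) simp
  also have "\<dots> = of_nat n - of_nat k" using u by (simp add: orthonormal_def)
  also have "\<dots> \<noteq> 0" using k by (simp add: of_nat_eq_iff)
  finally have trP: "(\<Sum>s<n. P s s) \<noteq> 0" .
  have "(\<Sum>s<n. C s s) = a + of_real \<sigma> * (\<Sum>s<n. P s s)"
    unfolding C_def a_def
    by (simp add: ring_distribs sum.distrib if_distrib[of "\<lambda>x. _ * x"] sum_distrib_left mult.commute cong: if_cong)
  then have "(\<Sum>s<n. C s s) \<noteq> 0" using trP by (auto simp: \<sigma>_def)
  then obtain x e where e: "e \<noteq> 0" and x: "\<exists>s<n. x s \<noteq> 0"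
    and Cx: "\<And>s. s < n \<Longrightarrow> mat_app n C x s = e * x s"
    using nonzero_eigenvalue_of_trace by metis
  define y where "y s = mat_app n A x s + of_real \<sigma> * x s" for s
  have Cx': "mat_app n C x s = y s - (\<Sum>i<k. cdot n y (u i) * u i s)" if "s < n" for s
  proof -
    have "mat_app n C x s = (\<Sum>r<n. P s r * (\<Sum>t<n. (A r t + (if r = t then of_real \<sigma> else 0)) * x t))"
      unfolding mat_app_def C_def sum_distrib_left sum_distrib_right
      by (subst sum.swap) (simp add: mult_ac)
    also have "\<dots> = (\<Sum>r<n. P s r * y r)"
      by (intro sum.cong refl)
         (simp add: y_def mat_app_def ring_distribs sum.distrib if_distrib[of "\<lambda>x. x * _"] cong: if_cong)
    finally show ?thesis using Papp[OF that] by simp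
  qed
  have orth: "cdot n x (u i) = 0" if i: "i < k" for i
  proof -
    have "e * cdot n x (u i) = cdot n (\<lambda>s. y s - (\<Sum>j<k. cdot n y (u j) * u j s)) (u i)"
      unfolding cdot_scale_left[symmetric] unfolding cdot_def
      by (intro sum.cong refl) (simp add: Cx[symmetric] Cx' cdot_def)
    also have "\<dots> = cdot n y (u i) - (\<Sum>j<k. cdot n y (u j) * cdot n (u j) (u i))"
      by (simp add: cdot_diff_left cdot_sum_left cdot_scale_left)
    also have "(\<Sum>j<k. cdot n y (u j) * cdot n (u j) (u i)) = (\<Sum>j<k. if j = i then cdot n y (u j) else 0)"
      by (intro sum.cong refl) (use u i in \<open>auto simp: orthonormal_def\<close>)
    also have "cdot n y (u i) - \<dots> = 0" using i by simp
    finally show ?thesis using e by simp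
  qed
  \<comment> \<open>Hermitian symmetry moves \<open>A\<close> onto the eigenvector
    \<open>u i\<close>, so orthogonality of \<open>x\<close> passes to \<open>A x\<close>. Then the
    projection in \<open>C\<close> leaves \<open>y\<close> unchanged, and \<open>C x = e x\<close>
    becomes an eigenvalue equation for \<open>A\<close>.\<close>
  have yorth: "cdot n y (u i) = 0" if i: "i < k" for i
  proof -
    have "cdot n (mat_app n A x) (u i) = cdot n x (mat_app n A (u i))"
      by (rule hermitian_cdot[OF herm])
    also have "\<dots> = cdot n x (\<lambda>s. of_real (lam i) * u i s)"
      unfolding cdot_def by (intro sum.cong refl) (simp add: eig[OF i])
    also have "\<dots> = of_real (lam i) * cdot n x (u i)"
      by (simp add: cdot_def sum_distrib_left mult_ac)
    finally show ?thesis using orth[OF i] by (simp add: y_def[abs_def] cdot_add_left cdot_scale_left)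
  qed
  have Ax: "mat_app n A x s = (e - of_real \<sigma>) * x s" if "s < n" for s
    using Cx[OF that] Cx'[OF that] yorth by (simp add: y_def left_diff_distrib eq_diff_eq)
  have nz: "l2 n x \<noteq> 0"
    using x by (auto simp: l2_def L2_set_eq_0_iff)
  have "(e - of_real \<sigma>) * cdot n x x = cdot n (mat_app n A x) x"
    unfolding cdot_scale_left[symmetric] unfolding cdot_def by (intro sum.cong refl) (simp add: Ax)
  moreover have "cnj (cdot n (mat_app n A x) x) = cdot n (mat_app n A x) x"
    using hermitian_cdot[of n A x x, OF herm] cdot_commute[of n x "mat_app n A x"] by simp
  ultimately have "cnj ((e - of_real \<sigma>) * cdot n x x) = (e - of_real \<sigma>) * cdot n x x" by simp
  then have "cnj (e - of_real \<sigma>) = e - of_real \<sigma>" using nz by (simp add: cdot_self)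
  then obtain m where m: "e - of_real \<sigma> = of_real m" by (metis Reals_cnj_iff Reals_cases)
  define w where "w s = of_real (1 / l2 n x) * x s" for s
  show thesis
  proof (rule that[of w m])
    have "cdot n w w = of_real (1 / l2 n x) * cnj (of_real (1 / l2 n x)) * cdot n x x"
      unfolding w_def[abs_def] cdot_def by (simp add: sum_distrib_left mult_ac sum_divide_distrib)
    then show "cdot n w w = 1" using nz by (simp add: cdot_self power2_eq_square)
    show "cdot n w (u i) = 0" if "i < k" for i
      unfolding w_def[abs_def] cdot_scale_left using orth[OF that] by simp
    show "mat_app n A w s = of_real m * w s" if "s < n" for s
    proof -
      have "mat_app n A w s = of_real (1 / l2 n x) * mat_app n A x s"
        by (simp add: mat_app_def w_def sum_distrib_left mult_ac)
      then show ?thesis by (simp add: Ax[OF that] m w_def mult_ac)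
    qed
  qed
qed

lemma hermitian_eigenbasis:
  assumes herm: "\<And>s t. s < n \<Longrightarrow> t < n \<Longrightarrow> A s t = cnj (A t s)"
  obtains u and lam :: "nat \<Rightarrow> real" where "orthonormal n n u"
    "\<And>i s. i < n \<Longrightarrow> s < n \<Longrightarrow> mat_app n A (u i) s = of_real (lam i) * u i s"
proof -
  have "\<exists>u (lam :: nat \<Rightarrow> real). orthonormal n k u \<and>
      (\<forall>i<k. \<forall>s<n. mat_app n A (u i) s = of_real (lam i) * u i s)" if "k \<le> n" for k
    using that
  proof (induction k)
    case 0
    then show ?case by (auto simp: orthonormal_def)
  next
    case (Suc k)
    then obtain u and lam :: "nat \<Rightarrow> real" where u: "orthonormal n k u"
      and eig: "\<And>i s. i < k \<Longrightarrow> s < n \<Longrightarrow> mat_app n A (u i) s = of_real (lam i) * u i s"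
      by auto
    obtain w and m :: real where w: "cdot n w w = 1" "\<And>i. i < k \<Longrightarrow> cdot n w (u i) = 0"
      "\<And>s. s < n \<Longrightarrow> mat_app n A w s = of_real m * w s"
      using orthonormal_eigenvectors_extend[OF herm u _ eig] Suc.prems by (metis Suc_le_lessD)
    have w': "cdot n (u i) w = 0" if "i < k" for i
      using w(2)[OF that] cdot_commute[of n "u i" w] by simp
    have "orthonormal n (Suc k) (u(k := w))"
      using u w w' by (auto simp: orthonormal_def less_Suc_eq)
    moreover have "\<forall>i<Suc k. \<forall>s<n. mat_app n A ((u(k := w)) i) s = of_real ((lam(k := m)) i) * (u(k := w)) i s"
      using eig w(3) by (auto simp: less_Suc_eq)
    ultimately show ?case by blast
  qed
  from this[of n] show thesis using that by auto
qed

text \<open>With the basis vectors as columns of \<open>P\<close> the matrix is similar to a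
  diagonal one, whose characteristic polynomial is explicit. This counts algebraic multiplicities
  correctly even if values of \<open>lam\<close> repeat.\<close>

lemma eigvals_mset_orthonormal:
  assumes A: "A \<in> carrier_mat n n" and u: "orthonormal n n u"
    and eig: "\<And>i s. i < n \<Longrightarrow> s < n \<Longrightarrow> mat_app n (\<lambda>s t. A $$ (s,t)) (u i) s = lam i * u i s"
  shows "eigvals_mset A = image_mset lam (mset [0..<n])"
proof -
  define P where "P = Matrix.mat n n (\<lambda>(s,i). u i s)"
  define Q where "Q = Matrix.mat n n (\<lambda>(i,s). cnj (u i s))"
  define L where "L = Matrix.mat n n (\<lambda>(i,j). if i = j then lam i else 0)"
  have c: "P \<in> carrier_mat n n" "Q \<in> carrier_mat n n" "L \<in> carrier_mat n n"
    by (auto simp: P_def Q_def L_def)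
  have PQ: "P * Q = 1\<^sub>m n"
    by (rule eq_matI)
       (auto simp: P_def Q_def scalar_prod_def atLeast0LessThan orthonormal_complete[OF u])
  have QP: "Q * P = 1\<^sub>m n" using mat_mult_left_right_inverse[OF c(1,2) PQ] .
  have "A * P = P * L"
  proof (rule eq_matI)
    fix i j assume "i < dim_row (P * L)" "j < dim_col (P * L)"
    then have ij: "i < n" "j < n" using c by auto
    have "(A * P) $$ (i, j) = (\<Sum>t<n. A $$ (i,t) * u j t)"
      using A ij by (auto simp: P_def scalar_prod_def atLeast0LessThan)
    also have "\<dots> = lam j * u j i" using eig[OF ij(2,1)] by (simp add: mat_app_def)
    also have "\<dots> = (P * L) $$ (i, j)"
      using ij by (auto simp: P_def L_def scalar_prod_def atLeast0LessThan if_distrib cong: if_cong)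
    finally show "(A * P) $$ (i, j) = (P * L) $$ (i, j)" .
  qed (use A c in auto)
  then have "A * P * Q = P * L * Q" by simp
  moreover have "A * P * Q = A" using A c PQ by (simp add: assoc_mult_mat[of _ n n _ n _ n])
  ultimately have "similar_mat_wit A L P Q"
    using A c PQ QP by (intro similar_mat_witI[of _ _ n]) auto
  then have "char_poly A = char_poly L"
    using char_poly_similar unfolding similar_mat_def by blast
  also have "\<dots> = (\<Prod>a\<leftarrow>diag_mat L. [:- a, 1:])"
    by (rule char_poly_upper_triangular[OF c(3)]) (auto simp: L_def)
  also have "diag_mat L = map lam [0..<n]" by (auto simp: diag_mat_def L_def)
  finally have "char_poly A = (\<Prod>a\<leftarrow>map lam [0..<n]. [:- a, 1:])" .
  moreover have "proots (\<Prod>a\<leftarrow>xs. [:- a, 1:]) = mset xs" for xs :: "complex list"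
  proof (induction xs)
    case (Cons a xs)
    have "(\<Prod>a\<leftarrow>xs. [:- a, 1:]) \<noteq> 0" by (auto simp: prod_list_zero_iff)
    then show ?case using Cons by (simp add: proots_mult del: mult_pCons_left)
  qed simp
  ultimately show ?thesis by (simp add: eigvals_mset_def del: map_map)
qed

section \<open>Toeplitz forms on the circle\<close>

text \<open>The closed interval gives compactness, hence integrability and uniform approximation of
  continuous functions. Its end points are a null set, so the Fourier integrals over the open
  interval are the same.\<close>

abbreviation circ :: "real measure" where
  "circ \<equiv> lebesgue_on {-pi..pi}"

lemma finite_measure_circ: "finite_measure circ"
  by (rule finite_measure_lebesgue_on) simp

lemma measure_circ: "measure circ (space circ) = 2 * pi"
  by (simp add: measure_restrict_space)

lemma integrable_circ_iff: "integrable circ f \<longleftrightarrow> set_integrable lebesgue {-pi<..<pi} f"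
  for f :: "real \<Rightarrow> 'a::{banach,second_countable_topology}"
proof -
  have "integrable circ f \<longleftrightarrow> integrable lebesgue (\<lambda>x. indicator {-pi..pi} x *\<^sub>R f x)"
    by (subst integrable_restrict_space) auto
  also have "\<dots> \<longleftrightarrow> integrable lebesgue (\<lambda>x. indicator {-pi<..<pi} x *\<^sub>R f x)"
    by (rule integrable_discrete_difference[where X="{-pi,pi}"]) (auto split: split_indicator)
  finally show ?thesis by (simp add: set_integrable_def)
qed

lemma set_integral_eq_circ: "(LINT x:{-pi<..<pi}|lebesgue. f x) = integral\<^sup>L circ f"
  for f :: "real \<Rightarrow> 'a::{banach,second_countable_topology}"
proof -
  have "integral\<^sup>L circ f = (\<integral>x. indicator {-pi..pi} x *\<^sub>R f x \<partial>lebesgue)"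
    by (subst integral_restrict_space) auto
  also have "\<dots> = (\<integral>x. indicator {-pi<..<pi} x *\<^sub>R f x \<partial>lebesgue)"
    by (rule integral_discrete_difference[where X="{-pi,pi}"]) (auto split: split_indicator)
  finally show ?thesis by (simp add: set_lebesgue_integral_def)
qed

lemma fourier_coeff_circ:
  "fourier_coeff f k = (1 / (2 * of_real pi)) * (\<integral>x. f x * cis (- (of_int k * x)) \<partial>circ)"
  unfolding fourier_coeff_def set_integral_eq_circ by (simp add: cis_conv_exp mult_ac)

lemma continuous_measurable_circ: "continuous_on UNIV f \<Longrightarrow> f \<in> borel_measurable circ"
  by (rule continuous_imp_measurable_on_sets_lebesgue) (auto intro: continuous_on_subset)

lemma integrable_mult_bounded:
  fixes h g :: "'a \<Rightarrow> complex"
  assumes h: "integrable M h" and g: "g \<in> borel_measurable M" and B: "\<And>x. cmod (g x) \<le> B"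
  shows "integrable M (\<lambda>x. h x * g x)"
proof (rule Bochner_Integration.integrable_bound[of M "\<lambda>x. B * norm (h x)"])
  show "integrable M (\<lambda>x. B * norm (h x))" using h by simp
  show "(\<lambda>x. h x * g x) \<in> borel_measurable M" using h g by simp
  show "AE x in M. norm (h x * g x) \<le> norm (B * norm (h x))"
  proof (rule AE_I2)
    fix x
    have "norm (h x * g x) \<le> B * norm (h x)"
      using mult_right_mono[OF B[of x], of "cmod (h x)"] by (simp add: norm_mult mult.commute)
    also have "\<dots> \<le> norm (B * norm (h x))" by simp
    finally show "norm (h x * g x) \<le> norm (B * norm (h x))" .
  qed
qed

lemma continuous_on_cis_mult [continuous_intros]:
  "continuous_on S f \<Longrightarrow> continuous_on S (\<lambda>x. cis (f x))"
  unfolding cis_conv_exp by (intro continuous_intros)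

lemma integrable_circ_times_cis:
  assumes "integrable circ h"
  shows "integrable circ (\<lambda>x. h x * cis (a * x))"
  by (rule integrable_mult_bounded[OF assms, where B=1])
     (auto intro!: continuous_measurable_circ continuous_intros)

lemma fourier_coeff_diff:
  assumes "integrable circ f" "integrable circ g"
  shows "fourier_coeff (\<lambda>x. f x - g x) k = fourier_coeff f k - fourier_coeff g k"
proof -
  have "integrable circ (\<lambda>x. f x * cis (- (of_int k * x)))" "integrable circ (\<lambda>x. g x * cis (- (of_int k * x)))"
    using integrable_circ_times_cis[OF assms(1), of "- of_int k"] integrable_circ_times_cis[OF assms(2), of "- of_int k"]
    by simp_all
  then show ?thesis by (simp add: fourier_coeff_circ left_diff_distrib diff_divide_distrib)
qed

text \<open>
  The row map \<open>q\<close> is the identity for \<open>T\<^sub>n(f)\<close> and the index flip \<open>s \<mapsto> n - 1 - s\<close> for \<open>H\<^sub>n(f)\<close>.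
\<close>

definition toep :: "(nat \<Rightarrow> nat) \<Rightarrow> (real \<Rightarrow> complex) \<Rightarrow> nat \<Rightarrow> nat \<Rightarrow> complex" where
  "toep q f s t = fourier_coeff f (int (q s) - int t)"

definition expvec :: "real \<Rightarrow> nat \<Rightarrow> complex" where
  "expvec x s = cis (- (real s * x))"

text \<open>A Toeplitz matrix is a superposition of rank-one matrices: with
  \<open>E = expvec x\<close> its entries are the averages of \<open>h x * E s * cnj (E t)\<close>
  over the circle.\<close>

lemma toep_cdot:
  assumes h: "integrable circ h"
  shows "cdot n (mat_app n (toep id h) b) a =
    (1 / (2 * of_real pi)) * (\<integral>x. h x * (cdot n (expvec x) a * cnj (cdot n (expvec x) b)) \<partial>circ)"
proof -
  have int: "integrable circ (\<lambda>x. h x * cis (- (of_int (int s - int t) * x)))" for s t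
    using integrable_circ_times_cis[OF h, of "- of_int (int s - int t)"] by (simp only: mult_minus_left)
  have e: "cis (- ((real s - real t) * x)) = expvec x s * cnj (expvec x t)" for x s t
    by (simp add: expvec_def cis_cnj cis_mult algebra_simps)
  have "h x * (cdot n (expvec x) a * cnj (cdot n (expvec x) b))
      = (\<Sum>s<n. \<Sum>t<n. (b t * cnj (a s)) * (h x * cis (- (of_int (int s - int t) * x))))" for x
    unfolding cdot_def cnj_sum unfolding sum_product unfolding sum_distrib_left
    by (intro sum.cong refl) (simp add: e)
  then have 1: "(\<integral>x. h x * (cdot n (expvec x) a * cnj (cdot n (expvec x) b)) \<partial>circ)
      = (\<Sum>s<n. \<Sum>t<n. (b t * cnj (a s)) * (\<integral>x. h x * cis (- (of_int (int s - int t) * x)) \<partial>circ))"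
    using int by (simp add: Bochner_Integration.integral_sum)
  show ?thesis
    unfolding 1 unfolding cdot_def mat_app_def toep_def fourier_coeff_circ sum_distrib_left sum_distrib_right
    by (simp add: mult_ac)
qed

lemma continuous_expvec: "continuous_on UNIV (\<lambda>x. cdot n (expvec x) a)"
  unfolding cdot_def expvec_def by (intro continuous_intros)

text \<open>For each fixed \<open>x\<close>, Cauchy-Schwarz over \<open>i\<close> and Parseval in
  both bases bound the sum of the kernels by the squared length of \<open>expvec x\<close>, which is
  \<open>n\<close>. Integrating against \<open>|h|\<close> leaves only the \<open>L^1\<close> norm.
  Two different bases are allowed because the index flip will be moved onto one of them.\<close>

lemma toep_bilinear_bound:
  assumes h: "integrable circ h" and a: "orthonormal n n a" and b: "orthonormal n n b"
  shows "(\<Sum>i<n. cmod (cdot n (mat_app n (toep id h) (b i)) (a i))) \<le> real n / (2 * pi) * (\<integral>x. cmod (h x) \<partial>circ)"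
proof -
  define K where "K i x = cdot n (expvec x) (a i) * cnj (cdot n (expvec x) (b i))" for i x
  have E: "l2 n (expvec x) = sqrt n" for x by (simp add: l2_def L2_set_def expvec_def)
  have KB: "(\<Sum>i<n. cmod (K i x)) \<le> real n" for x
  proof -
    have "(\<Sum>i<n. cmod (K i x)) = (\<Sum>i<n. \<bar>cmod (cdot n (expvec x) (a i))\<bar> * \<bar>cmod (cdot n (expvec x) (b i))\<bar>)"
      by (simp add: K_def norm_mult)
    also have "\<dots> \<le> l2 n (expvec x) * l2 n (expvec x)"
      using L2_set_mult_ineq[of "\<lambda>i. cmod (cdot n (expvec x) (a i))" "\<lambda>i. cmod (cdot n (expvec x) (b i))" "{..<n}"]
      by (simp only: parseval[OF a] parseval[OF b])
    finally show ?thesis by (simp add: E)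
  qed
  have K1: "cmod (K i x) \<le> real n" if "i < n" for i x
    using order_trans[OF member_le_sum[of i "{..<n}" "\<lambda>i. cmod (K i x)"] KB[of x]] that by simp
  have Kc: "continuous_on UNIV (K i)" for i
    unfolding K_def[abs_def] by (intro continuous_intros continuous_expvec)
  have int: "integrable circ (\<lambda>x. h x * K i x)" if "i < n" for i
    by (rule integrable_mult_bounded[OF h, where B="real n"]) (use K1[OF that] Kc continuous_measurable_circ in auto)
  have "cmod (cdot n (mat_app n (toep id h) (b i)) (a i)) \<le> 1 / (2 * pi) * (\<integral>x. cmod (h x * K i x) \<partial>circ)" for i
    unfolding toep_cdot[OF h] K_def[symmetric] norm_mult
    using integral_norm_bound[of circ "\<lambda>x. h x * K i x"] by (simp add: norm_divide norm_mult divide_right_mono)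
  then have "(\<Sum>i<n. cmod (cdot n (mat_app n (toep id h) (b i)) (a i)))
      \<le> (\<Sum>i<n. 1 / (2 * pi) * (\<integral>x. cmod (h x * K i x) \<partial>circ))"
    by (rule sum_mono)
  also have "\<dots> = 1 / (2 * pi) * (\<integral>x. (\<Sum>i<n. cmod (h x * K i x)) \<partial>circ)"
    using int by (subst Bochner_Integration.integral_sum) (auto simp: sum_distrib_left)
  also have "\<dots> \<le> 1 / (2 * pi) * (\<integral>x. real n * cmod (h x) \<partial>circ)"
  proof (intro mult_left_mono integral_mono)
    fix x
    have "(\<Sum>i<n. cmod (h x * K i x)) = cmod (h x) * (\<Sum>i<n. cmod (K i x))"
      by (simp add: norm_mult sum_distrib_left)
    also have "\<dots> \<le> cmod (h x) * real n" by (intro mult_left_mono KB) simp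
    finally show "(\<Sum>i<n. cmod (h x * K i x)) \<le> real n * cmod (h x)" by (simp add: mult.commute)
  qed (use int h in auto)
  finally show ?thesis by simp
qed

lemma cdot_reindex:
  assumes "bij_betw q {..<n} {..<n}"
  shows "cdot n (\<lambda>s. x (q s)) (\<lambda>s. y (q s)) = cdot n x y"
  unfolding cdot_def using assms by (rule sum.reindex_bij_betw)

text \<open>As \<open>q\<close> is an involution of the indices, the permutation of the rows can be
  transferred to the second argument of the inner product. There it turns \<open>u\<close> into
  another orthonormal basis, which reduces the flipped case to a plain Toeplitz form.\<close>

lemma toep_perturb:
  assumes f: "integrable circ f" and g: "integrable circ g" and u: "orthonormal n n u"
    and q: "bij_betw q {..<n} {..<n}" and inv: "\<And>s. s < n \<Longrightarrow> q (q s) = s"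
  shows "(\<Sum>i<n. cmod (cdot n (\<lambda>s. mat_app n (toep q f) (u i) s - mat_app n (toep q g) (u i) s) (u i)))
    \<le> real n / (2 * pi) * (\<integral>x. cmod (f x - g x) \<partial>circ)"
proof -
  define h where "h x = f x - g x" for x
  define a where "a i s = u i (q s)" for i s
  have h: "integrable circ h" unfolding h_def using f g by simp
  have a: "orthonormal n n a" using u by (simp add: orthonormal_def a_def[abs_def] cdot_reindex[OF q])
  have "cdot n (\<lambda>s. mat_app n (toep q f) (u i) s - mat_app n (toep q g) (u i) s) (u i)
      = cdot n (mat_app n (toep id h) (u i)) (a i)" for i
  proof -
    have "mat_app n (toep q f) (u i) s - mat_app n (toep q g) (u i) s = mat_app n (toep id h) (u i) (q s)" for s
      by (simp add: mat_app_def toep_def h_def[abs_def] fourier_coeff_diff[OF f g] left_diff_distrib sum_subtractf)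
    then have "cdot n (\<lambda>s. mat_app n (toep q f) (u i) s - mat_app n (toep q g) (u i) s) (u i)
      = cdot n (\<lambda>s. mat_app n (toep id h) (u i) (q s)) (\<lambda>s. a i (q s))"
      by (simp add: cdot_def a_def inv)
    then show ?thesis by (simp add: cdot_reindex[OF q])
  qed
  then show ?thesis using toep_bilinear_bound[OF h a u] by (simp add: h_def)
qed

section \<open>Trigonometric polynomials\<close>

text \<open>The inductive form makes closure under products, conjugation and reflection, as well as
  linear identities, a matter of rule induction. The coefficient representation is recovered
  separately in \<open>trig_poly_sum\<close>.\<close>

inductive trig_poly :: "(real \<Rightarrow> complex) \<Rightarrow> bool" where
  monom: "trig_poly (\<lambda>x. a * cis (of_int k * x))"
| add: "trig_poly f \<Longrightarrow> trig_poly g \<Longrightarrow> trig_poly (\<lambda>x. f x + g x)"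

lemma trig_poly_const: "trig_poly (\<lambda>x. a)"
  using trig_poly.monom[of a 0] by simp

lemma trig_poly_mult_monom: "trig_poly f \<Longrightarrow> trig_poly (\<lambda>x. f x * (a * cis (of_int k * x)))"
proof (induction rule: trig_poly.induct)
  case (monom b j)
  have "(\<lambda>x. b * cis (of_int j * x) * (a * cis (of_int k * x))) = (\<lambda>x. (b * a) * cis (of_int (j + k) * x))"
    by (simp add: mult_ac ring_distribs flip: cis_mult)
  then show ?case using trig_poly.monom by metis
next
  case (add f g)
  then show ?case by (simp add: ring_distribs trig_poly.add)
qed

lemma trig_poly_mult: "trig_poly g \<Longrightarrow> trig_poly f \<Longrightarrow> trig_poly (\<lambda>x. f x * g x)"
proof (induction rule: trig_poly.induct)
  case (monom a k)
  then show ?case by (rule trig_poly_mult_monom)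
next
  case (add g1 g2)
  then show ?case by (simp add: ring_distribs trig_poly.add)
qed

lemma trig_poly_scale: "trig_poly f \<Longrightarrow> trig_poly (\<lambda>x. a * f x)"
  using trig_poly_mult[OF _ trig_poly_const] .

lemma trig_poly_cnj: "trig_poly f \<Longrightarrow> trig_poly (\<lambda>x. cnj (f x))"
proof (induction rule: trig_poly.induct)
  case (monom a k)
  then show ?case using trig_poly.monom[of "cnj a" "-k"] by (simp add: cis_cnj)
qed (simp add: trig_poly.add)

lemma trig_poly_reflect: "trig_poly f \<Longrightarrow> trig_poly (\<lambda>x. f (- x))"
proof (induction rule: trig_poly.induct)
  case (monom a k)
  then show ?case using trig_poly.monom[of a "-k"] by simp
qed (simp add: trig_poly.add)

lemma trig_poly_continuous: "trig_poly f \<Longrightarrow> continuous_on S f"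
  by (induction rule: trig_poly.induct) (auto intro!: continuous_intros)

lemma trig_poly_periodic: "trig_poly f \<Longrightarrow> f (x + 2 * pi) = f x"
proof (induction rule: trig_poly.induct)
  case (monom a k)
  have "cis (of_int k * (x + 2 * pi)) = cis (of_int k * x) * cis (2 * pi * of_int k)"
    by (simp add: cis_mult algebra_simps)
  then show ?case by (simp add: cis_multiple_2pi)
qed simp

lemma trig_poly_sum:
  assumes "trig_poly g"
  obtains r :: nat and c where "g = (\<lambda>x. \<Sum>k = - int r..int r. c k * cis (of_int k * x))"
proof -
  have "\<exists>r c. g = (\<lambda>x. \<Sum>k = - int r..int r. c k * cis (of_int k * x))"
    using assms
  proof (induction rule: trig_poly.induct)
    case (monom a j)
    have j: "- \<bar>j\<bar> \<le> j" by linarith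
    show ?case
      by (rule exI[of _ "nat \<bar>j\<bar>"], rule exI[of _ "\<lambda>k. if k = j then a else 0"])
         (use j in \<open>auto simp: if_distrib[of "\<lambda>x. x * _"] cong: if_cong\<close>)
  next
    case (add f g)
    then obtain r c r' c' where
      f: "f = (\<lambda>x. \<Sum>k = - int r..int r. c k * cis (of_int k * x))" and
      g: "g = (\<lambda>x. \<Sum>k = - int r'..int r'. c' k * cis (of_int k * x))" by blast
    define R where "R = max r r'"
    have ext: "(\<Sum>k = - int m..int m. d k * cis (of_int k * x))
       = (\<Sum>k = - int R..int R. (if \<bar>k\<bar> \<le> int m then d k else 0) * cis (of_int k * x))"
      if "m \<le> R" for m d and x :: real
      by (rule sum.mono_neutral_cong_left) (use that in auto)
    show ?case
      by (rule exI[of _ R], rule exI[of _ "\<lambda>k. (if \<bar>k\<bar> \<le> int r then c k else 0) + (if \<bar>k\<bar> \<le> int r' then c' k else 0)"])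
         (simp only: f g ext[of r c] ext[of r' c'] R_def max.cobounded1 max.cobounded2 ring_distribs sum.distrib)
  qed
  then show thesis using that by blast
qed

lemma trig_poly_real_polynomial_cis:
  "real_polynomial_function p \<Longrightarrow> trig_poly (\<lambda>x. of_real (p (cis x)))"
proof (induction rule: real_polynomial_function.induct)
  case (linear f)
  interpret bounded_linear f by fact
  \<comment> \<open>A real linear functional takes the value
    \<open>cos x * f 1 + sin x * f \<i>\<close> at \<open>cis x\<close>. Euler's formulas turn this
    into two monomials of frequency 1 and -1.\<close>
  have *: "of_real (f (cis x)) = (of_real (f 1) - \<i> * of_real (f \<i>)) / 2 * cis (of_int 1 * x)
      + (of_real (f 1) + \<i> * of_real (f \<i>)) / 2 * cis (of_int (- 1) * x)" for x
  proof -
    have "cis x = cos x *\<^sub>R 1 + sin x *\<^sub>R \<i>" by (simp add: complex_eq_iff)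
    then have "f (cis x) = cos x * f 1 + sin x * f \<i>" by (simp only: add scaleR) simp
    then show ?thesis by (simp add: complex_eq_iff field_simps)
  qed
  show ?case unfolding * by (rule trig_poly.add[OF trig_poly.monom trig_poly.monom])
next
  case (const c)
  show ?case by (rule trig_poly_const)
next
  case (add f g)
  then show ?case using trig_poly.add by simp
next
  case (mult f g)
  then show ?case using trig_poly_mult by simp
qed

text \<open>Matching end values let \<open>\<phi>\<close> descend to a function on the unit circle.
  The map \<open>cis\<close> from the compact interval onto the circle is a quotient map, so this
  function is continuous and Stone-Weierstrass applies there; polynomials on the circle are
  trigonometric polynomials in the angle.\<close>

theorem trig_poly_approx:
  fixes \<phi> :: "real \<Rightarrow> complex"
  assumes c: "continuous_on {-pi..pi} \<phi>" and per: "\<phi> (-pi) = \<phi> pi" and e: "e > 0"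
  obtains g where "trig_poly g" "\<And>x. x \<in> {-pi..pi} \<Longrightarrow> cmod (\<phi> x - g x) < e"
proof -
  define \<Phi> where "\<Phi> z = \<phi> (Arg z)" for z
  let ?T = "sphere (0::complex) 1"
  have \<Phi>: "\<Phi> (cis x) = \<phi> x" if "x \<in> {-pi..pi}" for x
  \<comment> \<open>\<open>Arg\<close> has values in the half-open interval from \<open>-pi\<close>
    (excluded) to \<open>pi\<close>, so the left end point is sent to \<open>pi\<close>; this is
    where \<open>per\<close> enters.\<close>
  proof (cases "x = -pi")
    case True
    then have "cis x = cis pi" by (simp add: complex_eq_iff)
    then show ?thesis using per True by (simp add: \<Phi>_def Arg_cis del: cis_pi)
  next
    case False
    then show ?thesis using that by (simp add: \<Phi>_def Arg_cis)
  qed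
  have img: "cis ` {-pi..pi} = ?T"
  proof
    show "?T \<subseteq> cis ` {-pi..pi}"
    proof
      fix z :: complex assume "z \<in> ?T"
      then have "z \<noteq> 0" "cmod z = 1" by auto
      then have "z = cis (Arg z)" using Arg_eq[of z] by (simp add: cis_conv_exp)
      moreover have "Arg z \<in> {-pi..pi}" using mpi_less_Arg[of z] Arg_le_pi[of z] by simp
      ultimately show "z \<in> cis ` {-pi..pi}" by blast
    qed
  qed auto
  have cis: "continuous_on {-pi..pi} cis" by (intro continuous_intros)
  have "continuous_on ?T \<Phi>"
    unfolding continuous_on_open_gen[where T=UNIV, simplified] continuous_openin_preimage_eq
  proof (intro allI impI)
    fix W :: "complex set" assume W: "open W"
    have "{-pi..pi} \<inter> cis -` (?T \<inter> \<Phi> -` W) = {-pi..pi} \<inter> \<phi> -` W"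
      using \<Phi> by auto
    moreover have "openin (top_of_set {-pi..pi}) ({-pi..pi} \<inter> \<phi> -` W)"
      using c W by (simp add: continuous_openin_preimage_eq)
    ultimately show "openin (top_of_set ?T) (?T \<inter> \<Phi> -` W)"
      using Abstract_Topology_2.continuous_imp_quotient_map[OF cis img compact_Icc, of "?T \<inter> \<Phi> -` W"] by simp
  qed
  then obtain p where p: "polynomial_function p" "\<And>z. z \<in> ?T \<Longrightarrow> norm (\<Phi> z - p z) < e"
    using Stone_Weierstrass_polynomial_function[OF compact_sphere _ e] by metis
  have "real_polynomial_function (Re \<circ> p)" "real_polynomial_function (Im \<circ> p)"
    using p(1) bounded_linear_Re bounded_linear_Im unfolding polynomial_function_def by blast+
  from this[THEN trig_poly_real_polynomial_cis]
  have "trig_poly (\<lambda>x. of_real (Re (p (cis x))) + \<i> * of_real (Im (p (cis x))))"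
    unfolding o_def by (rule trig_poly.add[OF _ trig_poly_scale])
  then have "trig_poly (\<lambda>x. p (cis x))" by (simp flip: complex_eq)
  then show thesis
  proof (rule that)
    fix x assume "x \<in> {-pi..pi}"
    then show "cmod (\<phi> x - p (cis x)) < e" using p(2)[of "cis x"] \<Phi>[of x] by simp
  qed
qed

section \<open>Density of trigonometric polynomials in L^1\<close>

lemma trig_poly_integrable: "trig_poly g \<Longrightarrow> integrable circ g"
  by (intro continuous_imp_integrable_real trig_poly_continuous)

lemma integral_circ_const: "(\<integral>x. c \<partial>circ) = 2 * pi * (c::real)"
  by (simp add: measure_restrict_space)

lemma integral_circ_bounded:
  fixes g :: "real \<Rightarrow> complex"
  assumes "integrable circ g" "\<And>x. x \<in> {-pi..pi} \<Longrightarrow> cmod (g x) \<le> B"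
  shows "(\<integral>x. cmod (g x) \<partial>circ) \<le> 2 * pi * B"
proof -
  have "(\<integral>x. cmod (g x) \<partial>circ) \<le> (\<integral>x. B \<partial>circ)"
    by (rule integral_mono) (use assms in auto)
  then show ?thesis by (simp only: integral_circ_const)
qed

text \<open>For \<open>k > 0\<close> this is the radial projection onto the disc of radius
  \<open>k\<close>. The \<open>max\<close> gives one continuous formula with a positive
  denominator.\<close>

definition clip :: "real \<Rightarrow> complex \<Rightarrow> complex" where
  "clip k z = (k / max k (cmod z)) *\<^sub>R z"

lemma clip_id: "k > 0 \<Longrightarrow> cmod z \<le> k \<Longrightarrow> clip k z = z"
  by (simp add: clip_def max_def)

lemma clip_norm: "k > 0 \<Longrightarrow> cmod (clip k z) \<le> k"
  by (auto simp: clip_def max_def field_simps)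

lemma clip_norm': "k > 0 \<Longrightarrow> cmod (clip k z) \<le> cmod z"
  by (auto simp: clip_def max_def field_simps intro: mult_right_mono)

lemma continuous_clip: "k > 0 \<Longrightarrow> continuous_on UNIV (clip k)"
  unfolding clip_def[abs_def] by (intro continuous_intros) (auto simp: max_def)

text \<open>At every point the truncation is eventually the identity, and
  \<open>2 * cmod (f x)\<close> dominates. \<open>Suc n\<close> keeps the radius positive.\<close>

lemma clip_approx_L1:
  assumes f: "integrable M f"
  shows "(\<lambda>n. \<integral>x. cmod (f x - clip (real (Suc n)) (f x)) \<partial>M) \<longlonglongrightarrow> 0"
proof -
  have [measurable]: "clip (real (Suc n)) \<in> borel_measurable borel" for n
    by (intro borel_measurable_continuous_onI continuous_clip) simp
  have [measurable]: "f \<in> borel_measurable M" using f by simp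
  have "(\<lambda>n. \<integral>x. cmod (f x - clip (real (Suc n)) (f x)) \<partial>M) \<longlonglongrightarrow> (\<integral>x. 0 \<partial>M)"
  proof (rule integral_dominated_convergence[where w="\<lambda>x. 2 * cmod (f x)"])
    show "AE x in M. (\<lambda>n. cmod (f x - clip (real (Suc n)) (f x))) \<longlonglongrightarrow> 0"
    proof (rule AE_I2)
      fix x
      obtain m :: nat where m: "cmod (f x) \<le> real m" using real_arch_simple by blast
      have "\<forall>n\<ge>m. cmod (f x - clip (real (Suc n)) (f x)) = 0"
        using m by (auto simp: clip_id)
      then show "(\<lambda>n. cmod (f x - clip (real (Suc n)) (f x))) \<longlonglongrightarrow> 0"
        by (intro tendsto_eventually) (auto simp: eventually_sequentially)
    qed
    show "AE x in M. norm (cmod (f x - clip (real (Suc n)) (f x))) \<le> 2 * cmod (f x)" for n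
    proof (rule AE_I2)
      fix x
      show "norm (cmod (f x - clip (real (Suc n)) (f x))) \<le> 2 * cmod (f x)"
        using norm_triangle_ineq4[of "f x" "clip (real (Suc n)) (f x)"] clip_norm'[of "real (Suc n)" "f x"]
        by simp
    qed
    show "integrable M (\<lambda>x. 2 * cmod (f x))" using f by simp
  qed measurable
  then show ?thesis by simp
qed

text \<open>A measurable function is an almost everywhere limit of continuous functions. Clipping
  them provides a constant dominating function, and damping them near the ends makes the end values
  agree, as uniform approximation by trigonometric polynomials requires.\<close>

lemma bounded_approx_L1:
  fixes f :: "real \<Rightarrow> complex"
  assumes f: "f \<in> borel_measurable circ" and k: "k > 0" and e: "e > 0"
  obtains \<phi> where "continuous_on UNIV \<phi>" "\<phi> (-pi) = 0" "\<phi> pi = 0"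
    "(\<integral>x. cmod (clip k (f x) - \<phi> x) \<partial>circ) < e"
proof -
  have "f measurable_on {-pi..pi}" using f by (simp add: measurable_on_iff_borel_measurable)
  then obtain N g where N: "negligible N" and gc: "\<And>n. continuous_on UNIV (g n)"
    and gl: "\<And>x. x \<notin> N \<Longrightarrow> (\<lambda>n. g n x) \<longlonglongrightarrow> (if x \<in> {-pi..pi} then f x else 0)"
    unfolding measurable_on_def by blast
  \<comment> \<open>A trapezoid that vanishes at both end points and equals 1 as soon as
    \<open>n * (pi - |x|) \<ge> 1\<close>. It tends to 1 at every interior point, so only the null
    set of end points is lost.\<close>
  define cut where "cut n x = max 0 (min 1 (real n * (pi - \<bar>x\<bar>)))" for n :: nat and x :: real
  define \<phi> where "\<phi> n x = cut n x *\<^sub>R clip k (g n x)" for n x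
  have \<phi>c: "continuous_on UNIV (\<phi> n)" for n
    unfolding \<phi>_def[abs_def] cut_def
    by (intro continuous_intros continuous_on_compose2[OF continuous_clip[OF k] gc]) auto
  have \<phi>0: "\<phi> n (-pi) = 0" "\<phi> n pi = 0" for n by (auto simp: \<phi>_def cut_def)
  have tr [measurable]: "clip k \<in> borel_measurable borel"
    by (intro borel_measurable_continuous_onI continuous_clip k)
  have [measurable]: "f \<in> borel_measurable circ" "\<And>n. \<phi> n \<in> borel_measurable circ"
    using f continuous_measurable_circ[OF \<phi>c] by auto
  have "(\<lambda>n. \<integral>x. cmod (clip k (f x) - \<phi> n x) \<partial>circ) \<longlonglongrightarrow> (\<integral>x. 0 \<partial>circ)"
  proof (rule integral_dominated_convergence[where w="\<lambda>x. 2 * k"])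
    have "N \<union> {-pi, pi} \<in> null_sets lebesgue"
      using N by (simp flip: negligible_iff_null_sets)
    then have "AE x in lebesgue. x \<notin> N \<union> {-pi, pi}" by (rule AE_not_in)
    then have "AE x in circ. x \<notin> N \<union> {-pi, pi}" by (subst AE_restrict_space_iff) auto
    moreover have "AE x in circ. x \<in> {-pi..pi}" by (rule AE_I2) simp
    ultimately show "AE x in circ. (\<lambda>n. cmod (clip k (f x) - \<phi> n x)) \<longlonglongrightarrow> 0"
    proof eventually_elim
      case (elim x)
      then have x: "x \<notin> N" "\<bar>x\<bar> < pi" by auto
      have "isCont (clip k) (f x)"
        using continuous_clip[OF k] continuous_on_eq_continuous_at open_UNIV by blast
      then have t: "(\<lambda>n. clip k (g n x)) \<longlonglongrightarrow> clip k (f x)"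
        using gl[OF x(1)] elim(2) by (intro isCont_tendsto_compose[of _ "clip k"]) auto
      obtain m :: nat where "1 / (pi - \<bar>x\<bar>) \<le> real m" using real_arch_simple by blast
      then have m: "1 \<le> real m * (pi - \<bar>x\<bar>)" using x(2) by (simp add: field_simps)
      have "\<forall>n\<ge>m. cut n x = 1"
      proof (intro allI impI)
        fix n assume "n \<ge> m"
        then have "real m * (pi - \<bar>x\<bar>) \<le> real n * (pi - \<bar>x\<bar>)" using x(2) by (intro mult_right_mono) auto
        then show "cut n x = 1" using m by (simp add: cut_def)
      qed
      then have "(\<lambda>n. cut n x) \<longlonglongrightarrow> 1"
        by (intro tendsto_eventually) (auto simp: eventually_sequentially)
      from tendsto_scaleR[OF this t] have "(\<lambda>n. \<phi> n x) \<longlonglongrightarrow> clip k (f x)" by (simp add: \<phi>_def)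
      from tendsto_norm[OF tendsto_diff[OF tendsto_const this]]
      have "(\<lambda>n. cmod (clip k (f x) - \<phi> n x)) \<longlonglongrightarrow> cmod (clip k (f x) - clip k (f x))" .
      then show ?case by simp
    qed
    show "AE x in circ. norm (cmod (clip k (f x) - \<phi> n x)) \<le> 2 * k" for n
    proof (rule AE_I2)
      fix x
      have "cmod (\<phi> n x) \<le> 1 * k"
        unfolding \<phi>_def norm_scaleR by (intro mult_mono clip_norm k) (auto simp: cut_def)
      then show "norm (cmod (clip k (f x) - \<phi> n x)) \<le> 2 * k"
        using norm_triangle_ineq4[of "clip k (f x)" "\<phi> n x"] clip_norm[OF k, of "f x"] by simp
    qed
    show "integrable circ (\<lambda>x. 2 * k)" by simp
  qed measurable
  then have "(\<lambda>n. \<integral>x. cmod (clip k (f x) - \<phi> n x) \<partial>circ) \<longlonglongrightarrow> 0" by simp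
  from order_tendstoD(2)[OF this e] obtain n where "(\<integral>x. cmod (clip k (f x) - \<phi> n x) \<partial>circ) < e"
    by (auto simp: eventually_sequentially)
  then show thesis using that[OF \<phi>c \<phi>0] by blast
qed

theorem trig_poly_dense_L1:
  assumes f: "integrable circ f" and e: "e > 0"
  obtains g where "trig_poly g" "(\<integral>x. cmod (f x - g x) \<partial>circ) < e"
proof -
  have "e / 3 > 0" using e by simp
  from order_tendstoD(2)[OF clip_approx_L1[OF f] this]
  obtain n where n: "(\<integral>x. cmod (f x - clip (real (Suc n)) (f x)) \<partial>circ) < e / 3"
    by (auto simp: eventually_sequentially)
  define k where "k = real (Suc n)"
  have k: "k > 0" by (simp add: k_def)
  have fm: "f \<in> borel_measurable circ" using f by simp
  obtain \<phi> where \<phi>c: "continuous_on UNIV \<phi>" and \<phi>0: "\<phi> (-pi) = 0" "\<phi> pi = 0"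
    and \<phi>: "(\<integral>x. cmod (clip k (f x) - \<phi> x) \<partial>circ) < e / 3"
    using bounded_approx_L1[OF fm k \<open>e / 3 > 0\<close>] by metis
  \<comment> \<open>The interval has length \<open>2 * pi\<close>, so a uniform error of this size
    costs at most \<open>e / 3\<close> in the \<open>L^1\<close> norm.\<close>
  have "e / 3 / (2 * pi) > 0" using e by simp
  then obtain g where g: "trig_poly g" "\<And>x. x \<in> {-pi..pi} \<Longrightarrow> cmod (\<phi> x - g x) < e / 3 / (2 * pi)"
    using trig_poly_approx[of \<phi>] \<phi>c \<phi>0 continuous_on_subset by (metis subset_UNIV)
  have tr [measurable]: "clip k \<in> borel_measurable borel"
    by (intro borel_measurable_continuous_onI continuous_clip k)
  have Ti: "integrable circ (\<lambda>x. clip k (f x))"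
    by (rule Bochner_Integration.integrable_bound[OF f]) (use fm k clip_norm' in auto)
  have \<phi>i: "integrable circ \<phi>"
    by (intro continuous_imp_integrable_real continuous_on_subset[OF \<phi>c]) auto
  have gi: "integrable circ g" by (rule trig_poly_integrable[OF g(1)])
  have "(\<integral>x. cmod (f x - g x) \<partial>circ)
    \<le> (\<integral>x. cmod (f x - clip k (f x)) + cmod (clip k (f x) - \<phi> x) + cmod (\<phi> x - g x) \<partial>circ)"
  proof (rule integral_mono)
    fix x
    show "cmod (f x - g x) \<le> cmod (f x - clip k (f x)) + cmod (clip k (f x) - \<phi> x) + cmod (\<phi> x - g x)"
      using norm_triangle_ineq[of "f x - clip k (f x) + (clip k (f x) - \<phi> x)" "\<phi> x - g x"]
        norm_triangle_ineq[of "f x - clip k (f x)" "clip k (f x) - \<phi> x"] by simp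
  qed (use f Ti \<phi>i gi in auto)
  also have "\<dots> = (\<integral>x. cmod (f x - clip k (f x)) \<partial>circ) + (\<integral>x. cmod (clip k (f x) - \<phi> x) \<partial>circ)
      + (\<integral>x. cmod (\<phi> x - g x) \<partial>circ)"
    using f Ti \<phi>i gi by simp
  also have "\<dots> < e / 3 + e / 3 + e / 3"
  proof -
    have "(\<integral>x. cmod (\<phi> x - g x) \<partial>circ) \<le> 2 * pi * (e / 3 / (2 * pi))"
      by (rule integral_circ_bounded) (use \<phi>i gi g(2) in \<open>auto intro: less_imp_le\<close>)
    then show ?thesis using n \<phi> by (simp add: k_def)
  qed
  finally show thesis using that g(1) by simp
qed

section \<open>Uniqueness of Fourier coefficients\<close>

lemma integral_times_trig_poly_eq_0:
  assumes h: "integrable circ h" and z: "\<And>k. fourier_coeff h k = 0" and g: "trig_poly g"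
  shows "(\<integral>x. h x * g x \<partial>circ) = 0"
  using g
proof (induction rule: trig_poly.induct)
  case (monom a k)
  have "(\<integral>x. h x * (a * cis (of_int k * x)) \<partial>circ) = a * (\<integral>x. h x * cis (of_int k * x) \<partial>circ)"
    by (simp add: mult.left_commute)
  also have "(\<integral>x. h x * cis (of_int k * x) \<partial>circ) = 0"
    using z[of "-k"] by (simp add: fourier_coeff_circ)
  finally show ?case by simp
next
  case (add f g)
  have "integrable circ (\<lambda>x. h x * p x)" if "trig_poly p" for p
  proof -
    have "bounded (p ` {-pi..pi})"
      using compact_continuous_image[OF trig_poly_continuous[OF that] compact_Icc] by (rule compact_imp_bounded)
    then obtain B where "\<forall>x\<in>{-pi..pi}. cmod (p x) \<le> B" by (auto simp: bounded_iff)
    then have le: "cmod (h x * p x) \<le> cmod (of_real \<bar>B\<bar> * h x)" if "x \<in> {-pi..pi}" for x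
      unfolding norm_mult norm_of_real abs_idempotent mult.commute[of _ "cmod (h x)"]
      using that by (intro mult_left_mono) (auto intro: order_trans[OF _ abs_ge_self])
    show ?thesis
    proof (rule Bochner_Integration.integrable_bound)
      show "integrable circ (\<lambda>x. of_real \<bar>B\<bar> * h x)" using h by simp
      show "(\<lambda>x. h x * p x) \<in> borel_measurable circ"
        using h trig_poly_integrable[OF that] by simp
      show "AE x in circ. cmod (h x * p x) \<le> cmod (of_real \<bar>B\<bar> * h x)"
        by (rule AE_I2, rule le) simp
    qed
  qed
  then show ?case using add by (simp add: ring_distribs)
qed

text \<open>
  Test \<open>h\<close> against \<open>cnj g / (\<bar>g\<bar> + \<delta>)\<close> for a trigonometric polynomial \<open>g\<close> close to \<open>h\<close>: the integral
  vanishes, yet it is close to the \<open>L\<^sup>1\<close> norm of \<open>h\<close>.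
\<close>

theorem fourier_coeff_unique:
  assumes h: "integrable circ h" and z: "\<And>k. fourier_coeff h k = 0"
  shows "AE x in circ. h x = 0"
proof -
  have le: "(\<integral>x. cmod (h x) \<partial>circ) \<le> 0 + e" if e: "e > 0" for e :: real
  proof -
    \<comment> \<open>Chosen so that \<open>2 * pi * \<delta> = e / 3\<close>: this is the price of
      regularising the denominator. The other two thirds are two uses of the bound on the distance
      from \<open>h\<close> to \<open>g\<close>.\<close>
    define \<delta> where "\<delta> = e / 3 / (2 * pi)"
    have d: "\<delta> > 0" using e by (simp add: \<delta>_def)
    obtain g where g: "trig_poly g" and hg: "(\<integral>x. cmod (h x - g x) \<partial>circ) < e / 3"
      using trig_poly_dense_L1[OF h, of "e/3"] e by auto
    have gi: "integrable circ g" by (rule trig_poly_integrable[OF g])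
    \<comment> \<open>The unimodular factor \<open>cnj g / |g|\<close> would give the norm exactly
      but may be discontinuous at zeros of \<open>g\<close>. With \<open>\<delta>\<close> the
      quotient is continuous, has equal end values, and stays bounded by 1.\<close>
    define \<phi> where "\<phi> x = cnj (g x) / of_real (cmod (g x) + \<delta>)" for x
    have nz: "of_real (cmod (g x) + \<delta>) \<noteq> (0::complex)" for x
      using d by (metis add_nonneg_pos less_irrefl norm_ge_zero of_real_eq_0_iff)
    have \<phi>c: "continuous_on UNIV \<phi>"
      unfolding \<phi>_def[abs_def] by (intro continuous_intros trig_poly_continuous[OF g] ballI nz)
    have \<phi>m: "\<phi> \<in> borel_measurable circ" by (rule continuous_measurable_circ[OF \<phi>c])
    have \<phi>1: "cmod (\<phi> x) \<le> 1" for x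
    proof -
      have "cmod (\<phi> x) = cmod (g x) / (cmod (g x) + \<delta>)"
        unfolding \<phi>_def norm_divide norm_of_real using d by simp
      also have "\<dots> \<le> 1" using d by (subst divide_le_eq_1_pos) (auto intro: add_nonneg_pos)
      finally show ?thesis .
    qed
    have gpi: "g (-pi) = g pi" using trig_poly_periodic[OF g, of "-pi"] by simp
    have g\<phi>: "g x * \<phi> x = of_real ((cmod (g x))\<^sup>2 / (cmod (g x) + \<delta>))" for x
      by (simp add: \<phi>_def complex_norm_square del: of_real_power)
    have hp: "integrable circ (\<lambda>x. h x * \<phi> x)" by (rule integrable_mult_bounded[OF h \<phi>m \<phi>1])
    have gp: "integrable circ (\<lambda>x. g x * \<phi> x)" by (rule integrable_mult_bounded[OF gi \<phi>m \<phi>1])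
    \<comment> \<open>In general \<open>\<phi>\<close> is not a trigonometric polynomial, but it is
      a uniform limit of such, and \<open>h\<close> integrates to zero against each of them.\<close>
    have h\<phi>: "cmod (\<integral>x. h x * \<phi> x \<partial>circ) \<le> 0 + \<eta>" if "\<eta> > 0" for \<eta> :: real
    proof -
      \<comment> \<open>The added 1 keeps \<open>H\<close> positive even if the norm of
        \<open>h\<close> is zero.\<close>
      define H where "H = (\<integral>x. cmod (h x) \<partial>circ) + 1"
      have H: "H > 0" unfolding H_def by (intro add_nonneg_pos integral_nonneg) auto
      have cc: "continuous_on {-pi..pi} \<phi>" using \<phi>c continuous_on_subset by blast
      have "\<eta> / H > 0" using that H by simp
      then obtain p where p: "trig_poly p" "\<And>x. x \<in> {-pi..pi} \<Longrightarrow> cmod (\<phi> x - p x) < \<eta> / H"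
        using trig_poly_approx[OF cc] gpi by (metis \<phi>_def)
      have hb: "cmod (h x * (\<phi> x - p x)) \<le> \<eta> / H * cmod (h x)" if "x \<in> {-pi..pi}" for x
        using mult_left_mono[OF less_imp_le[OF p(2)[OF that]], of "cmod (h x)"]
        by (simp add: norm_mult mult.commute)
      have nm: "cmod (of_real (\<eta> / H) * z) = \<eta> / H * cmod z" for z :: complex
        unfolding norm_mult norm_of_real using H that by simp
      have ph: "integrable circ (\<lambda>x. h x * (\<phi> x - p x))"
      proof (rule Bochner_Integration.integrable_bound)
        show "integrable circ (\<lambda>x. of_real (\<eta> / H) * h x)" using h by simp
        show "(\<lambda>x. h x * (\<phi> x - p x)) \<in> borel_measurable circ"
          using h \<phi>m trig_poly_integrable[OF p(1)] by simp
        show "AE x in circ. cmod (h x * (\<phi> x - p x)) \<le> cmod (of_real (\<eta> / H) * h x)"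
          unfolding nm by (rule AE_I2, rule hb) simp
      qed
      have "(\<integral>x. h x * \<phi> x \<partial>circ) = (\<integral>x. h x * (\<phi> x - p x) \<partial>circ) + (\<integral>x. h x * p x \<partial>circ)"
      proof -
        have "integrable circ (\<lambda>x. h x * \<phi> x - h x * (\<phi> x - p x))" using hp ph by simp
        then have "integrable circ (\<lambda>x. h x * p x)" by (simp add: ring_distribs)
        then show ?thesis using ph by (simp add: ring_distribs flip: Bochner_Integration.integral_add)
      qed
      also have "(\<integral>x. h x * p x \<partial>circ) = 0" by (rule integral_times_trig_poly_eq_0[OF h z p(1)])
      finally have "cmod (\<integral>x. h x * \<phi> x \<partial>circ) \<le> (\<integral>x. cmod (h x * (\<phi> x - p x)) \<partial>circ)"
        using integral_norm_bound[of circ "\<lambda>x. h x * (\<phi> x - p x)"] by simp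
      also have "\<dots> \<le> (\<integral>x. \<eta> / H * cmod (h x) \<partial>circ)"
      proof (rule integral_mono)
        show "cmod (h x * (\<phi> x - p x)) \<le> \<eta> / H * cmod (h x)" if "x \<in> space circ" for x
          by (rule hb) (use that in simp)
      qed (use h ph in auto)
      also have "\<dots> = \<eta> / H * (H - 1)" by (simp add: H_def)
      also have "\<dots> \<le> \<eta>" using H that by (simp add: field_simps)
      finally show ?thesis by simp
    qed
    then have h\<phi>0: "(\<integral>x. h x * \<phi> x \<partial>circ) = 0"
      using field_le_epsilon[of "cmod (\<integral>x. h x * \<phi> x \<partial>circ)" 0] by simp
    have "(\<integral>x. cmod (g x) - \<delta> \<partial>circ) \<le> (\<integral>x. Re (g x * \<phi> x) \<partial>circ)"
    proof (rule integral_mono)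
      fix x
      have "(cmod (g x) - \<delta>) * (cmod (g x) + \<delta>) \<le> (cmod (g x))\<^sup>2"
        by (simp add: algebra_simps power2_eq_square)
      then show "cmod (g x) - \<delta> \<le> Re (g x * \<phi> x)"
        using d by (simp add: g\<phi> pos_le_divide_eq add_nonneg_pos)
    qed (use gi integrable_bounded_linear[OF bounded_linear_Re gp] in auto)
    also have "\<dots> = Re (\<integral>x. g x * \<phi> x \<partial>circ)"
      by (rule integral_bounded_linear[OF bounded_linear_Re gp])
    also have "\<dots> = Re (\<integral>x. g x * \<phi> x - h x * \<phi> x \<partial>circ)" using gp hp h\<phi>0 by simp
    also have "\<dots> \<le> (\<integral>x. cmod (g x * \<phi> x - h x * \<phi> x) \<partial>circ)"
      by (rule order_trans[OF complex_Re_le_cmod integral_norm_bound])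
    also have "\<dots> \<le> (\<integral>x. cmod (h x - g x) \<partial>circ)"
    proof (rule integral_mono)
      fix x
      have "cmod (g x * \<phi> x - h x * \<phi> x) = cmod (h x - g x) * cmod (\<phi> x)"
        by (simp add: norm_minus_commute flip: left_diff_distrib norm_mult)
      also have "\<dots> \<le> cmod (h x - g x)" by (rule mult_left_le[OF \<phi>1]) simp
      finally show "cmod (g x * \<phi> x - h x * \<phi> x) \<le> cmod (h x - g x)" .
    qed (use gi gp h hp in auto)
    finally have 1: "(\<integral>x. cmod (g x) \<partial>circ) - 2 * pi * \<delta> \<le> e / 3"
      using hg gi measure_circ by (simp add: space_restrict_space)
    have "(\<integral>x. cmod (h x) \<partial>circ) \<le> (\<integral>x. cmod (h x - g x) + cmod (g x) \<partial>circ)"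
      by (rule integral_mono) (use h gi norm_triangle_sub[of "h _" "g _"] in \<open>auto simp: add.commute\<close>)
    also have "\<dots> = (\<integral>x. cmod (h x - g x) \<partial>circ) + (\<integral>x. cmod (g x) \<partial>circ)" using h gi by simp
    finally show ?thesis using 1 hg by (simp add: \<delta>_def)
  qed
  have "(\<integral>x. cmod (h x) \<partial>circ) \<le> 0" using field_le_epsilon[OF le] .
  then have "(\<integral>x. cmod (h x) \<partial>circ) = 0" by (intro antisym integral_nonneg) auto
  then show ?thesis using h by (subst (asm) integral_nonneg_eq_0_iff_AE) auto
qed

section \<open>Approximate eigenbases for trigonometric polynomial symbols\<close>

lemma cis_eq_1_iff_int: "cis x = 1 \<longleftrightarrow> (\<exists>k::int. x = of_int k * (2 * pi))"
  by (simp add: cis_conv_exp exp_eq_1 mult_ac)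

lemma sum_cis_roots:
  assumes "m > 0"
  shows "(\<Sum>s<m. cis (real s * (2 * pi * of_int d / real m))) = (if int m dvd d then of_nat m else 0)"
proof -
  define z where "z = cis (2 * pi * of_int d / real m)"
  have p: "cis (real s * (2 * pi * of_int d / real m)) = z ^ s" for s
    unfolding z_def by (rule Complex.DeMoivre[symmetric])
  have z1: "z = 1 \<longleftrightarrow> int m dvd d"
  proof -
    have "z = 1 \<longleftrightarrow> (\<exists>k::int. of_int d = (of_int (int m * k) :: real))"
      unfolding z_def cis_eq_1_iff_int using assms by (simp add: field_simps)
    then show ?thesis by (simp only: of_int_eq_iff dvd_def)
  qed
  show ?thesis
    unfolding p
  proof (cases "z = 1")
    case True
    then show "(\<Sum>s<m. z ^ s) = (if int m dvd d then of_nat m else 0)" using z1 by simp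
  next
    case False
    have "z ^ m = cis (2 * pi * of_int d)" unfolding z_def Complex.DeMoivre using assms by simp
    then have "z ^ m = 1" by (simp add: cis_multiple_2pi)
    then show "(\<Sum>s<m. z ^ s) = (if int m dvd d then of_nat m else 0)"
      using False z1 by (simp add: sum_gp_strict)
  qed
qed

lemma sum_cis_orthogonal:
  assumes "j < m" "k < m"
  shows "(\<Sum>s<m. cis (- (real s * (2 * pi * real j / real m))) * cnj (cis (- (real s * (2 * pi * real k / real m)))))
    = (if j = k then of_nat m else 0)"
proof -
  have "cis (- (real s * (2 * pi * real j / real m))) * cnj (cis (- (real s * (2 * pi * real k / real m))))
      = cis (real s * (2 * pi * of_int (int k - int j) / real m))" for s
    by (simp add: cis_cnj cis_mult diff_divide_distrib algebra_simps)
  moreover have "int m dvd int k - int j \<longleftrightarrow> j = k"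
  proof
    assume "int m dvd int k - int j"
    then have "int k mod int m = int j mod int m" by (simp add: mod_eq_dvd_iff)
    then show "j = k" using assms by (simp flip: of_nat_mod)
  qed simp
  ultimately show ?thesis using assms sum_cis_roots[of m "int k - int j"] by simp
qed

lemma integral_circ_cis: "(\<integral>x. cis (of_int k * x) \<partial>circ) = (if k = 0 then 2 * of_real pi else 0)"
proof (cases "k = 0")
  case True
  then show ?thesis using measure_circ by (simp add: space_restrict_space scaleR_conv_of_real)
next
  case False
  define F where "F x = cis (of_int k * x) / (\<i> * of_int k)" for x
  have "((\<lambda>x. cis (of_int k * x)) has_integral (F pi - F (-pi))) {-pi..pi}"
  proof (rule fundamental_theorem_of_calculus)
    fix x :: real
    have "((\<lambda>z. exp (\<i> * of_int k * z) / (\<i> * of_int k)) has_field_derivative exp (\<i> * of_int k * of_real x)) (at (of_real x))"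
      using False by (auto intro!: derivative_eq_intros)
    from has_vector_derivative_real_field[OF this]
    show "(F has_vector_derivative cis (of_int k * x)) (at x within {-pi..pi})"
      by (auto simp: F_def[abs_def] cis_conv_exp mult_ac intro: has_vector_derivative_at_within)
  qed simp
  moreover have "F pi = F (-pi)"
    using trig_poly_periodic[OF trig_poly.monom[of 1 k], of "-pi"] by (simp add: F_def)
  ultimately have "integral {-pi..pi} (\<lambda>x. cis (of_int k * x)) = 0" by (simp add: integral_unique)
  then show ?thesis
    using False trig_poly_integrable[OF trig_poly.monom[of 1 k]] by (simp add: lebesgue_integral_eq_integral)
qed

text \<open>The two facts used about a trigonometric polynomial of degree at most \<open>r\<close>:
  its Toeplitz matrices are banded, and the same coefficients that fill the band evaluate
  \<open>g\<close> pointwise.\<close>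

locale trig_symbol =
  fixes g :: "real \<Rightarrow> complex" and r :: nat
  assumes coeff_0: "\<bar>k\<bar> > int r \<Longrightarrow> fourier_coeff g k = 0"
    and expansion: "g x = (\<Sum>k = - int r..int r. fourier_coeff g k * cis (of_int k * x))"

lemma trig_poly_symbol:
  assumes "trig_poly g"
  obtains r where "trig_symbol g r"
proof -
  obtain r :: nat and c where g: "g = (\<lambda>x. \<Sum>k = - int r..int r. c k * cis (of_int k * x))"
    using trig_poly_sum[OF assms] by blast
  have fc: "fourier_coeff g k = (if k \<in> {- int r..int r} then c k else 0)" for k
  proof -
    have "g x * cis (- (of_int k * x)) = (\<Sum>j = - int r..int r. c j * cis (of_int (j - k) * x))" for x
      by (simp add: g sum_distrib_right mult.assoc cis_mult left_diff_distrib)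
    moreover have "integrable circ (\<lambda>x. c j * cis (of_int (j - k) * x))" for j
      by (rule trig_poly_integrable[OF trig_poly.monom])
    ultimately have "(\<integral>x. g x * cis (- (of_int k * x)) \<partial>circ) = (\<Sum>j = - int r..int r. c j * (\<integral>x. cis (of_int (j - k) * x) \<partial>circ))"
      by (simp add: Bochner_Integration.integral_sum del: of_int_diff)
    also have "\<dots> = (if k \<in> {- int r..int r} then c k * (2 * of_real pi) else 0)"
      unfolding integral_circ_cis by (simp add: if_distrib cong: if_cong)
    finally show ?thesis by (simp add: fourier_coeff_circ)
  qed
  have "trig_symbol g r"
  proof
    show "g x = (\<Sum>k = - int r..int r. fourier_coeff g k * cis (of_int k * x))" for x
      unfolding fc by (subst g) (intro sum.cong, auto)
  qed (auto simp: fc)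
  then show thesis by (rule that)
qed

text \<open>Meant for residuals: they live on a bounded number of exceptional rows, with entries of
  order \<open>1 / sqrt n\<close>, so their length is also of order
  \<open>1 / sqrt n\<close>.\<close>

lemma l2_sparse:
  assumes "\<And>s. s < n \<Longrightarrow> s \<notin> S \<Longrightarrow> x s = 0" "\<And>s. s < n \<Longrightarrow> cmod (x s) \<le> K"
    and S: "finite S" "card S \<le> b" and K: "0 \<le> K"
  shows "l2 n x \<le> sqrt (real b) * K"
proof -
  have "(\<Sum>s<n. (cmod (x s))\<^sup>2) = (\<Sum>s\<in>{..<n} \<inter> S. (cmod (x s))\<^sup>2)"
    by (rule sum.mono_neutral_right) (use assms(1) in auto)
  also have "\<dots> \<le> (\<Sum>s\<in>{..<n} \<inter> S. K\<^sup>2)"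
    by (rule sum_mono) (use assms(2) in \<open>auto intro: power_mono\<close>)
  also have "\<dots> = real (card ({..<n} \<inter> S)) * K\<^sup>2" by simp
  also have "\<dots> \<le> real b * K\<^sup>2"
    using card_mono[OF S(1), of "{..<n} \<inter> S"] S(2) by (intro mult_right_mono) auto
  finally show ?thesis
    using K real_sqrt_le_mono by (fastforce simp: l2_def L2_set_def real_sqrt_mult)
qed

context trig_symbol
begin

text \<open>The norm of \<open>g\<close> in the Wiener algebra. It bounds both the supremum of
  \<open>|g|\<close> and every absolute row sum of the Toeplitz matrices.\<close>

definition csum :: real where
  "csum = (\<Sum>k = - int r..int r. cmod (fourier_coeff g k))"

lemma csum_nonneg: "0 \<le> csum" by (simp add: csum_def sum_nonneg)

lemma norm_le_csum: "cmod (g x) \<le> csum"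
  unfolding csum_def expansion[of x] by (rule order_trans[OF norm_sum]) (simp add: norm_mult)

text \<open>Within one row or one column of a plain or flipped Toeplitz matrix every coefficient
  occurs at most once, which is what injectivity of \<open>h\<close> expresses.\<close>

lemma sum_coeff_le:
  assumes "finite T" "inj_on h T"
  shows "(\<Sum>t\<in>T. cmod (fourier_coeff g (h t))) \<le> csum"
proof -
  have nz: "- int r \<le> k \<and> k \<le> int r" if "fourier_coeff g k \<noteq> 0" for k
    using coeff_0[of k] that by linarith
  have "(\<Sum>t\<in>T. cmod (fourier_coeff g (h t))) = (\<Sum>k\<in>h ` T. cmod (fourier_coeff g k))"
    using assms(2) by (simp add: sum.reindex)
  also have "\<dots> = (\<Sum>k\<in>h ` T \<inter> {- int r..int r}. cmod (fourier_coeff g k))"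
    using assms(1) by (intro sum.mono_neutral_right) (auto dest: nz)
  also have "\<dots> \<le> csum" unfolding csum_def by (rule sum_mono2) auto
  finally show ?thesis .
qed

lemma row_bound:
  assumes "\<And>t. t < n \<Longrightarrow> cmod (x t) \<le> K" "0 \<le> K"
  shows "cmod (mat_app n (toep q g) x s) \<le> csum * K"
proof -
  have "cmod (mat_app n (toep q g) x s) \<le> (\<Sum>t<n. cmod (fourier_coeff g (int (q s) - int t)) * K)"
    unfolding mat_app_def toep_def
    by (rule order_trans[OF norm_sum]) (use assms in \<open>auto simp: norm_mult intro!: sum_mono mult_left_mono\<close>)
  also have "\<dots> \<le> csum * K"
    unfolding sum_distrib_right[symmetric]
    by (intro mult_right_mono sum_coeff_le assms) (auto simp: inj_on_def)
  finally show ?thesis .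
qed

text \<open>By bandedness, row \<open>s\<close> sees only the entries of \<open>x\<close> within
  distance \<open>r\<close> of \<open>q s\<close>. If \<open>x\<close> is a pure exponential in this
  window, the row multiplies it by \<open>g \<theta>\<close>, whatever \<open>x\<close> does
  elsewhere. This allows vectors that are exponentials on pieces of the index range only.\<close>

lemma toep_window:
  assumes "r \<le> q s" "q s + r < n"
    and x: "\<And>t. q s \<le> t + r \<Longrightarrow> t \<le> q s + r \<Longrightarrow> x t = a * cis (- (real t * \<theta>))"
  shows "mat_app n (toep q g) x s = a * cis (- (real (q s) * \<theta>)) * g \<theta>"
proof -
  define p where "p = q s"
  have "mat_app n (toep q g) x s = (\<Sum>t\<in>{p-r..p+r}. fourier_coeff g (int p - int t) * x t)"
    unfolding mat_app_def toep_def p_def[symmetric]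
    by (rule sum.mono_neutral_right) (use assms(1,2) coeff_0 in \<open>auto simp: p_def[symmetric]\<close>)
  also have "\<dots> = (\<Sum>t\<in>{p-r..p+r}. fourier_coeff g (int p - int t) * (a * cis (- (real t * \<theta>))))"
    by (intro sum.cong refl) (use x assms(1) in \<open>auto simp: p_def[symmetric]\<close>)
  also have "\<dots> = (\<Sum>k = - int r..int r. fourier_coeff g k * (a * cis (- (of_int (int p - k) * \<theta>))))"
    by (rule sum.reindex_bij_witness[of _ "\<lambda>k. nat (int p - k)" "\<lambda>t. int p - int t"])
       (use assms(1) in \<open>auto simp: p_def[symmetric]\<close>)
  also have "\<dots> = (\<Sum>k = - int r..int r. a * cis (- (real p * \<theta>)) * (fourier_coeff g k * cis (of_int k * \<theta>)))"
    by (intro sum.cong refl) (simp add: cis_mult algebra_simps)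
  finally show ?thesis by (simp add: p_def expansion[of \<theta>] sum_distrib_left)
qed

text \<open>The discrete Fourier basis would diagonalise the corresponding circulant matrix. Here
  only the first and the last \<open>r\<close> rows, whose windows leave the index range, can fail.
  That gives a residual of order \<open>1 / sqrt n\<close> for each of the \<open>n\<close>
  vectors.\<close>

lemma toeplitz_approx_basis:
  assumes real: "\<And>x. g x \<in> \<real>" and n: "n > 0"
  shows "\<exists>v. orthonormal n n v \<and>
    (\<Sum>j<n. l2 n (\<lambda>s. mat_app n (toep id g) (v j) s - of_real (Re (g (2 * pi * real j / real n))) * v j s))
      \<le> sqrt (real (2 * r)) * (2 * csum) * sqrt (real n)"
proof -
  define \<theta> where "\<theta> j = 2 * pi * real j / real n" for j
  define v where "v j s = of_real (1 / sqrt (real n)) * cis (- (real s * \<theta> j))" for j s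
  have on: "orthonormal n n v"
  proof -
    have "cdot n (v j) (v k) = of_real (1 / real n) * (\<Sum>s<n. cis (- (real s * \<theta> j)) * cnj (cis (- (real s * \<theta> k))))" for j k
      by (simp add: cdot_def v_def sum_divide_distrib mult_ac flip: of_real_mult)
    note * = this
    show ?thesis
      unfolding orthonormal_def * \<theta>_def using n sum_cis_orthogonal[of _ n] by simp
  qed
  have vn: "cmod (v j s) = 1 / sqrt (real n)" for j s by (simp add: v_def norm_divide)
  have "l2 n (\<lambda>s. mat_app n (toep id g) (v j) s - of_real (Re (g (\<theta> j))) * v j s) \<le> sqrt (real (2 * r)) * (2 * csum / sqrt (real n))" for j
  proof (rule l2_sparse[where S="{..<r} \<union> {n-r..<n}"])
    show "mat_app n (toep id g) (v j) s - of_real (Re (g (\<theta> j))) * v j s = 0" if "s < n" "s \<notin> {..<r} \<union> {n-r..<n}" for s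
    proof -
      have "r \<le> s" "s + r < n" using that by auto
      then show ?thesis
        using toep_window[of id s n "v j" "of_real (1 / sqrt (real n))" "\<theta> j"] real[of "\<theta> j"]
        by (simp add: v_def mult_ac)
    qed
    show "cmod (mat_app n (toep id g) (v j) s - of_real (Re (g (\<theta> j))) * v j s) \<le> 2 * csum / sqrt (real n)" for s
    proof -
      have "cmod (mat_app n (toep id g) (v j) s) \<le> csum * (1 / sqrt (real n))"
        by (rule row_bound) (simp_all add: vn)
      moreover have "cmod (of_real (Re (g (\<theta> j))) * v j s) \<le> csum * (1 / sqrt (real n))"
        unfolding norm_mult vn
        using order_trans[OF abs_Re_le_cmod norm_le_csum, of "\<theta> j"] by (intro mult_right_mono) auto
      ultimately show ?thesis
        using norm_triangle_ineq4[of "mat_app n (toep id g) (v j) s" "of_real (Re (g (\<theta> j))) * v j s"] by simp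
    qed
    have "card ({..<r} \<union> {n-r..<n}) \<le> card {..<r} + card {n-r..<n}" by (rule card_Un_le)
    then show "card ({..<r} \<union> {n-r..<n}) \<le> 2 * r" by simp
  qed (auto simp: csum_nonneg)
  then have "(\<Sum>j<n. l2 n (\<lambda>s. mat_app n (toep id g) (v j) s - of_real (Re (g (\<theta> j))) * v j s))
      \<le> (\<Sum>j<n. sqrt (real (2 * r)) * (2 * csum / sqrt (real n)))"
    by (rule sum_mono)
  also have "\<dots> = sqrt (real (2 * r)) * (2 * csum) * (real n / sqrt (real n))" by simp
  also have "real n / sqrt (real n) = sqrt (real n)" by (simp add: real_div_sqrt)
  finally show ?thesis using on unfolding \<theta>_def by blast
qed

text \<open>Each half of the index range carries its own Fourier vectors, so the sampling grid has
  \<open>n div 2\<close> points, once for either sign. For odd \<open>n\<close> the middle index is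
  left over; its value 0 is arbitrary, as a single index has no weight in the limit.\<close>

definition hankel_eval :: "nat \<Rightarrow> nat \<Rightarrow> real" where
  "hankel_eval n j = (let m = n div 2 in
     if j < m then cmod (g (2 * pi * real j / real m))
     else if n - m \<le> j then - cmod (g (2 * pi * real (j - (n - m)) / real m)) else 0)"

text \<open>
  On the first half the basis vectors are \<open>exp (-\<i>s\<theta>)\<close>, on the second half \<open>\<plusminus>\<rho> exp (-\<i>(n - 1 - s)\<theta>)\<close>. Away
  from the ends of the two halves, \<open>H\<^sub>n(g)\<close> turns them into \<open>\<plusminus>\<rho> cnj g(\<theta>) exp (-\<i>s\<theta>)\<close> and
  \<open>g(\<theta>) exp (-\<i>(n - 1 - s)\<theta>)\<close>, so the phase \<open>\<rho> = g(\<theta>) / \<bar>g(\<theta>)\<bar>\<close> gives the eigenvalue \<open>\<plusminus>\<bar>g(\<theta>)\<bar>\<close>. For odd \<open>n\<close>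
  the middle unit vector completes the basis.
\<close>

lemma hankel_approx_basis:
  assumes sym: "\<And>x. g (- x) = cnj (g x)" and n: "n \<ge> 2"
  shows "\<exists>v. orthonormal n n v \<and>
    (\<Sum>j<n. l2 n (\<lambda>s. mat_app n (toep (\<lambda>s. n - 1 - s) g) (v j) s - of_real (hankel_eval n j) * v j s))
      \<le> (sqrt (real (4 * r + 1)) * (2 * csum) * 2 + csum) * sqrt (real n)"
proof -
  define m where "m = n div 2"
  define l where "l = n - m"
  have ml: "m \<le> l" "l \<le> m + 1" "l + m = n" "m > 0" using n by (auto simp: m_def l_def)
  define \<theta> where "\<theta> j = 2 * pi * real j / real m" for j
  \<comment> \<open>Where \<open>g\<close> vanishes any phase will do; 1 keeps
    \<open>|\<rho>| = 1\<close> and preserves \<open>\<rho> * |g| = g\<close>.\<close>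
  define \<rho> where "\<rho> j = (if g (\<theta> j) = 0 then 1 else g (\<theta> j) / of_real (cmod (g (\<theta> j))))" for j
  have \<rho>1: "cmod (\<rho> j) = 1" for j by (simp add: \<rho>_def norm_divide)
  have \<rho>g: "\<rho> j * of_real (cmod (g (\<theta> j))) = g (\<theta> j)" for j by (simp add: \<rho>_def)
  have \<rho>\<rho>: "\<rho> j * cnj (\<rho> j) = 1" for j using complex_norm_square[of "\<rho> j"] \<rho>1 by simp
  have \<rho>c: "\<rho> j * cnj (g (\<theta> j)) = of_real (cmod (g (\<theta> j)))" for j
  proof -
    have "\<rho> j * cnj (g (\<theta> j)) = \<rho> j * cnj (\<rho> j * of_real (cmod (g (\<theta> j))))" by (simp only: \<rho>g)
    also have "\<dots> = (\<rho> j * cnj (\<rho> j)) * of_real (cmod (g (\<theta> j)))" by simp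
    finally show ?thesis by (simp add: \<rho>\<rho>)
  qed
  \<comment> \<open>Each vector has \<open>2 * m\<close> nonzero entries, all of modulus
    \<open>b\<close>, so this normalises its length to 1.\<close>
  define b :: complex where "b = of_real (1 / sqrt (real (2 * m)))"
  have bb: "b * b * of_nat m = 1 / 2"
  proof -
    have "b * b * of_nat m = of_real (1 / sqrt (real (2 * m)) * (1 / sqrt (real (2 * m))) * real m)"
      by (simp only: b_def of_real_mult of_real_of_nat_eq)
    also have "1 / sqrt (real (2 * m)) * (1 / sqrt (real (2 * m))) * real m = 1 / 2"
      using ml by (simp add: field_simps)
    finally show ?thesis by simp
  qed
  define w where "w \<epsilon> j s = (if s < m then b * cis (- (real s * \<theta> j)) else if l \<le> s
      then b * of_real \<epsilon> * \<rho> j * cis (- (real (n - 1 - s) * \<theta> j)) else 0)" for \<epsilon> :: real and j s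
  define v where "v j = (if j < m then w 1 j else if l \<le> j then w (-1) (j - l) else (\<lambda>s. if s = j then 1 else 0))" for j
  \<comment> \<open>The last half is enumerated backwards, so that both halves of an inner product
    become sums over the same Fourier vectors of length \<open>m\<close>.\<close>
  have split: "(\<Sum>s<n. F s) = (\<Sum>s<m. F s) + (\<Sum>s\<in>{m..<l}. F s) + (\<Sum>s<m. F (n - 1 - s))" for F :: "nat \<Rightarrow> complex"
  proof -
    have "(\<Sum>s<n. F s) = (\<Sum>s<m. F s) + (\<Sum>s\<in>{m..<l}. F s) + (\<Sum>s\<in>{l..<n}. F s)"
      using ml by (simp add: sum.atLeastLessThan_concat flip: atLeast0LessThan)
    also have "(\<Sum>s\<in>{l..<n}. F s) = (\<Sum>s<m. F (n - 1 - s))"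
      by (rule sum.reindex_bij_witness[of _ "\<lambda>s. n - 1 - s" "\<lambda>s. n - 1 - s"]) (use ml in auto)
    finally show ?thesis .
  qed
  \<comment> \<open>The two halves contribute in the ratio 1 to
    \<open>\<epsilon> * \<epsilon>'\<close>. For equal grid points they add up to 1 if the signs
    agree and cancel if they differ; for different grid points both vanish.\<close>
  have ww: "cdot n (w \<epsilon> j) (w \<epsilon>' k) = (if j = k then of_real ((1 + \<epsilon> * \<epsilon>') / 2) else 0)" if jk: "j < m" "k < m" for \<epsilon> \<epsilon>' j k
  proof -
    define E where "E s = cis (- (real s * \<theta> j)) * cnj (cis (- (real s * \<theta> k)))" for s
    have SE: "(\<Sum>s<m. E s) = (if j = k then of_nat m else 0)"
      unfolding E_def \<theta>_def by (rule sum_cis_orthogonal[OF jk])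
    have bc: "cnj b = b" by (simp add: b_def)
    have "cdot n (w \<epsilon> j) (w \<epsilon>' k) = (\<Sum>s<m. b * b * E s) + 0 + (\<Sum>s<m. b * b * (of_real (\<epsilon> * \<epsilon>') * (\<rho> j * cnj (\<rho> k))) * E s)"
      unfolding cdot_def split
    proof (intro arg_cong2[where f="(+)"] sum.cong refl)
      show "(\<Sum>s\<in>{m..<l}. w \<epsilon> j s * cnj (w \<epsilon>' k s)) = 0" by (rule sum.neutral) (simp add: w_def)
      show "w \<epsilon> j (n - 1 - s) * cnj (w \<epsilon>' k (n - 1 - s)) = b * b * (of_real (\<epsilon> * \<epsilon>') * (\<rho> j * cnj (\<rho> k))) * E s"
        if "s \<in> {..<m}" for s
      proof -
        have "\<not> n - 1 - s < m" "l \<le> n - 1 - s" "n - 1 - (n - 1 - s) = s" using that ml by auto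
        then show ?thesis by (simp add: w_def E_def bc mult_ac)
      qed
    qed (simp add: w_def E_def bc mult_ac)
    also have "\<dots> = (b * b) * (\<Sum>s<m. E s) * (1 + of_real (\<epsilon> * \<epsilon>') * (\<rho> j * cnj (\<rho> k)))"
      unfolding sum_distrib_left[symmetric] by (simp add: algebra_simps)
    finally have *: "cdot n (w \<epsilon> j) (w \<epsilon>' k) = b * b * (\<Sum>s<m. E s) * (1 + of_real (\<epsilon> * \<epsilon>') * (\<rho> j * cnj (\<rho> k)))" .
    show ?thesis
    proof (cases "j = k")
      case True
      then have "cdot n (w \<epsilon> j) (w \<epsilon>' k) = 1 / 2 * (1 + of_real (\<epsilon> * \<epsilon>'))"
        unfolding * by (simp only: SE simp_thms if_True bb \<rho>\<rho> mult_1_right)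
      then show ?thesis using True by simp
    qed (simp add: * SE)
  qed
  have mid: "j = m \<and> l = m + 1" if "j < n" "\<not> j < m" "\<not> l \<le> j" for j using that ml by linarith
  have wmid: "w \<epsilon> k j = 0" if "\<not> j < m" "\<not> l \<le> j" for \<epsilon> k j using that by (simp add: w_def)
  have single: "cdot n (\<lambda>s. if s = j then 1 else 0) x = cnj (x j)" if "j < n" for x j
    using that by (simp add: cdot_def if_distrib[of "\<lambda>y. y * _"] cong: if_cong)
  have single': "cdot n x (\<lambda>s. if s = j then 1 else 0) = x j" if "j < n" for x j
    using single[OF that, of x] cdot_commute[of n x "\<lambda>s. if s = j then 1 else 0"] by simp
  have on: "orthonormal n n v"
    unfolding orthonormal_def
  proof (intro allI impI)
    fix j k assume jk: "j < n" "k < n"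
    have jl: "j - l < m" "k - l < m" using jk ml by linarith+
    show "cdot n (v j) (v k) = (if j = k then 1 else 0)"
    proof (cases "j < m")
      case j: True
      then show ?thesis
        using jk jl ml by (cases "k < m"; cases "l \<le> k") (auto simp: v_def ww single' wmid)
    next
      case j: False
      show ?thesis
      proof (cases "l \<le> j")
        case True
        then have eq: "j - l = k - l \<longleftrightarrow> j = k" if "l \<le> k" using that by linarith
        have vj: "v j = w (-1) (j - l)" using j True by (simp add: v_def)
        show ?thesis
          unfolding vj using jk jl ml j True eq
          by (cases "k < m"; cases "l \<le> k") (auto simp: v_def ww single' wmid)
      next
        case False
        then have vj: "v j = (\<lambda>s. if s = j then 1 else 0)" using j by (simp add: v_def)
        have jm: "j = m" "l = m + 1" using mid[OF jk(1) j False] by auto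
        show ?thesis unfolding vj single[OF jk(1)]
          using jk jl jm ml by (auto simp: v_def w_def)
      qed
    qed
  qed
  have wn: "cmod (w \<epsilon> j s) \<le> 1 / sqrt (real (2 * m))" if "\<bar>\<epsilon>\<bar> = 1" for \<epsilon> j s
    using that by (simp add: w_def b_def norm_mult norm_divide \<rho>1)
  let ?q = "\<lambda>s. n - 1 - s"
  have res: "l2 n (\<lambda>s. mat_app n (toep ?q g) (w \<epsilon> j) s - of_real (\<epsilon> * cmod (g (\<theta> j))) * w \<epsilon> j s)
      \<le> sqrt (real (4 * r + 1)) * (2 * csum / sqrt (real (2 * m)))" if e: "\<epsilon> = 1 \<or> \<epsilon> = -1" for \<epsilon> j
  \<comment> \<open>The exceptional rows are those whose window meets an end of the index range or
    the junction of the halves. They number at most \<open>r + (2 * r + 1) + r\<close>, the 1 being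
    the middle index of odd \<open>n\<close>.\<close>
  proof (rule l2_sparse[where S="{..<r} \<union> {m-r..<l+r} \<union> {n-r..<n}"])
    have ee: "of_real \<epsilon> * (of_real \<epsilon> * z) = (z::complex)" for z using e by auto
    show "mat_app n (toep ?q g) (w \<epsilon> j) s - of_real (\<epsilon> * cmod (g (\<theta> j))) * w \<epsilon> j s = 0"
      if s: "s < n" "s \<notin> {..<r} \<union> {m-r..<l+r} \<union> {n-r..<n}" for s
    proof -
      consider "r \<le> s" "s + r < m" | "l + r \<le> s" "s + r < n" using s by force
      then show ?thesis
      proof cases
        case 1
        \<comment> \<open>Read in the original index, the reversed exponential of the second half
          has frequency \<open>- \<theta> j\<close>. This is why \<open>g (- \<theta> j)\<close>
          appears, which \<open>sym\<close> converts into the conjugate needed to cancel the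
          phase.\<close>
        have c: "cis (- (real (n - 1 - t) * \<theta> j)) = cis (- (real (n - 1) * \<theta> j)) * cis (- (real t * - \<theta> j))"
          if "t < n" for t using that by (simp add: cis_mult of_nat_diff algebra_simps)
        have "mat_app n (toep ?q g) (w \<epsilon> j) s = (b * of_real \<epsilon> * \<rho> j * cis (- (real (n - 1) * \<theta> j))) * cis (- (real (?q s) * - \<theta> j)) * g (- \<theta> j)"
        proof (rule toep_window)
          fix t assume t: "?q s \<le> t + r" "t \<le> ?q s + r"
          then have "\<not> t < m" "l \<le> t" "t < n" using 1 ml by linarith+
          then show "w \<epsilon> j t = (b * of_real \<epsilon> * \<rho> j * cis (- (real (n - 1) * \<theta> j))) * cis (- (real t * - \<theta> j))"
            by (simp only: w_def c if_True if_False mult.assoc)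
        qed (use 1 ml in linarith)+
        also have "\<dots> = b * of_real \<epsilon> * (\<rho> j * cnj (g (\<theta> j))) * (cis (- (real (n - 1) * \<theta> j)) * cis (- (real (?q s) * - \<theta> j)))"
          by (simp add: sym mult_ac)
        also have "cis (- (real (n - 1) * \<theta> j)) * cis (- (real (?q s) * - \<theta> j)) = cis (- (real s * \<theta> j))"
          using c[of "?q s"] s(1) by simp
        finally have *: "mat_app n (toep ?q g) (w \<epsilon> j) s = b * of_real \<epsilon> * of_real (cmod (g (\<theta> j))) * cis (- (real s * \<theta> j))"
          by (simp only: \<rho>c)
        have "w \<epsilon> j s = b * cis (- (real s * \<theta> j))" using 1 by (simp add: w_def)
        then show ?thesis unfolding * by simp
      next
        case 2
        have "mat_app n (toep ?q g) (w \<epsilon> j) s = b * cis (- (real (?q s) * \<theta> j)) * g (\<theta> j)"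
        proof (rule toep_window)
          fix t assume t: "?q s \<le> t + r" "t \<le> ?q s + r"
          then have "t < m" using 2 ml by linarith
          then show "w \<epsilon> j t = b * cis (- (real t * \<theta> j))" by (simp add: w_def)
        qed (use 2 ml in linarith)+
        also have "\<dots> = b * cis (- (real (?q s) * \<theta> j)) * (\<rho> j * of_real (cmod (g (\<theta> j))))" by (simp only: \<rho>g)
        finally have *: "mat_app n (toep ?q g) (w \<epsilon> j) s = b * cis (- (real (?q s) * \<theta> j)) * (\<rho> j * of_real (cmod (g (\<theta> j))))" .
        have "\<not> s < m" "l \<le> s" using 2 ml by linarith+
        then have "w \<epsilon> j s = b * of_real \<epsilon> * \<rho> j * cis (- (real (?q s) * \<theta> j))" by (simp only: w_def if_True if_False)
        then have "of_real (\<epsilon> * cmod (g (\<theta> j))) * w \<epsilon> j s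
          = of_real \<epsilon> * (of_real \<epsilon> * (b * cis (- (real (?q s) * \<theta> j)) * (\<rho> j * of_real (cmod (g (\<theta> j))))))"
          by (simp only: of_real_mult mult_ac)
        then show ?thesis by (simp only: * ee diff_self)
      qed
    qed
    show "cmod (mat_app n (toep ?q g) (w \<epsilon> j) s - of_real (\<epsilon> * cmod (g (\<theta> j))) * w \<epsilon> j s) \<le> 2 * csum / sqrt (real (2 * m))" for s
    proof -
      have e1: "\<bar>\<epsilon>\<bar> = 1" using e by auto
      have "cmod (mat_app n (toep ?q g) (w \<epsilon> j) s) \<le> csum * (1 / sqrt (real (2 * m)))"
        by (rule row_bound) (use wn[OF e1] in simp_all)
      moreover have "cmod (of_real (\<epsilon> * cmod (g (\<theta> j))) * w \<epsilon> j s) \<le> csum * (1 / sqrt (real (2 * m)))"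
        unfolding norm_mult norm_of_real abs_mult e1
        using norm_le_csum[of "\<theta> j"] csum_nonneg by (intro mult_mono wn e1) auto
      ultimately show ?thesis
        using norm_triangle_ineq4[of "mat_app n (toep ?q g) (w \<epsilon> j) s" "of_real (\<epsilon> * cmod (g (\<theta> j))) * w \<epsilon> j s"] by simp
    qed
    have "card ({..<r} \<union> {m-r..<l+r} \<union> {n-r..<n}) \<le> card {..<r} + card {m-r..<l+r} + card {n-r..<n}"
      by (intro order_trans[OF card_Un_le] add_mono card_Un_le order_refl)
    then show "card ({..<r} \<union> {m-r..<l+r} \<union> {n-r..<n}) \<le> 4 * r + 1" using ml by simp
  qed (auto simp: csum_nonneg)
  define B where "B = sqrt (real (4 * r + 1)) * (2 * csum / sqrt (real (2 * m)))"
  have B0: "0 \<le> B" using csum_nonneg by (simp add: B_def)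
  define R where "R j = l2 n (\<lambda>s. mat_app n (toep ?q g) (v j) s - of_real (hankel_eval n j) * v j s)" for j
  have "R j \<le> B + (if j = m then csum else 0)" if j: "j < n" for j
  proof -
    consider "j < m" | "l \<le> j" "\<not> j < m" | "\<not> j < m" "\<not> l \<le> j" by blast
    then show ?thesis
    proof cases
      case 1
      then have "hankel_eval n j = 1 * cmod (g (\<theta> j))" "v j = w 1 j"
        by (simp_all add: hankel_eval_def v_def Let_def \<theta>_def m_def)
      then show ?thesis using res[of 1 j] 1 by (simp only: R_def B_def) simp
    next
      case 2
      then have "hankel_eval n j = (-1) * cmod (g (\<theta> (j - l)))" "v j = w (-1) (j - l)"
        by (simp_all add: hankel_eval_def v_def Let_def \<theta>_def m_def l_def)
      then have "R j \<le> B" using res[of "-1" "j - l"] by (simp only: R_def B_def) simp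
      then show ?thesis using csum_nonneg by auto
    next
      case 3
      then have jm: "j = m" using mid j by blast
      have h0: "hankel_eval n j = 0" using 3 by (simp add: hankel_eval_def Let_def m_def l_def)
      \<comment> \<open>On the middle unit vector with value 0 the residual is a full column of the
        matrix. It is merely bounded by \<open>csum\<close>, but it occurs only once.\<close>
      have "R j = L2_set (\<lambda>s. cmod (fourier_coeff g (int (?q s) - int j))) {..<n}"
        unfolding R_def l2_def h0 using 3 j
        by (simp add: v_def mat_app_def toep_def if_distrib[of "\<lambda>y. _ * y"] cong: if_cong)
      also have "\<dots> \<le> (\<Sum>s<n. \<bar>cmod (fourier_coeff g (int (?q s) - int j))\<bar>)" by (rule L2_set_le_sum_abs)
      also have "\<dots> \<le> csum" unfolding abs_norm_cancel by (rule sum_coeff_le) (auto simp: inj_on_def)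
      finally show ?thesis using B0 jm by simp
    qed
  qed
  then have "(\<Sum>j<n. R j) \<le> (\<Sum>j<n. B + (if j = m then csum else 0))" by (intro sum_mono) auto
  also have "\<dots> = real n * B + csum" using ml by (simp add: sum.distrib)
  finally have sum_R: "(\<Sum>j<n. R j) \<le> real n * B + csum" .
  have nB: "real n * B \<le> sqrt (real (4 * r + 1)) * (2 * csum) * 2 * sqrt (real n)"
  proof -
    \<comment> \<open>From \<open>n \<le> 2 * m + 1\<close> and \<open>m \<ge> 1\<close>; it lets
      \<open>sqrt n\<close> replace the normalisation \<open>sqrt (2 * m)\<close> at the cost of the
      factor 2 in the bound.\<close>
    have "real n \<le> 2\<^sup>2 * real (2 * m)" using ml by simp
    then have "sqrt (real n) \<le> 2 * sqrt (real (2 * m))"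
      using real_sqrt_le_mono by (fastforce simp only: real_sqrt_mult real_sqrt_abs abs_numeral)
    then have "sqrt (real n) / sqrt (real (2 * m)) \<le> 2" using ml by (simp add: divide_le_eq)
    from mult_left_mono[OF this, of "sqrt (real (4 * r + 1)) * (2 * csum) * sqrt (real n)"] csum_nonneg
    have "sqrt (real (4 * r + 1)) * (2 * csum) * sqrt (real n) * (sqrt (real n) / sqrt (real (2 * m)))
        \<le> sqrt (real (4 * r + 1)) * (2 * csum) * sqrt (real n) * 2" by simp
    also have "sqrt (real (4 * r + 1)) * (2 * csum) * sqrt (real n) * (sqrt (real n) / sqrt (real (2 * m)))
        = (sqrt (real n) * sqrt (real n)) * B" unfolding B_def by (simp only: times_divide_eq_right times_divide_eq_left mult_ac)
    also have "sqrt (real n) * sqrt (real n) = real n" by simp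
    finally show ?thesis by (simp only: mult_ac)
  qed
  have "csum \<le> csum * sqrt (real n)" using csum_nonneg n by (simp add: mult_le_cancel_left1)
  with sum_R nB have "(\<Sum>j<n. R j) \<le> (sqrt (real (4 * r + 1)) * (2 * csum) * 2 + csum) * sqrt (real n)"
    unfolding distrib_right by linarith
  then show ?thesis using on unfolding R_def by blast
qed

end

section \<open>Passing to the limit\<close>

lemma norm_diff_triangle4:
  "norm (x - z) \<le> norm (x - y) + norm (y - w) + norm (w - z)" for x :: "'a::real_normed_vector"
  using norm_triangle_ineq[of "x - y + (y - w)" "w - z"] norm_triangle_ineq[of "x - y" "y - w"] by simp

lemma norm_diff_less_thirds:
  fixes x :: "'a::real_normed_vector"
  assumes "norm (x - y) \<le> e / 3" "norm (y - w) < e / 3" "norm (w - z) \<le> e / 3"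
  shows "norm (x - z) < e"
  using norm_diff_triangle4[of x z y w] assms by linarith

text \<open>Equidistant sampling and the integral are both stable under uniform perturbation, so the
  statement passes from trigonometric polynomials, where it is an identity for large
  \<open>n\<close>, to continuous periodic functions.\<close>

lemma equidistribution:
  fixes \<phi> :: "real \<Rightarrow> complex"
  assumes c: "continuous_on UNIV \<phi>" and per: "\<And>x. \<phi> (x + 2 * pi) = \<phi> x"
  shows "(\<lambda>n. (\<Sum>j<n. \<phi> (2 * pi * real j / real n)) / of_nat n) \<longlonglongrightarrow> (\<integral>x. \<phi> x \<partial>circ) / (2 * of_real pi)"
proof (rule LIMSEQ_I)
  fix e :: real assume e: "e > 0"
  have cc: "continuous_on {-pi..pi} \<phi>" using c continuous_on_subset by blast
  have e3: "0 < e / 3" using e by simp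
  moreover have "\<phi> (-pi) = \<phi> pi" using per[of "-pi"] by simp
  ultimately obtain p where p: "trig_poly p" and ap: "\<And>x. x \<in> {-pi..pi} \<Longrightarrow> cmod (\<phi> x - p x) < e / 3"
    using trig_poly_approx[OF cc] by metis
  have \<phi>i: "integrable circ \<phi>" by (rule continuous_imp_integrable_real[OF cc])
  have pint: "integrable circ p" by (rule trig_poly_integrable[OF p])
  obtain r where "trig_symbol p r" using trig_poly_symbol[OF p] .
  then interpret trig_symbol p r .
  \<comment> \<open>Only frequencies divisible by \<open>n\<close> survive the sum over the sample
    points; for \<open>n > r\<close> the single such frequency in the spectrum of \<open>p\<close>
    is 0.\<close>
  have exact: "(\<Sum>j<n. p (2 * pi * real j / real n)) / of_nat n = (\<integral>x. p x \<partial>circ) / (2 * of_real pi)" if n: "n > r" for n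
  proof -
    have "p (2 * pi * real j / real n) = (\<Sum>k = - int r..int r. fourier_coeff p k * cis (real j * (2 * pi * of_int k / real n)))" for j
      unfolding expansion[of "2 * pi * real j / real n"] by (simp add: mult_ac)
    then have "(\<Sum>j<n. p (2 * pi * real j / real n))
        = (\<Sum>k = - int r..int r. fourier_coeff p k * (\<Sum>j<n. cis (real j * (2 * pi * of_int k / real n))))"
      by (simp only: sum_distrib_left) (rule sum.swap)
    also have "\<dots> = (\<Sum>k = - int r..int r. if k = 0 then fourier_coeff p k * of_nat n else 0)"
    proof (intro sum.cong refl)
      fix k assume k: "k \<in> {- int r..int r}"
      have "int n dvd k \<longleftrightarrow> k = 0"
      proof
        assume "int n dvd k"
        then show "k = 0" using k n by (cases "k = 0") (auto dest!: dvd_imp_le_int)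
      qed simp
      then show "fourier_coeff p k * (\<Sum>j<n. cis (real j * (2 * pi * of_int k / real n))) = (if k = 0 then fourier_coeff p k * of_nat n else 0)"
        using sum_cis_roots[of n k] n by simp
    qed
    also have "\<dots> = fourier_coeff p 0 * of_nat n" by simp
    finally show ?thesis using n by (simp add: fourier_coeff_circ)
  qed
  \<comment> \<open>The sample points lie between 0 and \<open>2 * pi\<close>, whereas the
    approximation is known between \<open>-pi\<close> and \<open>pi\<close>. Points beyond
    \<open>pi\<close> are moved back by one period.\<close>
  have ap': "cmod (\<phi> (2 * pi * real j / real n) - p (2 * pi * real j / real n)) \<le> e / 3" if "j < n" for j n
  proof -
    define x where "x = 2 * pi * real j / real n"
    have x: "0 \<le> x" "x \<le> 2 * pi" using that by (auto simp: x_def divide_le_eq)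
    show ?thesis
    proof (cases "x \<le> pi")
      case True
      then show ?thesis using ap[of x] x pi_gt_zero unfolding x_def[symmetric] by (simp add: less_imp_le)
    next
      case False
      then have "cmod (\<phi> (x - 2 * pi) - p (x - 2 * pi)) < e / 3" using x by (intro ap) auto
      then show ?thesis
        using per[of "x - 2 * pi"] trig_poly_periodic[OF p, of "x - 2 * pi"] unfolding x_def[symmetric] by simp
    qed
  qed
  have "cmod ((\<Sum>j<n. \<phi> (2 * pi * real j / real n)) / of_nat n - (\<integral>x. \<phi> x \<partial>circ) / (2 * of_real pi)) < e" if n: "n \<ge> Suc r" for n
  proof -
    have n': "n > r" "n > 0" using n by auto
    have 1: "cmod ((\<Sum>j<n. \<phi> (2 * pi * real j / real n)) / of_nat n - (\<Sum>j<n. p (2 * pi * real j / real n)) / of_nat n) \<le> e / 3"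
    proof -
      have "cmod (\<Sum>j<n. \<phi> (2 * pi * real j / real n) - p (2 * pi * real j / real n)) \<le> real n * (e / 3)"
        using sum_norm_bound[of "{..<n}" "\<lambda>j. \<phi> (2 * pi * real j / real n) - p (2 * pi * real j / real n)" "e / 3"] ap' by auto
      then show ?thesis
        using n' by (simp add: sum_subtractf norm_divide divide_le_eq mult.commute flip: diff_divide_distrib)
    qed
    have 2: "cmod ((\<integral>x. p x \<partial>circ) / (2 * of_real pi) - (\<integral>x. \<phi> x \<partial>circ) / (2 * of_real pi)) \<le> e / 3"
    proof -
      have "cmod (\<integral>x. p x - \<phi> x \<partial>circ) \<le> (\<integral>x. cmod (p x - \<phi> x) \<partial>circ)" by (rule integral_norm_bound)
      also have "\<dots> \<le> 2 * pi * (e / 3)"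
        by (rule integral_circ_bounded)
           (use \<phi>i pint ap in \<open>auto simp: norm_minus_commute intro: less_imp_le\<close>)
      finally have "cmod ((\<integral>x. p x \<partial>circ) - (\<integral>x. \<phi> x \<partial>circ)) \<le> 2 * pi * (e / 3)" using \<phi>i pint by simp
      then show ?thesis by (simp add: norm_divide divide_le_eq mult_ac flip: diff_divide_distrib)
    qed
    show ?thesis
      by (rule norm_diff_less_thirds[OF 1 _ 2]) (simp only: exact[OF n'(1)] diff_self norm_zero e3)
  qed
  then show "\<exists>no. \<forall>n\<ge>no. cmod ((\<Sum>j<n. \<phi> (2 * pi * real j / real n)) / of_nat n - (\<integral>x. \<phi> x \<partial>circ) / (2 * of_real pi)) < e"
    by blast
qed

lemma equidistribution_real:
  fixes \<phi> :: "real \<Rightarrow> real"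
  assumes c: "continuous_on UNIV \<phi>" and per: "\<And>x. \<phi> (x + 2 * pi) = \<phi> x"
  shows "(\<lambda>n. (\<Sum>j<n. \<phi> (2 * pi * real j / real n)) / real n) \<longlonglongrightarrow> (\<integral>x. \<phi> x \<partial>circ) / (2 * pi)"
proof -
  have "(\<lambda>n. (\<Sum>j<n. complex_of_real (\<phi> (2 * pi * real j / real n))) / of_nat n)
    \<longlonglongrightarrow> (\<integral>x. complex_of_real (\<phi> x) \<partial>circ) / (2 * of_real pi)"
    using assms by (intro equidistribution continuous_intros) simp_all
  moreover have "(\<integral>x. complex_of_real (\<phi> x) \<partial>circ) / (2 * of_real pi) = of_real ((\<integral>x. \<phi> x \<partial>circ) / (2 * pi))" by simp
  moreover have "(\<Sum>j<n. complex_of_real (\<phi> (2 * pi * real j / real n))) / of_nat n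
      = of_real ((\<Sum>j<n. \<phi> (2 * pi * real j / real n)) / real n)" for n by simp
  ultimately show ?thesis by (simp only: tendsto_of_real_iff)
qed

text \<open>The comparison of eigenvalue sums is used in both directions. The residuals on the side
  of \<open>f\<close> vanish, since \<open>u\<close> consists of exact eigenvectors, and the
  \<open>L^1\<close> bound holds for the diagonal of the difference in either basis.\<close>

lemma abs_sum_compare:
  assumes f: "integrable circ f" and g: "integrable circ g"
    and q: "bij_betw q {..<n} {..<n}" "\<And>s. s < n \<Longrightarrow> q (q s) = s"
    and u: "orthonormal n n u" and v: "orthonormal n n v"
    and eig: "\<And>i s. i < n \<Longrightarrow> s < n \<Longrightarrow> mat_app n (toep q f) (u i) s = of_real (lam i) * u i s"
    and res: "(\<Sum>j<n. l2 n (\<lambda>s. mat_app n (toep q g) (v j) s - of_real (mu j) * v j s)) \<le> R"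
    and fg: "(\<integral>x. cmod (f x - g x) \<partial>circ) \<le> e"
  shows "\<bar>(\<Sum>i<n. \<bar>lam i - c\<bar>) - (\<Sum>j<n. \<bar>mu j - c\<bar>)\<bar> \<le> real n / (2 * pi) * e + R"
proof -
  have z: "(\<Sum>i<n. l2 n (\<lambda>s. mat_app n (toep q f) (u i) s - of_real (lam i) * u i s)) = 0"
    by (rule sum.neutral) (auto simp: l2_def L2_set_def eig)
  have fg': "real n / (2 * pi) * (\<integral>x. cmod (f x - g x) \<partial>circ) \<le> real n / (2 * pi) * e"
    by (rule mult_left_mono[OF fg]) simp
  have gf': "real n / (2 * pi) * (\<integral>x. cmod (g x - f x) \<partial>circ) \<le> real n / (2 * pi) * e"
    using fg' by (simp only: norm_minus_commute)
  have gen: "\<bar>s - t\<bar> \<le> E + R" if "s \<le> t + d + z + r" "t \<le> s + d' + r + z" "d \<le> D" "d' \<le> D'" "D \<le> E" "D' \<le> E" "z = 0" "r \<le> R"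
    for s t d d' z r D D' E R :: real using that by linarith
  show ?thesis
    by (rule gen[OF sum_abs_eigen_compare[OF u v, of lam c mu "toep q f" "toep q g"]
      sum_abs_eigen_compare[OF v u, of mu c lam "toep q g" "toep q f"]
      toep_perturb[OF f g u q] toep_perturb[OF g f v q] fg' gf' z res])
qed

text \<open>For a fixed approximant the residuals add up to \<open>K * sqrt n\<close>, which
  disappears after division by \<open>n\<close>. What remains is an error proportional to the
  \<open>L^1\<close> distance, uniform in \<open>n\<close>, so \<open>L\<close> is determined by the
  limits \<open>l\<close> of the approximants even though \<open>K\<close> may grow with their
  accuracy.\<close>

lemma abs_limit:
  fixes lam :: "nat \<Rightarrow> nat \<Rightarrow> real"
  assumes f: "integrable circ f"
    and q: "\<And>n. bij_betw (q n) {..<n} {..<n}" "\<And>n s. s < n \<Longrightarrow> q n (q n s) = s"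
    and u: "\<And>n. orthonormal n n (u n)"
    and eig: "\<And>n i s. i < n \<Longrightarrow> s < n \<Longrightarrow> mat_app n (toep (q n) f) (u n i) s = of_real (lam n i) * u n i s"
    and approx: "\<And>e. e > 0 \<Longrightarrow> \<exists>g mu K l. integrable circ g \<and> (\<integral>x. cmod (f x - g x) \<partial>circ) \<le> e
      \<and> (\<forall>n\<ge>2. \<exists>v. orthonormal n n v \<and>
          (\<Sum>j<n. l2 n (\<lambda>s. mat_app n (toep (q n) g) (v j) s - of_real (mu n j) * v j s)) \<le> K * sqrt (real n))
      \<and> (\<lambda>n. (\<Sum>j<n. \<bar>mu n j - c\<bar>) / real n) \<longlonglongrightarrow> l \<and> \<bar>l - L\<bar> \<le> e"
  shows "(\<lambda>n. (\<Sum>i<n. \<bar>lam n i - c\<bar>) / real n) \<longlonglongrightarrow> L"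
proof (rule LIMSEQ_I)
  fix e :: real assume e: "e > 0"
  then obtain g mu K l where g: "integrable circ g" "(\<integral>x. cmod (f x - g x) \<partial>circ) \<le> e / 4"
    and v: "\<And>n. n \<ge> 2 \<Longrightarrow> \<exists>v. orthonormal n n v \<and>
          (\<Sum>j<n. l2 n (\<lambda>s. mat_app n (toep (q n) g) (v j) s - of_real (mu n j) * v j s)) \<le> K * sqrt (real n)"
    and l: "(\<lambda>n. (\<Sum>j<n. \<bar>mu n j - c\<bar>) / real n) \<longlonglongrightarrow> l" and L: "\<bar>l - L\<bar> \<le> e / 4"
    using approx[of "e / 4"] by auto
  have "(\<lambda>n. K / sqrt (real n)) \<longlonglongrightarrow> 0"
    by (rule real_tendsto_divide_at_top[OF tendsto_const filterlim_compose[OF sqrt_at_top filterlim_real_sequentially]])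
  from LIMSEQ_D[OF this, of "e / 4"] e obtain N1 where N1: "\<And>n. n \<ge> N1 \<Longrightarrow> \<bar>K / sqrt (real n)\<bar> < e / 4" by auto
  from LIMSEQ_D[OF l, of "e / 4"] e obtain N2 where N2: "\<And>n. n \<ge> N2 \<Longrightarrow> \<bar>(\<Sum>j<n. \<bar>mu n j - c\<bar>) / real n - l\<bar> < e / 4" by auto
  have "\<bar>(\<Sum>i<n. \<bar>lam n i - c\<bar>) / real n - L\<bar> < e" if n: "n \<ge> max 2 (max N1 N2)" for n
  proof -
    have n2: "n \<ge> 2" "n \<ge> N1" "n \<ge> N2" using n by auto
    obtain w where w: "orthonormal n n w"
      "(\<Sum>j<n. l2 n (\<lambda>s. mat_app n (toep (q n) g) (w j) s - of_real (mu n j) * w j s)) \<le> K * sqrt (real n)"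
      using v[OF n2(1)] by blast
    have "\<bar>(\<Sum>i<n. \<bar>lam n i - c\<bar>) - (\<Sum>j<n. \<bar>mu n j - c\<bar>)\<bar> \<le> real n / (2 * pi) * (e / 4) + K * sqrt (real n)"
      by (rule abs_sum_compare[OF f g(1) q u w(1) eig w(2) g(2)])
    then have "\<bar>(\<Sum>i<n. \<bar>lam n i - c\<bar>) - (\<Sum>j<n. \<bar>mu n j - c\<bar>)\<bar> / real n \<le> (real n / (2 * pi) * (e / 4) + K * sqrt (real n)) / real n"
      by (rule divide_right_mono) simp
    also have "\<dots> = e / 4 / (2 * pi) + K / sqrt (real n)"
    proof -
      have "K * sqrt (real n) / real n = K / sqrt (real n)" using n2 by (subst frac_eq_eq) auto
      then show ?thesis using n2 by (simp add: add_divide_distrib)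
    qed
    also have "e / 4 / (2 * pi) \<le> e / 4"
      using e pi_gt3 by (subst divide_le_eq) (auto simp: mult_le_cancel_left1)
    finally have "\<bar>(\<Sum>i<n. \<bar>lam n i - c\<bar>) / real n - (\<Sum>j<n. \<bar>mu n j - c\<bar>) / real n\<bar> \<le> e / 4 + K / sqrt (real n)"
      by (simp flip: diff_divide_distrib)
    then show ?thesis using N1[OF n2(2)] N2[OF n2(3)] L by linarith
  qed
  then show "\<exists>no. \<forall>n\<ge>no. norm ((\<Sum>i<n. \<bar>lam n i - c\<bar>) / real n - L) < e"
    unfolding real_norm_def by blast
qed

text \<open>The factor of each node value is a scaled second difference of \<open>|x - c|\<close> in
  \<open>c\<close>: the hat function of height 1 around \<open>k * d\<close>. The sum is thus the
  piecewise linear interpolant of \<open>F\<close>. At any \<open>x\<close> only the two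
  neighbouring hats are nonzero and their values are convex weights, so the error is an average of
  two differences of \<open>F\<close> over a distance of at most \<open>d\<close>.\<close>

lemma hat_sum:
  fixes F :: "real \<Rightarrow> complex"
  assumes d: "d > 0" and N: "\<And>x. \<bar>x\<bar> \<ge> real N * d \<Longrightarrow> F x = 0"
    and F: "\<And>x y. \<bar>x - y\<bar> \<le> d \<Longrightarrow> cmod (F x - F y) \<le> e"
  shows "cmod (F x - (\<Sum>k = - int N..int N. F (of_int k * d) *
    of_real ((\<bar>x - of_int (k - 1) * d\<bar> + \<bar>x - of_int (k + 1) * d\<bar> - 2 * \<bar>x - of_int k * d\<bar>) / (2 * d)))) \<le> e"
proof -
  define y where "y = x / d"
  define m where "m = \<lfloor>y\<rfloor>"
  define h where "h k = (\<bar>x - of_int (k - 1) * d\<bar> + \<bar>x - of_int (k + 1) * d\<bar> - 2 * \<bar>x - of_int k * d\<bar>) / (2 * d)" for k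
  have x: "x = y * d" using d by (simp add: y_def)
  have my: "of_int m \<le> y" "y < of_int m + 1" by (auto simp: m_def)
  have h: "h k = (\<bar>y - of_int (k - 1)\<bar> + \<bar>y - of_int (k + 1)\<bar> - 2 * \<bar>y - of_int k\<bar>) / 2" for k
  proof -
    have *: "\<bar>x - of_int j * d\<bar> = \<bar>y - of_int j\<bar> * d" for j
      using d by (simp add: x abs_mult flip: left_diff_distrib)
    have "h k = (\<bar>y - of_int (k - 1)\<bar> + \<bar>y - of_int (k + 1)\<bar> - 2 * \<bar>y - of_int k\<bar>) * d / (2 * d)"
      unfolding h_def * by (simp add: algebra_simps)
    then show ?thesis using d by simp
  qed
  have hm: "h m = 1 - (y - of_int m)" "h (m + 1) = y - of_int m" using my by (auto simp: h)
  have h0: "h k = 0" if "k \<notin> {m, m + 1}" for k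
  proof -
    have "k \<le> m - 1 \<or> k \<ge> m + 2" using that by auto
    then have "of_int k \<le> y - 1 \<or> of_int k \<ge> y + 1"
    proof
      assume "k \<le> m - 1"
      then have "real_of_int k \<le> of_int m - 1" by linarith
      then show ?thesis using my by linarith
    next
      assume "k \<ge> m + 2"
      then have "real_of_int k \<ge> of_int m + 2" by linarith
      then show ?thesis using my by linarith
    qed
    then show ?thesis by (auto simp: h)
  qed
  have F0: "F (of_int k * d) = 0" if "k \<notin> {- int N..int N}" for k
  proof (rule N)
    have "real N \<le> \<bar>real_of_int k\<bar>" using that by auto
    then show "real N * d \<le> \<bar>of_int k * d\<bar>" using d by (simp add: abs_mult)
  qed
  \<comment> \<open>The neighbours \<open>m\<close> and \<open>m + 1\<close> may lie outside the
    summation range. Adding them is harmless, because \<open>F\<close> vanishes at such nodes;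
    afterwards all other hats drop out.\<close>
  have "(\<Sum>k = - int N..int N. F (of_int k * d) * of_real (h k)) = (\<Sum>k\<in>{- int N..int N} \<union> {m, m+1}. F (of_int k * d) * of_real (h k))"
    by (rule sum.mono_neutral_left) (use F0 in auto)
  also have "\<dots> = (\<Sum>k\<in>{m, m+1}. F (of_int k * d) * of_real (h k))"
    by (rule sum.mono_neutral_right) (use h0 in auto)
  also have "\<dots> = F (of_int m * d) * of_real (1 - (y - of_int m)) + F (of_int (m + 1) * d) * of_real (y - of_int m)"
    by (simp add: hm)
  finally have S: "F x - (\<Sum>k = - int N..int N. F (of_int k * d) * of_real (h k))
      = (F x - F (of_int m * d)) * of_real (1 - (y - of_int m)) + (F x - F (of_int (m + 1) * d)) * of_real (y - of_int m)"
    by (simp add: algebra_simps)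
  have c1: "cmod (F x - F (of_int m * d)) \<le> e"
  proof (rule F)
    have "\<bar>x - of_int m * d\<bar> = \<bar>y - of_int m\<bar> * d" using d by (simp add: x abs_mult flip: left_diff_distrib)
    also have "\<dots> \<le> 1 * d" using my d by (intro mult_right_mono) auto
    finally show "\<bar>x - of_int m * d\<bar> \<le> d" by simp
  qed
  have c2: "cmod (F x - F (of_int (m + 1) * d)) \<le> e"
  proof (rule F)
    have "\<bar>x - of_int (m + 1) * d\<bar> = \<bar>y - of_int (m + 1)\<bar> * d" using d by (simp add: x abs_mult flip: left_diff_distrib)
    also have "\<dots> \<le> 1 * d" using my d by (intro mult_right_mono) auto
    finally show "\<bar>x - of_int (m + 1) * d\<bar> \<le> d" by simp
  qed
  have "cmod (F x - (\<Sum>k = - int N..int N. F (of_int k * d) * of_real (h k)))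
      \<le> cmod (F x - F (of_int m * d)) * (1 - (y - of_int m)) + cmod (F x - F (of_int (m + 1) * d)) * (y - of_int m)"
    unfolding S by (rule order_trans[OF norm_triangle_ineq]) (use my in \<open>simp add: norm_mult del: of_real_diff\<close>)
  also have "\<dots> \<le> e * (1 - (y - of_int m)) + e * (y - of_int m)"
    using c1 c2 my by (intro add_mono mult_right_mono) auto
  also have "\<dots> = e" by (simp add: algebra_simps)
  finally show ?thesis unfolding h_def .
qed

lemma uniformly_continuous_compact_support:
  fixes F :: "real \<Rightarrow> complex"
  assumes c: "continuous_on UNIV F" and R: "\<And>x. \<bar>x\<bar> > R \<Longrightarrow> F x = 0" and e: "e > 0"
  obtains d where "d > 0" "\<And>x y. \<bar>x - y\<bar> \<le> d \<Longrightarrow> cmod (F x - F y) \<le> e"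
proof -
  have "uniformly_continuous_on {- R - 1..R + 1} F"
    by (rule compact_uniformly_continuous) (auto intro: continuous_on_subset[OF c])
  then obtain d where d: "d > 0"
    "\<And>x y. x \<in> {- R - 1..R + 1} \<Longrightarrow> y \<in> {- R - 1..R + 1} \<Longrightarrow> dist y x < d \<Longrightarrow> dist (F y) (F x) < e"
    unfolding uniformly_continuous_on_def using e by metis
  show thesis
  \<comment> \<open>The bound 1 matches the margin of the enlarged interval: if one of the two
    points leaves it, the other is still beyond \<open>R\<close>, and both values are zero. Halving
    \<open>d\<close> turns the non-strict distance condition into the strict one.\<close>
  proof (rule that[of "min 1 (d / 2)"])
    show "min 1 (d / 2) > 0" using d by simp
    fix x y :: real assume xy: "\<bar>x - y\<bar> \<le> min 1 (d / 2)"
    show "cmod (F x - F y) \<le> e"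
    proof (cases "x \<in> {- R - 1..R + 1} \<and> y \<in> {- R - 1..R + 1}")
      case True
      then show ?thesis using d(2)[of y x] d(1) xy by (simp add: dist_norm)
    next
      case False
      then have "\<bar>x\<bar> > R" "\<bar>y\<bar> > R" using xy by auto
      then show ?thesis using R e by simp
    qed
  qed
qed

text \<open>Two functions \<open>a\<close> and \<open>b\<close> cover both applications: opposite
  signs for the flipped matrices, equal functions for the Toeplitz matrices. Hence the denominator
  is twice the length of the circle. The interpolant \<open>G\<close> is a finite combination of the
  functions \<open>|x - c|\<close>, and replacing \<open>F\<close> by it costs at most
  \<open>e / 3\<close> on either side of the limit.\<close>

lemma test_function_limit:
  fixes lam :: "nat \<Rightarrow> nat \<Rightarrow> real" and a b :: "real \<Rightarrow> real" and F :: "real \<Rightarrow> complex"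
  assumes a: "integrable circ a" and b: "integrable circ b"
    and lim: "\<And>c. (\<lambda>n. (\<Sum>i<n. \<bar>lam n i - c\<bar>) / real n) \<longlonglongrightarrow> (\<integral>x. \<bar>a x - c\<bar> + \<bar>b x - c\<bar> \<partial>circ) / (4 * pi)"
    and F: "continuous_on UNIV F" and supp: "\<And>x. \<bar>x\<bar> > R \<Longrightarrow> F x = 0"
  shows "(\<lambda>n. (\<Sum>i<n. F (lam n i)) / of_nat n) \<longlonglongrightarrow> (\<integral>x. F (a x) + F (b x) \<partial>circ) / (4 * of_real pi)"
proof (rule LIMSEQ_I)
  fix e :: real assume e: "e > 0"
  then have e3: "e / 3 > 0" by simp
  obtain d where d: "d > 0" "\<And>x y. \<bar>x - y\<bar> \<le> d \<Longrightarrow> cmod (F x - F y) \<le> e / 3"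
    using uniformly_continuous_compact_support[OF F supp e3] by metis
  obtain N :: nat where "\<bar>R\<bar> / d + 1 \<le> real N" using real_arch_simple by blast
  then have "\<bar>R\<bar> < real N * d" using d(1) by (simp add: field_simps)
  then have N: "F x = 0" if "\<bar>x\<bar> \<ge> real N * d" for x using that by (intro supp) linarith
  define h where "h k x = (\<bar>x - of_int (k - 1) * d\<bar> + \<bar>x - of_int (k + 1) * d\<bar> - 2 * \<bar>x - of_int k * d\<bar>) / (2 * d)" for k :: int and x
  define G where "G x = (\<Sum>k = - int N..int N. F (of_int k * d) * of_real (h k x))" for x
  have FG: "cmod (F x - G x) \<le> e / 3" for x
    unfolding G_def h_def by (rule hat_sum[OF d(1) N d(2)])
  have abs_int: "integrable circ (\<lambda>x. \<bar>a x - c\<bar>)" "integrable circ (\<lambda>x. \<bar>b x - c\<bar>)" for c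
    using a b finite_measure.integrable_const[OF finite_measure_circ, of c] by simp_all
  have hlim: "(\<lambda>n. (\<Sum>i<n. h k (lam n i)) / real n) \<longlonglongrightarrow> (\<integral>x. h k (a x) + h k (b x) \<partial>circ) / (4 * pi)" for k
  proof -
    define S where "S c n = (\<Sum>i<n. \<bar>lam n i - c\<bar>) / real n" for c n
    define J where "J c = (\<integral>x. \<bar>a x - c\<bar> + \<bar>b x - c\<bar> \<partial>circ)" for c
    have "(\<lambda>n. (S (of_int (k - 1) * d) n + S (of_int (k + 1) * d) n - 2 * S (of_int k * d) n) / (2 * d))
      \<longlonglongrightarrow> (J (of_int (k - 1) * d) / (4 * pi) + J (of_int (k + 1) * d) / (4 * pi) - 2 * (J (of_int k * d) / (4 * pi))) / (2 * d)"
      unfolding S_def J_def by (intro tendsto_intros lim) (use d in auto)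
    moreover have "(S (of_int (k - 1) * d) n + S (of_int (k + 1) * d) n - 2 * S (of_int k * d) n) / (2 * d)
        = (\<Sum>i<n. h k (lam n i)) / real n" for n
    proof -
      have "(\<Sum>i<n. h k (lam n i)) = ((\<Sum>i<n. \<bar>lam n i - of_int (k - 1) * d\<bar>) + (\<Sum>i<n. \<bar>lam n i - of_int (k + 1) * d\<bar>)
          - 2 * (\<Sum>i<n. \<bar>lam n i - of_int k * d\<bar>)) / (2 * d)"
        unfolding h_def sum_distrib_left sum_divide_distrib[symmetric] by (simp only: sum.distrib sum_subtractf)
      then show ?thesis
        unfolding S_def by (simp add: add_divide_distrib diff_divide_distrib mult_ac)
    qed
    moreover have "(J (of_int (k - 1) * d) / (4 * pi) + J (of_int (k + 1) * d) / (4 * pi) - 2 * (J (of_int k * d) / (4 * pi))) / (2 * d)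
        = (\<integral>x. h k (a x) + h k (b x) \<partial>circ) / (4 * pi)"
    proof -
      have "(\<integral>x. h k (a x) + h k (b x) \<partial>circ) = (J (of_int (k - 1) * d) + J (of_int (k + 1) * d) - 2 * J (of_int k * d)) / (2 * d)"
        unfolding J_def h_def by (simp add: abs_int diff_divide_distrib add_divide_distrib)
      then show ?thesis by (simp add: diff_divide_distrib add_divide_distrib mult_ac)
    qed
    ultimately show ?thesis by simp
  qed
  have hint: "integrable circ (\<lambda>x. h k (a x))" "integrable circ (\<lambda>x. h k (b x))" for k
    unfolding h_def by (simp_all add: abs_int)
  have Gint: "integrable circ (\<lambda>x. G (a x))" "integrable circ (\<lambda>x. G (b x))"
    unfolding G_def using hint by simp_all
  have "(\<lambda>n. \<Sum>k = - int N..int N. F (of_int k * d) * of_real ((\<Sum>i<n. h k (lam n i)) / real n))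
      \<longlonglongrightarrow> (\<Sum>k = - int N..int N. F (of_int k * d) * of_real ((\<integral>x. h k (a x) + h k (b x) \<partial>circ) / (4 * pi)))"
    by (intro tendsto_intros hlim)
  moreover have "(\<Sum>k = - int N..int N. F (of_int k * d) * of_real ((\<Sum>i<n. h k (lam n i)) / real n)) = (\<Sum>i<n. G (lam n i)) / of_nat n" for n
    unfolding G_def by (subst sum.swap) (simp add: sum_distrib_left sum_divide_distrib)
  moreover have "(\<Sum>k = - int N..int N. F (of_int k * d) * of_real ((\<integral>x. h k (a x) + h k (b x) \<partial>circ) / (4 * pi)))
      = (\<integral>x. G (a x) + G (b x) \<partial>circ) / (4 * of_real pi)"
  proof -
    have "(\<integral>x. G (a x) + G (b x) \<partial>circ) = (\<integral>x. (\<Sum>k = - int N..int N. F (of_int k * d) * of_real (h k (a x) + h k (b x))) \<partial>circ)"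
      by (simp add: G_def sum.distrib ring_distribs)
    also have "\<dots> = (\<Sum>k = - int N..int N. F (of_int k * d) * of_real (\<integral>x. h k (a x) + h k (b x) \<partial>circ))"
      by (subst Bochner_Integration.integral_sum) (use hint in auto)
    finally show ?thesis by (simp add: sum_divide_distrib)
  qed
  ultimately have "(\<lambda>n. (\<Sum>i<n. G (lam n i)) / of_nat n) \<longlonglongrightarrow> (\<integral>x. G (a x) + G (b x) \<partial>circ) / (4 * of_real pi)" by simp
  from LIMSEQ_D[OF this e3] obtain n0 where n0: "\<And>n. n \<ge> n0 \<Longrightarrow>
      cmod ((\<Sum>i<n. G (lam n i)) / of_nat n - (\<integral>x. G (a x) + G (b x) \<partial>circ) / (4 * of_real pi)) < e / 3" by blast
  have Fm [measurable]: "F \<in> borel_measurable borel" by (rule borel_measurable_continuous_onI[OF F])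
  have am [measurable]: "a \<in> borel_measurable circ" "b \<in> borel_measurable circ" using a b by auto
  have Fint: "integrable circ (\<lambda>x. F (t x))" if t: "t \<in> borel_measurable circ" "integrable circ (\<lambda>x. G (t x))" for t
  proof -
    have "integrable circ (\<lambda>x. F (t x) - G (t x))"
    proof (rule finite_measure.integrable_const_bound[OF finite_measure_circ])
      show "AE x in circ. cmod (F (t x) - G (t x)) \<le> e / 3" using FG by simp
      show "(\<lambda>x. F (t x) - G (t x)) \<in> borel_measurable circ" using t by measurable
    qed
    from Bochner_Integration.integrable_add[OF this t(2)] show ?thesis by simp
  qed
  note Fi = Fint[OF am(1) Gint(1)] Fint[OF am(2) Gint(2)]
  have 2: "cmod ((\<integral>x. G (a x) + G (b x) \<partial>circ) / (4 * of_real pi) - (\<integral>x. F (a x) + F (b x) \<partial>circ) / (4 * of_real pi)) \<le> e / 3"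
  proof -
    have "cmod (\<integral>x. (G (a x) + G (b x)) - (F (a x) + F (b x)) \<partial>circ) \<le> (\<integral>x. cmod ((G (a x) + G (b x)) - (F (a x) + F (b x))) \<partial>circ)"
      by (rule integral_norm_bound)
    also have "\<dots> \<le> 2 * pi * (2 * (e / 3))"
    proof (rule integral_circ_bounded)
      show "cmod ((G (a x) + G (b x)) - (F (a x) + F (b x))) \<le> 2 * (e / 3)" for x
      proof -
        have GF: "cmod (G y - F y) \<le> e / 3" for y by (subst norm_minus_commute) (rule FG)
        have "G (a x) + G (b x) - (F (a x) + F (b x)) = (G (a x) - F (a x)) + (G (b x) - F (b x))" by simp
        then have "cmod (G (a x) + G (b x) - (F (a x) + F (b x))) \<le> cmod (G (a x) - F (a x)) + cmod (G (b x) - F (b x))"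
          by (simp only: norm_triangle_ineq)
        also have "\<dots> \<le> e / 3 + e / 3" by (intro add_mono GF)
        finally show ?thesis by simp
      qed
    qed (use Fi Gint in auto)
    finally have "cmod ((\<integral>x. G (a x) + G (b x) \<partial>circ) - (\<integral>x. F (a x) + F (b x) \<partial>circ)) \<le> 4 * pi * (e / 3)"
      using Fi Gint by simp
    then show ?thesis by (simp add: norm_divide norm_mult divide_le_eq mult_ac flip: diff_divide_distrib)
  qed
  have "cmod ((\<Sum>i<n. F (lam n i)) / of_nat n - (\<integral>x. F (a x) + F (b x) \<partial>circ) / (4 * of_real pi)) < e" if n: "n \<ge> max 1 n0" for n
  proof -
    have 1: "cmod ((\<Sum>i<n. F (lam n i)) / of_nat n - (\<Sum>i<n. G (lam n i)) / of_nat n) \<le> e / 3"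
    proof -
      have "cmod (\<Sum>i<n. F (lam n i) - G (lam n i)) \<le> real n * (e / 3)"
        using sum_norm_bound[of "{..<n}" "\<lambda>i. F (lam n i) - G (lam n i)" "e / 3"] FG by auto
      then show ?thesis
        using n by (simp add: sum_subtractf norm_divide divide_le_eq mult.commute flip: diff_divide_distrib)
    qed
    have "n \<ge> n0" using n by simp
    from norm_diff_less_thirds[OF 1 n0[OF this] 2] show ?thesis .
  qed
  then show "\<exists>no. \<forall>n\<ge>no. cmod ((\<Sum>i<n. F (lam n i)) / of_nat n - (\<integral>x. F (a x) + F (b x) \<partial>circ) / (4 * of_real pi)) < e"
    by blast
qed

section \<open>Reflection symmetry of the symbol\<close>

lemma integral_circ_reflect: "(\<integral>x. f (- x) \<partial>circ) = (\<integral>x. f x \<partial>circ)"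
  for f :: "real \<Rightarrow> 'a::euclidean_space"
  using Equivalence_Lebesgue_Henstock_Integration.integral_reflect_real[of pi "-pi" f] by simp

lemma integrable_circ_reflect: "integrable circ (\<lambda>x. f (- x)) \<longleftrightarrow> integrable circ f"
  for f :: "real \<Rightarrow> 'a::euclidean_space"
  using Equivalence_Lebesgue_Henstock_Integration.integrable_reflect_real[of pi "-pi" f] by simp

lemma fourier_coeff_reflect: "fourier_coeff (\<lambda>x. f (- x)) k = fourier_coeff f (- k)"
  using integral_circ_reflect[of "\<lambda>x. f x * cis (of_int k * x)"] by (simp add: fourier_coeff_circ)

lemma fourier_coeff_cnj: "fourier_coeff (\<lambda>x. cnj (f x)) k = cnj (fourier_coeff f (- k))"
proof -
  have "cnj (\<integral>x. f x * cis (of_int k * x) \<partial>circ) = (\<integral>x. cnj (f x) * cis (- (of_int k * x)) \<partial>circ)"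
    by (subst Bochner_Integration.integral_cnj[symmetric]) (simp add: cis_cnj)
  then show ?thesis by (simp add: fourier_coeff_circ)
qed

lemma AE_eq_of_fourier_coeff_eq:
  assumes "integrable circ f" "integrable circ g" "\<And>k. fourier_coeff f k = fourier_coeff g k"
  shows "AE x in circ. f x = g x"
proof -
  have "AE x in circ. f x - g x = 0"
    by (rule fourier_coeff_unique) (use assms in \<open>auto simp: fourier_coeff_diff\<close>)
  then show ?thesis by eventually_elim simp
qed

text \<open>The two sides have the coefficients \<open>fourier_coeff f (- k)\<close> and
  \<open>cnj (fourier_coeff f (- k))\<close>, which agree for real coefficients; uniqueness does the
  rest.\<close>

lemma AE_reflect_eq_cnj:
  assumes f: "integrable circ f" and r: "\<And>k. fourier_coeff f k \<in> \<real>"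
  shows "AE x in circ. f (- x) = cnj (f x)"
  by (rule AE_eq_of_fourier_coeff_eq)
     (use assms in \<open>auto simp: integrable_circ_reflect fourier_coeff_reflect fourier_coeff_cnj Reals_cnj_iff\<close>)

lemma AE_reflect_eq:
  assumes f: "integrable circ f" and s: "\<And>k. fourier_coeff f k = fourier_coeff f (- k)"
  shows "AE x in circ. f (- x) = f x"
  by (rule AE_eq_of_fourier_coeff_eq)
     (use assms in \<open>auto simp: integrable_circ_reflect fourier_coeff_reflect\<close>)

text \<open>Stability of the limit values under \<open>L^1\<close> approximation, from the
  1-Lipschitz property of \<open>|x - c|\<close>. The exact factor is \<open>2 / (4 * pi)\<close>,
  rounded up to 1.\<close>

lemma abs_integral_lipschitz:
  fixes a b a' b' D :: "real \<Rightarrow> real"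
  assumes int: "integrable circ a" "integrable circ b" "integrable circ a'" "integrable circ b'" "integrable circ D"
    and D: "AE x in circ. \<bar>a x - a' x\<bar> \<le> D x" "AE x in circ. \<bar>b x - b' x\<bar> \<le> D x" and e: "(\<integral>x. D x \<partial>circ) \<le> e" "0 \<le> e"
  shows "\<bar>(\<integral>x. \<bar>a x - c\<bar> + \<bar>b x - c\<bar> \<partial>circ) / (4 * pi) - (\<integral>x. \<bar>a' x - c\<bar> + \<bar>b' x - c\<bar> \<partial>circ) / (4 * pi)\<bar> \<le> e"
proof -
  have i: "integrable circ (\<lambda>x. \<bar>t x - c\<bar>)" if "integrable circ t" for t
    using that finite_measure.integrable_const[OF finite_measure_circ, of c] by simp
  note ii = i[OF int(1)] i[OF int(2)] i[OF int(3)] i[OF int(4)]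
  have "\<bar>\<integral>x. (\<bar>a x - c\<bar> + \<bar>b x - c\<bar>) - (\<bar>a' x - c\<bar> + \<bar>b' x - c\<bar>) \<partial>circ\<bar>
     \<le> (\<integral>x. \<bar>(\<bar>a x - c\<bar> + \<bar>b x - c\<bar>) - (\<bar>a' x - c\<bar> + \<bar>b' x - c\<bar>)\<bar> \<partial>circ)"
    by (rule integral_abs_bound)
  also have "\<dots> \<le> (\<integral>x. 2 * D x \<partial>circ)"
  proof (rule integral_mono_AE)
    show "AE x in circ. \<bar>(\<bar>a x - c\<bar> + \<bar>b x - c\<bar>) - (\<bar>a' x - c\<bar> + \<bar>b' x - c\<bar>)\<bar> \<le> 2 * D x"
      using D by eventually_elim linarith
  qed (use ii int in auto)
  also have "\<dots> \<le> 2 * e" using e int by simp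
  finally have 1: "\<bar>(\<integral>x. \<bar>a x - c\<bar> + \<bar>b x - c\<bar> \<partial>circ) - (\<integral>x. \<bar>a' x - c\<bar> + \<bar>b' x - c\<bar> \<partial>circ)\<bar> \<le> 2 * e"
    using ii by simp
  have "\<bar>(\<integral>x. \<bar>a x - c\<bar> + \<bar>b x - c\<bar> \<partial>circ) / (4 * pi) - (\<integral>x. \<bar>a' x - c\<bar> + \<bar>b' x - c\<bar> \<partial>circ) / (4 * pi)\<bar> \<le> 2 * e / (4 * pi)"
    using divide_right_mono[OF 1, of "4 * pi"] by (simp add: abs_divide flip: diff_divide_distrib)
  also have "\<dots> \<le> e"
    using mult_right_mono[of 1 "2 * pi" e] e(2) pi_gt3 by (simp add: divide_le_eq mult_ac)
  finally show ?thesis .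
qed

lemma toeplitz_abs_limit:
  fixes lam :: "nat \<Rightarrow> nat \<Rightarrow> real"
  assumes f: "integrable circ f" and real: "AE x in circ. f x \<in> \<real>"
    and u: "\<And>n. orthonormal n n (u n)"
    and eig: "\<And>n i s. i < n \<Longrightarrow> s < n \<Longrightarrow> mat_app n (toep id f) (u n i) s = of_real (lam n i) * u n i s"
  shows "(\<lambda>n. (\<Sum>i<n. \<bar>lam n i - c\<bar>) / real n) \<longlonglongrightarrow> (\<integral>x. \<bar>Re (f x) - c\<bar> + \<bar>Re (f x) - c\<bar> \<partial>circ) / (4 * pi)"
proof (rule abs_limit[where q="\<lambda>n. id", OF f _ _ u eig])
  fix e :: real assume e: "e > 0"
  then obtain g0 where g0: "trig_poly g0" "(\<integral>x. cmod (f x - g0 x) \<partial>circ) < e"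
    using trig_poly_dense_L1[OF f] by metis
  \<comment> \<open>The real part of \<open>g0\<close>: the approximate eigenvalues must be real. As
    \<open>f\<close> is real almost everywhere, taking real parts does not increase the
    distance.\<close>
  define g where "g x = 1 / 2 * (g0 x + cnj (g0 x))" for x
  have g: "trig_poly g"
    unfolding g_def[abs_def] by (intro trig_poly_scale trig_poly.add trig_poly_cnj g0)
  have gr: "g x = of_real (Re (g0 x))" for x by (simp add: g_def complex_eq_iff)
  have gi: "integrable circ g" "integrable circ g0" using g g0(1) trig_poly_integrable by auto
  have fg: "(\<integral>x. cmod (f x - g x) \<partial>circ) \<le> e"
  proof -
    have "(\<integral>x. cmod (f x - g x) \<partial>circ) \<le> (\<integral>x. cmod (f x - g0 x) \<partial>circ)"
    proof (rule integral_mono_AE)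
      show "AE x in circ. cmod (f x - g x) \<le> cmod (f x - g0 x)"
        using real
      proof eventually_elim
        case (elim x)
        then have "f x - g x = of_real (Re (f x - g0 x))" by (simp add: gr complex_eq_iff complex_is_Real_iff)
        then show ?case using abs_Re_le_cmod[of "f x - g0 x"] by (simp only: norm_of_real)
      qed
    qed (use f gi in auto)
    then show ?thesis using g0(2) by simp
  qed
  obtain r where "trig_symbol g r" using trig_poly_symbol[OF g] .
  then interpret trig_symbol g r .
  have "(\<lambda>n. (\<Sum>j<n. \<bar>Re (g (2 * pi * real j / real n)) - c\<bar>) / real n) \<longlonglongrightarrow> (\<integral>x. \<bar>Re (g x) - c\<bar> \<partial>circ) / (2 * pi)"
    by (rule equidistribution_real) (auto intro!: continuous_intros trig_poly_continuous g simp: trig_poly_periodic[OF g])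
  also have "(\<integral>x. \<bar>Re (g x) - c\<bar> \<partial>circ) / (2 * pi) = (\<integral>x. \<bar>Re (g x) - c\<bar> + \<bar>Re (g x) - c\<bar> \<partial>circ) / (4 * pi)"
    by simp
  finally have lim: "(\<lambda>n. (\<Sum>j<n. \<bar>Re (g (2 * pi * real j / real n)) - c\<bar>) / real n) \<longlonglongrightarrow> \<dots>" .
  have diff: "\<bar>(\<integral>x. \<bar>Re (g x) - c\<bar> + \<bar>Re (g x) - c\<bar> \<partial>circ) / (4 * pi) - (\<integral>x. \<bar>Re (f x) - c\<bar> + \<bar>Re (f x) - c\<bar> \<partial>circ) / (4 * pi)\<bar> \<le> e"
  proof (rule abs_integral_lipschitz[where D="\<lambda>x. cmod (f x - g x)"])
    show "AE x in circ. \<bar>Re (g x) - Re (f x)\<bar> \<le> cmod (f x - g x)"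
      using abs_Re_le_cmod[of "f _ - g _"] by (intro AE_I2) (metis abs_minus_commute minus_complex.simps(1))
    then show "AE x in circ. \<bar>Re (g x) - Re (f x)\<bar> \<le> cmod (f x - g x)" .
  qed (use f gi fg e in \<open>auto intro: integrable_bounded_linear[OF bounded_linear_Re]\<close>)
  have basis: "\<forall>n\<ge>2. \<exists>v. orthonormal n n v \<and>
      (\<Sum>j<n. l2 n (\<lambda>s. mat_app n (toep id g) (v j) s - of_real (Re (g (2 * pi * real j / real n))) * v j s))
      \<le> (sqrt (real (2 * r)) * (2 * csum)) * sqrt (real n)"
  proof (intro allI impI)
    fix n :: nat assume "n \<ge> 2"
    then have "n > 0" by simp
    then show "\<exists>v. orthonormal n n v \<and>
      (\<Sum>j<n. l2 n (\<lambda>s. mat_app n (toep id g) (v j) s - of_real (Re (g (2 * pi * real j / real n))) * v j s))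
      \<le> (sqrt (real (2 * r)) * (2 * csum)) * sqrt (real n)"
      by (rule toeplitz_approx_basis[rotated]) (subst gr, rule Reals_of_real)
  qed
  show "\<exists>g mu K l. integrable circ g \<and> (\<integral>x. cmod (f x - g x) \<partial>circ) \<le> e
      \<and> (\<forall>n\<ge>2. \<exists>v. orthonormal n n v \<and>
          (\<Sum>j<n. l2 n (\<lambda>s. mat_app n (toep id g) (v j) s - of_real (mu n j) * v j s)) \<le> K * sqrt (real n))
      \<and> (\<lambda>n. (\<Sum>j<n. \<bar>mu n j - c\<bar>) / real n) \<longlonglongrightarrow> l
      \<and> \<bar>l - (\<integral>x. \<bar>Re (f x) - c\<bar> + \<bar>Re (f x) - c\<bar> \<partial>circ) / (4 * pi)\<bar> \<le> e"
    by (rule exI[of _ g], rule exI[of _ "\<lambda>n j. Re (g (2 * pi * real j / real n))"], rule exI, rule exI)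
       (rule conjI[OF gi(1) conjI[OF fg conjI[OF basis conjI[OF lim diff]]]])
qed auto

text \<open>Pairing the two signs at each grid point gives a sampling sum of the single periodic
  function \<open>\<Psi>\<close> over \<open>n div 2\<close> points, with relative weight tending to
  1/2. The middle index of odd \<open>n\<close> contributes \<open>|c| / n\<close>.\<close>

lemma (in trig_symbol) hankel_eval_limit:
  assumes g: "trig_poly g"
  shows "(\<lambda>n. (\<Sum>j<n. \<bar>hankel_eval n j - c\<bar>) / real n) \<longlonglongrightarrow>
    (\<integral>x. \<bar>cmod (g x) - c\<bar> + \<bar>- cmod (g x) - c\<bar> \<partial>circ) / (4 * pi)"
proof -
  define \<Psi> where "\<Psi> x = \<bar>cmod (g x) - c\<bar> + \<bar>- cmod (g x) - c\<bar>" for x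
  define G where "G m = (\<Sum>j<m. \<Psi> (2 * pi * real j / real m)) / real m" for m
  have "continuous_on UNIV \<Psi>"
    unfolding \<Psi>_def by (intro continuous_intros trig_poly_continuous g)
  moreover have "\<Psi> (x + 2 * pi) = \<Psi> x" for x by (simp only: \<Psi>_def trig_poly_periodic[OF g])
  ultimately have "G \<longlonglongrightarrow> (\<integral>x. \<Psi> x \<partial>circ) / (2 * pi)"
    unfolding G_def[abs_def] by (rule equidistribution_real[where \<phi>=\<Psi>])
  moreover have half: "filterlim (\<lambda>n::nat. n div 2) at_top sequentially"
    unfolding filterlim_at_top
  proof
    fix Z :: nat
    show "\<forall>\<^sub>F n in sequentially. Z \<le> n div 2" by (rule eventually_sequentiallyI[of "2 * Z"]) simp
  qed
  ultimately have 1: "(\<lambda>n. G (n div 2)) \<longlonglongrightarrow> (\<integral>x. \<Psi> x \<partial>circ) / (2 * pi)"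
    by (rule filterlim_compose)
  have 2: "(\<lambda>n. real (n mod 2) / real n) \<longlonglongrightarrow> 0"
  proof (rule tendsto_sandwich[OF _ _ tendsto_const lim_1_over_n])
    show "\<forall>\<^sub>F n in sequentially. real (n mod 2) / real n \<le> 1 / real n"
      by (intro always_eventually allI divide_right_mono) (auto simp: less_Suc_eq_le[symmetric])
  qed auto
  have 3: "(\<lambda>n. real (n div 2) / real n) \<longlonglongrightarrow> 1 / 2"
  proof -
    have "(\<lambda>n. 1 / 2 - real (n mod 2) / real n / 2) \<longlonglongrightarrow> 1 / 2 - 0 / 2" by (intro tendsto_intros 2) auto
    moreover have "\<forall>\<^sub>F n in sequentially. 1 / 2 - real (n mod 2) / real n / 2 = real (n div 2) / real n"
    proof (rule eventually_sequentiallyI[of 1])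
      fix n :: nat assume "n \<ge> 1"
      moreover have "real n = 2 * real (n div 2) + real (n mod 2)"
        by (metis div_mult_mod_eq mult.commute of_nat_add of_nat_mult of_nat_numeral)
      ultimately show "1 / 2 - real (n mod 2) / real n / 2 = real (n div 2) / real n" by (simp add: field_simps)
    qed
    ultimately show ?thesis by (simp add: tendsto_cong)
  qed
  have "(\<Sum>j<n. \<bar>hankel_eval n j - c\<bar>) / real n = real (n div 2) / real n * G (n div 2) + real (n mod 2) / real n * \<bar>c\<bar>" for n
  proof -
    define m where "m = n div 2"
    define k where "k = n mod 2"
    have nk: "n = m + k + m" unfolding m_def k_def by presburger
    have "(\<Sum>j<n. \<bar>hankel_eval n j - c\<bar>) = (\<Sum>j<m. \<bar>hankel_eval n j - c\<bar>) + (\<Sum>j\<in>{m..<m+k}. \<bar>hankel_eval n j - c\<bar>)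
        + (\<Sum>j\<in>{m+k..<n}. \<bar>hankel_eval n j - c\<bar>)"
      using nk by (simp add: sum.atLeastLessThan_concat flip: atLeast0LessThan)
    also have "(\<Sum>j<m. \<bar>hankel_eval n j - c\<bar>) = (\<Sum>j<m. \<bar>cmod (g (2 * pi * real j / real m)) - c\<bar>)"
      by (intro sum.cong) (auto simp: hankel_eval_def m_def Let_def)
    also have "(\<Sum>j\<in>{m..<m+k}. \<bar>hankel_eval n j - c\<bar>) = (\<Sum>j\<in>{m..<m+k}. \<bar>c\<bar>)"
    proof (intro sum.cong refl)
      fix j assume "j \<in> {m..<m+k}"
      then have "\<not> j < m" "\<not> n - m \<le> j" using nk by auto
      then show "\<bar>hankel_eval n j - c\<bar> = \<bar>c\<bar>" by (simp add: hankel_eval_def m_def[symmetric])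
    qed
    also have "(\<Sum>j\<in>{m+k..<n}. \<bar>hankel_eval n j - c\<bar>) = (\<Sum>j<m. \<bar>- cmod (g (2 * pi * real j / real m)) - c\<bar>)"
    proof (rule sum.reindex_bij_witness[of _ "\<lambda>j. j + (m + k)" "\<lambda>j. j - (m + k)"])
      fix j assume j: "j \<in> {m+k..<n}"
      then have "\<not> j < m" "n - m \<le> j" "n - m = m + k" using nk by auto
      then show "\<bar>- cmod (g (2 * pi * real (j - (m + k)) / real m)) - c\<bar> = \<bar>hankel_eval n j - c\<bar>"
        by (simp add: hankel_eval_def m_def[symmetric] Let_def)
    qed (use nk in auto)
    finally have "(\<Sum>j<n. \<bar>hankel_eval n j - c\<bar>) = (\<Sum>j<m. \<Psi> (2 * pi * real j / real m)) + real k * \<bar>c\<bar>"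
      by (simp add: \<Psi>_def sum.distrib)
    also have "(\<Sum>j<m. \<Psi> (2 * pi * real j / real m)) = real m * G m" by (simp add: G_def)
    finally show ?thesis unfolding m_def k_def by (simp add: add_divide_distrib)
  qed
  moreover have "(\<lambda>n. real (n div 2) / real n * G (n div 2) + real (n mod 2) / real n * \<bar>c\<bar>)
      \<longlonglongrightarrow> 1 / 2 * ((\<integral>x. \<Psi> x \<partial>circ) / (2 * pi)) + 0 * \<bar>c\<bar>"
    by (intro tendsto_intros 1 2 3)
  ultimately show ?thesis by (simp add: \<Psi>_def)
qed

lemma hankel_abs_limit:
  fixes lam :: "nat \<Rightarrow> nat \<Rightarrow> real"
  assumes f: "integrable circ f" and refl: "AE x in circ. f (- x) = cnj (f x)"
    and u: "\<And>n. orthonormal n n (u n)"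
    and eig: "\<And>n i s. i < n \<Longrightarrow> s < n \<Longrightarrow> mat_app n (toep (\<lambda>s. n - 1 - s) f) (u n i) s = of_real (lam n i) * u n i s"
  shows "(\<lambda>n. (\<Sum>i<n. \<bar>lam n i - c\<bar>) / real n) \<longlonglongrightarrow> (\<integral>x. \<bar>cmod (f x) - c\<bar> + \<bar>- cmod (f x) - c\<bar> \<partial>circ) / (4 * pi)"
proof (rule abs_limit[where q="\<lambda>n s. n - 1 - s", OF f _ _ u eig])
  fix e :: real assume e: "e > 0"
  then obtain g0 where g0: "trig_poly g0" "(\<integral>x. cmod (f x - g0 x) \<partial>circ) < e"
    using trig_poly_dense_L1[OF f] by metis
  \<comment> \<open>Symmetrisation makes \<open>g (- x) = cnj (g x)\<close> hold exactly, as the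
    flipped basis demands. Since \<open>f\<close> has this symmetry almost everywhere and reflection
    preserves the \<open>L^1\<close> norm, the averaged error is no larger than that of
    \<open>g0\<close>.\<close>
  define g where "g x = 1 / 2 * (g0 x + cnj (g0 (- x)))" for x
  have g: "trig_poly g"
    unfolding g_def[abs_def] by (intro trig_poly_scale trig_poly.add trig_poly_cnj trig_poly_reflect g0)
  have gsym: "g (- x) = cnj (g x)" for x by (simp add: g_def add.commute)
  have gi: "integrable circ g" "integrable circ g0" using g g0(1) trig_poly_integrable by auto
  have fg0: "integrable circ (\<lambda>x. cmod (f x - g0 x))" using f gi by simp
  have fg: "(\<integral>x. cmod (f x - g x) \<partial>circ) \<le> e"
  proof -
    have "(\<integral>x. cmod (f x - g x) \<partial>circ) \<le> (\<integral>x. 1 / 2 * (cmod (f x - g0 x) + cmod (f (- x) - g0 (- x))) \<partial>circ)"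
    proof (rule integral_mono_AE)
      show "AE x in circ. cmod (f x - g x) \<le> 1 / 2 * (cmod (f x - g0 x) + cmod (f (- x) - g0 (- x)))"
        using refl
      proof eventually_elim
        case (elim x)
        have "f x - g x = 1 / 2 * ((f x - g0 x) + cnj (f (- x) - g0 (- x)))"
          by (simp add: g_def elim algebra_simps)
        then have "cmod (f x - g x) = 1 / 2 * cmod ((f x - g0 x) + cnj (f (- x) - g0 (- x)))"
          by (simp only: norm_mult) simp
        also have "\<dots> \<le> 1 / 2 * (cmod (f x - g0 x) + cmod (cnj (f (- x) - g0 (- x))))"
          by (intro mult_left_mono norm_triangle_ineq) simp
        finally show ?case by (simp only: complex_mod_cnj)
      qed
    qed (use f gi fg0 integrable_circ_reflect[of "\<lambda>x. cmod (f x - g0 x)"] in auto)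
    also have "\<dots> = 1 / 2 * ((\<integral>x. cmod (f x - g0 x) \<partial>circ) + (\<integral>x. cmod (f (- x) - g0 (- x)) \<partial>circ))"
      using fg0 integrable_circ_reflect[of "\<lambda>x. cmod (f x - g0 x)"] by simp
    also have "\<dots> = (\<integral>x. cmod (f x - g0 x) \<partial>circ)"
      using integral_circ_reflect[of "\<lambda>x. cmod (f x - g0 x)"] by simp
    finally show ?thesis using g0(2) by simp
  qed
  obtain r where "trig_symbol g r" using trig_poly_symbol[OF g] .
  then interpret trig_symbol g r .
  have diff: "\<bar>(\<integral>x. \<bar>cmod (g x) - c\<bar> + \<bar>- cmod (g x) - c\<bar> \<partial>circ) / (4 * pi) - (\<integral>x. \<bar>cmod (f x) - c\<bar> + \<bar>- cmod (f x) - c\<bar> \<partial>circ) / (4 * pi)\<bar> \<le> e"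
  proof (rule abs_integral_lipschitz[where D="\<lambda>x. cmod (f x - g x)"])
    have "\<bar>cmod (g x) - cmod (f x)\<bar> \<le> cmod (f x - g x)" for x
      using norm_triangle_ineq3[of "g x" "f x"] by (simp add: norm_minus_commute)
    then show "AE x in circ. \<bar>cmod (g x) - cmod (f x)\<bar> \<le> cmod (f x - g x)"
      "AE x in circ. \<bar>- cmod (g x) - - cmod (f x)\<bar> \<le> cmod (f x - g x)"
      by (auto simp: abs_minus_commute)
  qed (use f gi fg e in auto)
  have basis: "\<forall>n\<ge>2. \<exists>v. orthonormal n n v \<and>
      (\<Sum>j<n. l2 n (\<lambda>s. mat_app n (toep (\<lambda>s. n - 1 - s) g) (v j) s - of_real (hankel_eval n j) * v j s))
      \<le> (sqrt (real (4 * r + 1)) * (2 * csum) * 2 + csum) * sqrt (real n)"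
    using hankel_approx_basis[OF gsym] by blast
  show "\<exists>g mu K l. integrable circ g \<and> (\<integral>x. cmod (f x - g x) \<partial>circ) \<le> e
      \<and> (\<forall>n\<ge>2. \<exists>v. orthonormal n n v \<and>
          (\<Sum>j<n. l2 n (\<lambda>s. mat_app n (toep (\<lambda>s. n - 1 - s) g) (v j) s - of_real (mu n j) * v j s)) \<le> K * sqrt (real n))
      \<and> (\<lambda>n. (\<Sum>j<n. \<bar>mu n j - c\<bar>) / real n) \<longlonglongrightarrow> l
      \<and> \<bar>l - (\<integral>x. \<bar>cmod (f x) - c\<bar> + \<bar>- cmod (f x) - c\<bar> \<partial>circ) / (4 * pi)\<bar> \<le> e"
    by (rule exI[of _ g], rule exI[of _ hankel_eval], rule exI, rule exI)
       (rule conjI[OF gi(1) conjI[OF fg conjI[OF basis conjI[OF hankel_eval_limit[OF g] diff]]]])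
next
  have flip: "n - 1 - s < n \<and> n - 1 - (n - 1 - s) = s" if "s < n" for n s :: nat using that by arith
  show "bij_betw (\<lambda>s. n - 1 - s) {..<n} {..<n}" for n :: nat
    by (rule bij_betw_byWitness[where f'="\<lambda>s. n - 1 - s"]; (intro ballI image_subsetI)?; simp only: lessThan_iff flip)
  show "n - 1 - (n - 1 - s) = s" if "s < n" for n s :: nat using flip[OF that] by blast
qed

section \<open>From test functions to eigenvalue and singular value multisets\<close>

lemma test_fun_of_real:
  assumes "test_fun F"
  obtains R where "\<And>x. \<bar>x\<bar> > R \<Longrightarrow> F (of_real x) = 0"
proof -
  obtain R where R: "\<forall>z\<in>{z. F z \<noteq> 0}. cmod z \<le> R"
    using assms unfolding test_fun_def bounded_iff by blast
  show thesis
    by (rule that[of R]) (use R in \<open>force\<close>)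
qed

lemma test_fun_bounded:
  assumes "test_fun F"
  obtains B where "\<And>z. cmod (F z) \<le> B"
proof -
  obtain R where R: "\<forall>z\<in>{z. F z \<noteq> 0}. cmod z \<le> R"
    using assms unfolding test_fun_def bounded_iff by blast
  have "compact (F ` cball 0 R)"
    using assms by (intro compact_continuous_image) (auto simp: test_fun_def intro: continuous_on_subset)
  then obtain B where B: "\<forall>w\<in>F ` cball 0 R. cmod w \<le> B"
    using compact_imp_bounded bounded_iff by metis
  show thesis
  proof (rule that[of "\<bar>B\<bar>"])
    fix z
    show "cmod (F z) \<le> \<bar>B\<bar>"
    proof (cases "F z = 0")
      case False
      then have "z \<in> cball 0 R" using R by auto
      then have "cmod (F z) \<le> B" using B by blast
      then show ?thesis by linarith
    qed simp
  qed
qed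

lemma test_fun_measurable: "test_fun F \<Longrightarrow> F \<in> borel_measurable borel"
  unfolding test_fun_def by (auto intro: borel_measurable_continuous_onI)

lemma sum_mset_upt: "(\<Sum>z\<in>#image_mset h (mset [0..<n]). G z) = (\<Sum>i<n. G (h i))"
  unfolding sum_unfold_sum_mset mset_upt atLeast0LessThan by (simp add: image_mset.compositionality o_def)

text \<open>The eigenbasis is chosen inside the proof, so \<open>lim\<close> is required for every
  eigenbasis. The second conclusion allows any \<open>B\<close> with
  \<open>mat_adjoint B * B = A * A\<close>: its singular values are the moduli of the eigenvalues of
  \<open>A\<close>. In this way the eigenvalues of the flipped matrices yield the singular values of
  the flipped and of the plain Toeplitz matrices.\<close>

lemma hermitian_test_limit:
  fixes A :: "nat \<Rightarrow> complex mat" and a b :: "real \<Rightarrow> real"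
  assumes A: "\<And>n. A n \<in> carrier_mat n n" "\<And>n s t. s < n \<Longrightarrow> t < n \<Longrightarrow> A n $$ (s, t) = M n s t"
    and herm: "\<And>n s t. s < n \<Longrightarrow> t < n \<Longrightarrow> M n s t = cnj (M n t s)"
    and ab: "integrable circ a" "integrable circ b"
    and lim: "\<And>u lam c. (\<And>n. orthonormal n n (u n)) \<Longrightarrow>
      (\<And>n i s. i < n \<Longrightarrow> s < n \<Longrightarrow> mat_app n (M n) (u n i) s = of_real (lam n i) * u n i s) \<Longrightarrow>
      (\<lambda>n. (\<Sum>i<n. \<bar>lam n i - c\<bar>) / real n) \<longlonglongrightarrow> (\<integral>x. \<bar>a x - c\<bar> + \<bar>b x - c\<bar> \<partial>circ) / (4 * pi)"
    and F: "test_fun F"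
  shows "(\<lambda>n. (\<Sum>z\<in>#eigvals_mset (A n). F z) / of_nat n) \<longlonglongrightarrow>
      (\<integral>x. F (of_real (a x)) + F (of_real (b x)) \<partial>circ) / (4 * of_real pi) \<and>
    (\<forall>B. (\<forall>n. mat_adjoint (B n) * B n = A n * A n) \<longrightarrow>
      (\<lambda>n. (\<Sum>s\<in>#singvals_mset (B n). F (of_real s)) / of_nat n) \<longlonglongrightarrow>
      (\<integral>x. F (of_real \<bar>a x\<bar>) + F (of_real \<bar>b x\<bar>) \<partial>circ) / (4 * of_real pi))" (is "?eig \<and> (\<forall>B. _ \<longrightarrow> ?sv B)")
proof -
  have "\<exists>u (lam :: nat \<Rightarrow> real). orthonormal n n u \<and> (\<forall>i<n. \<forall>s<n. mat_app n (M n) (u i) s = of_real (lam i) * u i s)" for n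
    by (rule hermitian_eigenbasis[of n "M n", OF herm]) blast+
  then obtain u and lam :: "nat \<Rightarrow> nat \<Rightarrow> real" where u: "\<And>n. orthonormal n n (u n)"
    and eig: "\<And>n i s. i < n \<Longrightarrow> s < n \<Longrightarrow> mat_app n (M n) (u n i) s = of_real (lam n i) * u n i s"
    by metis
  note abs_lim = lim[OF u eig]
  obtain R where R: "\<And>x. \<bar>x\<bar> > R \<Longrightarrow> F (of_real x) = 0" using test_fun_of_real[OF F] by blast
  have Fc: "continuous_on UNIV F" using F by (simp add: test_fun_def)
  have eA: "eigvals_mset (A n) = image_mset (\<lambda>i. of_real (lam n i)) (mset [0..<n])" for n
  proof (rule eigvals_mset_orthonormal[OF A(1) u])
    fix i s assume "i < n" "s < n"
    then show "mat_app n (\<lambda>s t. A n $$ (s, t)) (u n i) s = of_real (lam n i) * u n i s"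
      using eig[of i n s] by (simp add: mat_app_def A(2))
  qed
  have eig_lim: ?eig
    unfolding eA sum_mset_upt
    by (rule test_function_limit[OF ab abs_lim, of "\<lambda>x. F (of_real x)"])
       (auto intro!: continuous_on_compose2[OF Fc] continuous_intros R)
  have eB: "eigvals_mset (A n * A n) = image_mset (\<lambda>i. of_real ((lam n i)\<^sup>2)) (mset [0..<n])" for n
  proof (rule eigvals_mset_orthonormal[OF _ u])
    show "A n * A n \<in> carrier_mat n n" using A(1)[of n] by auto
    fix i s assume i: "i < n" and s: "s < n"
    have d: "dim_row (A n) = n" "dim_col (A n) = n" using A(1)[of n] by auto
    have "mat_app n (\<lambda>s t. (A n * A n) $$ (s, t)) (u n i) s = (\<Sum>t<n. (\<Sum>k<n. M n s k * M n k t) * u n i t)"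
      unfolding mat_app_def using s by (intro sum.cong refl) (simp add: d scalar_prod_def atLeast0LessThan A(2))
    also have "\<dots> = (\<Sum>k<n. M n s k * mat_app n (M n) (u n i) k)"
      unfolding mat_app_def sum_distrib_left sum_distrib_right by (subst sum.swap) (simp add: mult.assoc)
    also have "\<dots> = (\<Sum>k<n. M n s k * (of_real (lam n i) * u n i k))"
      by (intro sum.cong refl) (simp add: eig[OF i])
    also have "\<dots> = of_real (lam n i) * mat_app n (M n) (u n i) s"
      by (simp add: mat_app_def sum_distrib_left mult_ac)
    finally show "mat_app n (\<lambda>s t. (A n * A n) $$ (s, t)) (u n i) s = of_real ((lam n i)\<^sup>2) * u n i s"
      by (simp add: eig[OF i s] power2_eq_square)
  qed
  have sB: "singvals_mset (B n) = image_mset (\<lambda>i. \<bar>lam n i\<bar>) (mset [0..<n])"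
    if "\<forall>n. mat_adjoint (B n) * B n = A n * A n" for B n
    unfolding singvals_mset_def that[rule_format] eB by (simp add: image_mset.compositionality o_def flip: of_real_power)
  have "\<forall>B. (\<forall>n. mat_adjoint (B n) * B n = A n * A n) \<longrightarrow> ?sv B"
  proof (intro allI impI)
    fix B assume "\<forall>n. mat_adjoint (B n) * B n = A n * A n"
    note * = sB[OF this]
    show "?sv B"
    unfolding * sum_mset_upt
    by (rule test_function_limit[OF ab abs_lim, of "\<lambda>x. F (of_real \<bar>x\<bar>)"])
       (auto intro!: continuous_on_compose2[OF Fc] continuous_intros R)
  qed
  with eig_lim show ?thesis by (rule conjI)
qed

section \<open>Eigenvalue and singular value distributions\<close>

lemma borel_measurable_circ: "g \<in> borel_measurable borel \<Longrightarrow> g \<in> borel_measurable circ"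
  by (intro measurable_restrict_space1 measurable_completion) simp

lemma indicator_circ_integral:
  fixes \<phi> :: "real \<Rightarrow> complex"
  shows "(LINT x:{0..pi}|lebesgue. \<phi> x) = (\<integral>x. indicator {0..} x *\<^sub>R \<phi> x \<partial>circ)"
  unfolding set_lebesgue_integral_def
  by (subst integral_restrict_space) (auto intro!: Bochner_Integration.integral_cong split: split_indicator)

lemma integral_circ_even:
  fixes \<phi> :: "real \<Rightarrow> complex"
  assumes i: "integrable circ \<phi>" and even: "AE x in circ. \<phi> (- x) = \<phi> x"
  shows "(\<integral>x. \<phi> x \<partial>circ) = 2 * (LINT x:{0..pi}|lebesgue. \<phi> x)"
proof -
  define p where "p x = indicat_real {0..} x *\<^sub>R \<phi> x" for x
  define m where "m x = indicat_real {0..} (- x) *\<^sub>R \<phi> x" for x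
  have "(\<lambda>x. indicat_real {0..} (- x)) = indicat_real {..(0::real)}" by (auto split: split_indicator)
  moreover have "indicat_real {..0} \<in> borel_measurable circ" by (rule borel_measurable_circ) simp
  ultimately have [measurable]: "(\<lambda>x. indicat_real {0..} (- x)) \<in> borel_measurable circ" by (simp only:)
  have [measurable]: "indicat_real {0..} \<in> borel_measurable circ" by (rule borel_measurable_circ) simp
  have [measurable]: "\<phi> \<in> borel_measurable circ" using i by simp
  have pi: "integrable circ p"
    by (rule Bochner_Integration.integrable_bound[OF i]) (auto simp: p_def[abs_def] split: split_indicator)
  have mi: "integrable circ m"
    by (rule Bochner_Integration.integrable_bound[OF i]) (auto simp: m_def[abs_def] split: split_indicator)
  have "AE x in lebesgue. x \<noteq> (0::real)"
    using AE_not_in[of "{0::real}" lebesgue] by simp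
  then have nz: "AE x in circ. x \<noteq> 0" by (subst AE_restrict_space_iff) auto
  have "(\<integral>x. \<phi> x \<partial>circ) = (\<integral>x. p x + m x \<partial>circ)"
  proof (rule integral_cong_AE)
    show "AE x in circ. \<phi> x = p x + m x"
      using nz by eventually_elim (auto simp: p_def m_def split: split_indicator)
  qed (use i pi mi in auto)
  also have "\<dots> = (\<integral>x. p x \<partial>circ) + (\<integral>x. m x \<partial>circ)" using pi mi by simp
  also have "(\<integral>x. m x \<partial>circ) = (\<integral>x. m (- x) \<partial>circ)" by (rule integral_circ_reflect[symmetric])
  also have "\<dots> = (\<integral>x. p x \<partial>circ)"
  proof (rule integral_cong_AE)
    show "AE x in circ. m (- x) = p x"
      using even by eventually_elim (simp add: p_def m_def)
    have "integrable circ (\<lambda>x. m (- x))" using mi by (simp only: integrable_circ_reflect)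
    then show "(\<lambda>x. m (- x)) \<in> borel_measurable circ" by simp
  qed (use pi in auto)
  finally show ?thesis by (simp add: indicator_circ_integral p_def)
qed

section \<open>The function psi on the doubled interval\<close>

lemma Icc_pi_Un_translate: "{0..pi} \<union> (+) pi ` {0..pi} = {0..2*pi}"
  by (auto simp: image_iff)

text \<open>The point \<open>pi\<close> lies in both \<open>D\<close> and its translate, and the
  first branch takes it; hence the half-open second interval.\<close>

lemma psi_ext_eq: "psi_ext {0..pi} pi a x =
    (if x \<in> {0..pi} then a x else if x \<in> {pi<..2*pi} then - a (x - pi) else 0)"
proof -
  have "x \<in> (+) pi ` {0..pi} \<longleftrightarrow> x - pi \<in> {0..pi}"
    by (metis add_diff_cancel_left' diff_add_cancel image_iff add.commute)
  then show ?thesis by (auto simp: psi_ext_def)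
qed

lemma circ_measurable_half:
  fixes a :: "real \<Rightarrow> complex"
  assumes "a \<in> borel_measurable circ" "S \<subseteq> {-pi..pi}" "S \<in> sets borel"
  shows "(\<lambda>x. indicat_real S x *\<^sub>R a x) \<in> borel_measurable lebesgue"
proof -
  have "(\<lambda>x. indicat_real {-pi..pi} x *\<^sub>R a x) \<in> borel_measurable lebesgue"
    using assms(1) by (subst (asm) borel_measurable_restrict_space_iff) auto
  moreover have "indicat_real S \<in> borel_measurable lebesgue"
    using assms(3) by (intro measurable_completion) simp
  ultimately have "(\<lambda>x. indicat_real S x *\<^sub>R (indicat_real {-pi..pi} x *\<^sub>R a x)) \<in> borel_measurable lebesgue"
    by (rule borel_measurable_scaleR[rotated])
  moreover have "indicat_real S x *\<^sub>R (indicat_real {-pi..pi} x *\<^sub>R a x) = indicat_real S x *\<^sub>R a x" for x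
    using assms(2) by (auto split: split_indicator)
  ultimately show ?thesis by (simp only:)
qed

lemma psi_ext_measurable:
  assumes a: "a \<in> borel_measurable circ"
  shows "set_borel_measurable lebesgue {0..2*pi} (psi_ext {0..pi} pi a)"
proof -
  \<comment> \<open>The point 0 is left out because its translate \<open>pi\<close> already belongs
    to the first branch.\<close>
  define t where "t x = indicat_real {0<..pi} x *\<^sub>R a x" for x
  have t: "t \<in> borel_measurable lebesgue"
    unfolding t_def[abs_def] by (rule circ_measurable_half[OF a]) auto
  have "(\<lambda>x. t (- pi + 1 *\<^sub>R x)) \<in> borel_measurable lebesgue" by (rule borel_measurable_affine[OF t]) simp
  moreover have "(\<lambda>x. indicat_real {0..pi} x *\<^sub>R a x) \<in> borel_measurable lebesgue"
    by (rule circ_measurable_half[OF a]) auto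
  ultimately have "(\<lambda>x. indicat_real {0..pi} x *\<^sub>R a x - t (- pi + 1 *\<^sub>R x)) \<in> borel_measurable lebesgue"
    by simp
  also have "(\<lambda>x. indicat_real {0..pi} x *\<^sub>R a x - t (- pi + 1 *\<^sub>R x)) = (\<lambda>x. indicat_real {0..2*pi} x *\<^sub>R psi_ext {0..pi} pi a x)"
    by (rule ext) (auto simp: psi_ext_eq t_def split: split_indicator)
  finally show ?thesis by (simp add: set_borel_measurable_def)
qed

text \<open>Translation by \<open>pi\<close> carries the second half back to the first, where it
  contributes \<open>F (- a x)\<close>. So \<open>psi\<close> on the doubled interval encodes a
  spectrum made of the values of \<open>a\<close> and of \<open>-a\<close> in equal
  proportion.\<close>

lemma psi_ext_integral:
  assumes a: "a \<in> borel_measurable circ" and F: "test_fun F"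
  shows "(LINT x:{0..2*pi}|lebesgue. F (psi_ext {0..pi} pi a x)) = (LINT x:{0..pi}|lebesgue. F (a x) + F (- a x))"
proof -
  obtain B where B: "\<And>z. cmod (F z) \<le> B" using test_fun_bounded[OF F] by blast
  have [measurable]: "F \<in> borel_measurable borel" by (rule test_fun_measurable[OF F])
  have int: "integrable lebesgue (\<lambda>x. indicat_real S x *\<^sub>R F (c * a x))" if S: "S \<subseteq> {-pi..pi}" "S \<in> sets borel" "S \<in> lmeasurable" for S c
  proof -
    have [measurable]: "a \<in> borel_measurable circ" by (rule a)
    have "(\<lambda>x. F (c * a x)) \<in> borel_measurable circ" by measurable
    then have m: "(\<lambda>x. indicat_real S x *\<^sub>R F (c * a x)) \<in> borel_measurable lebesgue"
      by (rule circ_measurable_half[OF _ S(1,2)])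
    have "integrable lebesgue (\<lambda>x. \<bar>B\<bar> * indicat_real S x)"
      using S(3) by (intro integrable_mult_right integrable_real_indicator) (auto simp: fmeasurable_def)
    then show ?thesis
      by (rule Bochner_Integration.integrable_bound[OF _ m])
         (rule AE_I2, use order_trans[OF B abs_ge_self] in \<open>auto split: split_indicator\<close>)
  qed
  define g where "g x = indicat_real {0<..pi} x *\<^sub>R F (- a x)" for x
  have gi: "integrable lebesgue g" 
  proof -
    have "{0<..pi} \<in> lmeasurable"
      by (rule bounded_set_imp_lmeasurable) (auto intro: bounded_subset[of "{0..pi}"])
    moreover have "{0<..pi} \<subseteq> {-pi..pi}" using pi_gt_zero by auto
    ultimately show ?thesis using int[of "{0<..pi}" "-1"] by (simp add: g_def[abs_def])
  qed
  have fi: "integrable lebesgue (\<lambda>x. indicat_real {0..pi} x *\<^sub>R F (a x))" using int[of "{0..pi}" 1] by auto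
  have gi': "integrable lebesgue (\<lambda>x. indicat_real {0..pi} x *\<^sub>R F (- a x))" using int[of "{0..pi}" "-1"] by auto
  have gs: "integrable lebesgue (\<lambda>x. g (- pi + 1 * x))" by (rule lebesgue_integrable_real_affine[OF gi]) simp
  have "(LINT x:{0..2*pi}|lebesgue. F (psi_ext {0..pi} pi a x))
      = (\<integral>x. indicat_real {0..pi} x *\<^sub>R F (a x) + g (- pi + 1 * x) \<partial>lebesgue)"
    unfolding set_lebesgue_integral_def
  proof (rule Bochner_Integration.integral_cong[OF refl])
    fix x :: real
    have *: "- pi + 1 * x = x - pi" by simp
    show "indicat_real {0..2*pi} x *\<^sub>R F (psi_ext {0..pi} pi a x) = indicat_real {0..pi} x *\<^sub>R F (a x) + g (- pi + 1 * x)"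
      unfolding * psi_ext_eq g_def using pi_gt_zero
      by (cases "0 \<le> x"; cases "x \<le> pi"; cases "x \<le> 2 * pi") (simp_all add: indicator_def)
  qed
  also have "\<dots> = (\<integral>x. indicat_real {0..pi} x *\<^sub>R F (a x) \<partial>lebesgue) + (\<integral>x. g (- pi + 1 * x) \<partial>lebesgue)"
    by (rule Bochner_Integration.integral_add[OF fi gs])
  also have "(\<integral>x. g (- pi + 1 * x) \<partial>lebesgue) = (\<integral>x. g x \<partial>lebesgue)"
    using lebesgue_integral_real_affine[of 1 g "-pi"] by simp
  also have "\<dots> = (\<integral>x. indicat_real {0..pi} x *\<^sub>R F (- a x) \<partial>lebesgue)"
    unfolding g_def
    by (rule integral_discrete_difference[where X="{0}"]) (auto split: split_indicator)
  also have "(\<integral>x. indicat_real {0..pi} x *\<^sub>R F (a x) \<partial>lebesgue) + \<dots> = (LINT x:{0..pi}|lebesgue. F (a x) + F (- a x))"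
    using fi gi' by (simp add: set_lebesgue_integral_def scaleR_add_right)
  finally show ?thesis .
qed

section \<open>Entries, symmetry and adjoint products of the matrices\<close>

lemma toeplitz_mat_index: "s < n \<Longrightarrow> t < n \<Longrightarrow> toeplitz_mat f n $$ (s, t) = toep id f s t"
  by (simp add: toeplitz_mat_def toep_def)

lemma toeplitz_mat_carrier: "toeplitz_mat f n \<in> carrier_mat n n"
  by (simp add: toeplitz_mat_def)

lemma hankel_mat_carrier: "hankel_mat f n \<in> carrier_mat n n"
  unfolding hankel_mat_def by (rule mult_carrier_mat[of _ n n]) (simp_all add: flip_mat_def toeplitz_mat_def)

lemma hankel_mat_index:
  assumes "s < n" "t < n"
  shows "hankel_mat f n $$ (s, t) = toep (\<lambda>s. n - 1 - s) f s t"
proof -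
  have "hankel_mat f n $$ (s, t) = (\<Sum>k<n. (if s + k + 1 = n then 1 else 0) * fourier_coeff f (int k - int t))"
    using assms by (simp add: hankel_mat_def flip_mat_def toeplitz_mat_def scalar_prod_def atLeast0LessThan)
  also have "\<dots> = (\<Sum>k<n. if k = n - 1 - s then fourier_coeff f (int k - int t) else 0)"
    using assms by (intro sum.cong refl) auto
  also have "\<dots> = toep (\<lambda>s. n - 1 - s) f s t" using assms by (simp add: toep_def)
  finally show ?thesis .
qed

lemma mat_adjoint_index:
  fixes A :: "complex mat"
  assumes "A \<in> carrier_mat n n" "s < n" "t < n"
  shows "mat_adjoint A $$ (s, t) = cnj (A $$ (t, s))"
  using assms by (auto simp: mat_adjoint_def mat_of_rows_def cols_def)

text \<open>The product of \<open>B\<close> with its adjoint on the left is a sum over rows of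
  \<open>B\<close>, so permuting these rows does not change it. The permuted matrix is the hermitian
  \<open>A\<close>, for which the product is \<open>A * A\<close>.\<close>

lemma hermitian_adjoint_mult:
  fixes A B :: "complex mat"
  assumes A: "A \<in> carrier_mat n n" and B: "B \<in> carrier_mat n n"
    and q: "bij_betw q {..<n} {..<n}"
    and eq: "\<And>k s. k < n \<Longrightarrow> s < n \<Longrightarrow> A $$ (s, k) = cnj (B $$ (q k, s))" "\<And>k s. k < n \<Longrightarrow> s < n \<Longrightarrow> A $$ (k, s) = B $$ (q k, s)"
  shows "mat_adjoint B * B = A * A"
proof (rule eq_matI)
  have B': "mat_adjoint B \<in> carrier_mat n n"
    using B by (auto simp: mat_adjoint_def mat_of_rows_def)
  fix s t assume "s < dim_row (A * A)" "t < dim_col (A * A)"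
  then have st: "s < n" "t < n" using A by auto
  have "(mat_adjoint B * B) $$ (s, t) = (\<Sum>k<n. mat_adjoint B $$ (s, k) * B $$ (k, t))"
    using B B' st by (simp add: scalar_prod_def atLeast0LessThan)
  also have "\<dots> = (\<Sum>k<n. cnj (B $$ (k, s)) * B $$ (k, t))"
    by (intro sum.cong refl) (simp add: mat_adjoint_index[OF B] st)
  also have "\<dots> = (\<Sum>k<n. cnj (B $$ (q k, s)) * B $$ (q k, t))"
    by (rule sum.reindex_bij_betw[OF q, symmetric])
  also have "\<dots> = (\<Sum>k<n. A $$ (s, k) * A $$ (k, t))"
  proof (intro sum.cong refl)
    fix k assume "k \<in> {..<n}"
    then have k: "k < n" by simp
    show "cnj (B $$ (q k, s)) * B $$ (q k, t) = A $$ (s, k) * A $$ (k, t)"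
      unfolding eq(1)[OF k st(1)] eq(2)[OF k st(2)] ..
  qed
  also have "\<dots> = (A * A) $$ (s, t)"
    using A st by (simp add: scalar_prod_def atLeast0LessThan)
  finally show "(mat_adjoint B * B) $$ (s, t) = (A * A) $$ (s, t)" .
qed (use A B in \<open>auto simp: mat_adjoint_def\<close>)

lemma toep_hermitian:
  assumes "\<And>k. fourier_coeff f k \<in> \<real>" "\<And>k. fourier_coeff f k = fourier_coeff f (- k)"
  shows "toep id f s t = cnj (toep id f t s)"
  using assms(1)[of "int s - int t"] assms(2)[of "int s - int t"] by (simp add: toep_def Reals_cnj_iff)

text \<open>After the flip an entry depends only on \<open>s + t\<close>, so the matrix is symmetric
  for every symbol, and real coefficients make it hermitian.\<close>

lemma toep_flip_hermitian:
  assumes "\<And>k. fourier_coeff f k \<in> \<real>" "s < n" "t < n"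
  shows "toep (\<lambda>s. n - 1 - s) f s t = cnj (toep (\<lambda>s. n - 1 - s) f t s)"
proof -
  have "int (n - 1 - s) - int t = int (n - 1 - t) - int s" using assms by simp
  then show ?thesis using assms(1) by (simp add: toep_def Reals_cnj_iff)
qed

lemma adjoint_mult_hankel:
  assumes r: "\<And>k. fourier_coeff f k \<in> \<real>"
  shows "mat_adjoint (toeplitz_mat f n) * toeplitz_mat f n = hankel_mat f n * hankel_mat f n"
    and "mat_adjoint (hankel_mat f n) * hankel_mat f n = hankel_mat f n * hankel_mat f n"
proof -
  have "bij_betw (\<lambda>s. n - 1 - s) {..<n} {..<n}"
    by (rule bij_betw_byWitness[where f'="\<lambda>s. n - 1 - s"]) auto
  then show "mat_adjoint (toeplitz_mat f n) * toeplitz_mat f n = hankel_mat f n * hankel_mat f n"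
  proof (rule hermitian_adjoint_mult[OF hankel_mat_carrier toeplitz_mat_carrier])
    fix k s assume ks: "k < n" "s < n"
    then show *: "hankel_mat f n $$ (k, s) = toeplitz_mat f n $$ (n - 1 - k, s)"
      by (simp add: hankel_mat_index toeplitz_mat_index toep_def)
    show "hankel_mat f n $$ (s, k) = cnj (toeplitz_mat f n $$ (n - 1 - k, s))"
      using toep_flip_hermitian[OF r ks(2,1)] ks * by (simp add: hankel_mat_index)
  qed
  show "mat_adjoint (hankel_mat f n) * hankel_mat f n = hankel_mat f n * hankel_mat f n"
  proof (rule hermitian_adjoint_mult[OF hankel_mat_carrier hankel_mat_carrier, of id])
    show "hankel_mat f n $$ (s, k) = cnj (hankel_mat f n $$ (id k, s))" if "k < n" "s < n" for k s
      unfolding id_apply hankel_mat_index[OF that] hankel_mat_index[OF that(2,1)]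
      by (rule toep_flip_hermitian[OF r that(2,1)])
  qed auto
qed

lemma test_fun_integrable_circ:
  assumes F: "test_fun F" and a: "a \<in> borel_measurable circ"
  shows "integrable circ (\<lambda>x. F (a x))"
proof -
  obtain B where B: "\<And>z. cmod (F z) \<le> B" using test_fun_bounded[OF F] by blast
  have [measurable]: "F \<in> borel_measurable borel" "a \<in> borel_measurable circ" by (rule test_fun_measurable[OF F], rule a)
  show ?thesis by (rule finite_measure.integrable_const_bound[OF finite_measure_circ, of _ B]) (auto simp: B)
qed

lemma admissible_intro:
  assumes "\<And>n. A n \<in> carrier_mat n n" "K \<in> lmeasurable" "0 < measure lebesgue K" "set_borel_measurable lebesgue K \<psi>"
  shows "admissible A \<psi> K"
proof -
  have "dim_row (A n) = n" "dim_col (A n) = n" for n using assms(1)[of n] by auto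
  then show ?thesis using assms by (auto simp: admissible_def strict_mono_def)
qed

theorem theorem14:
  fixes f :: "real \<Rightarrow> complex" and D Dp Dt :: "real set" and p :: real
  assumes f_L1: "set_integrable lebesgue {-pi<..<pi} f"
    and real_coeffs: "\<And>k::int. fourier_coeff f k \<in> \<real>"
    and D_def: "D = {0..pi}" and p_def: "p = pi"
    and Dp_def: "Dp = (+) p ` D" and Dt_def: "Dt = D \<union> Dp"
  shows "sv_distr (toeplitz_mat f) f {0..pi}
    \<and> sv_distr (hankel_mat f) f {0..pi}
    \<and> eig_distr (hankel_mat f) (psi_ext D p (\<lambda>x. of_real (cmod (f x)))) Dt
    \<and> ((\<forall>k::int. fourier_coeff f k = fourier_coeff f (- k)) \<longrightarrow>
         eig_distr (toeplitz_mat f) f {0..pi}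
       \<and> eig_distr (hankel_mat f) (psi_ext D p f) Dt
       \<and> eig_distr (hankel_mat f) (psi_ext D p (\<lambda>x. of_real (cmod (f x)))) Dt)"
proof -
  have f: "integrable circ f" using f_L1 by (simp add: integrable_circ_iff)
  then have fm [measurable]: "f \<in> borel_measurable circ" by simp
  have absm: "(\<lambda>x. complex_of_real (cmod (f x))) \<in> borel_measurable circ" by measurable
  have Dt: "Dt = {0..2*pi}" unfolding Dt_def Dp_def D_def p_def by (rule Icc_pi_Un_translate)
  have mD: "measure lebesgue {0..pi} = pi" "measure lebesgue {0..2*pi} = 2 * pi" by auto
  have refl: "AE x in circ. f (- x) = cnj (f x)" by (rule AE_reflect_eq_cnj[OF f real_coeffs])
  \<comment> \<open>Conjugation does not change the modulus, so every function of \<open>|f|\<close>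
    is even almost everywhere and its circle average is its average over
    \<open>[0, pi]\<close>.\<close>
  have abs_even: "AE x in circ. G (of_real (cmod (f (- x)))) = G (of_real (cmod (f x)))" for G :: "complex \<Rightarrow> complex"
    using refl by eventually_elim simp
  have dimT: "dim_row (toeplitz_mat f n) = n" for n using toeplitz_mat_carrier[of f n] by auto
  have dimH: "dim_row (hankel_mat f n) = n" for n using hankel_mat_carrier[of f n] by auto
  have fD: "set_borel_measurable lebesgue {0..pi} f"
    unfolding set_borel_measurable_def by (rule circ_measurable_half[OF fm]) auto
  have intabs: "integrable circ (\<lambda>x. cmod (f x))" "integrable circ (\<lambda>x. - cmod (f x))" using f by auto
  have hankel_lim: "(\<lambda>n. (\<Sum>z\<in>#eigvals_mset (hankel_mat f n). F z) / of_nat n) \<longlonglongrightarrow>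
      (\<integral>x. F (of_real (cmod (f x))) + F (of_real (- cmod (f x))) \<partial>circ) / (4 * of_real pi) \<and>
    (\<forall>B. (\<forall>n. mat_adjoint (B n) * B n = hankel_mat f n * hankel_mat f n) \<longrightarrow>
      (\<lambda>n. (\<Sum>s\<in>#singvals_mset (B n). F (of_real s)) / of_nat n) \<longlonglongrightarrow>
      (\<integral>x. F (of_real \<bar>cmod (f x)\<bar>) + F (of_real \<bar>- cmod (f x)\<bar>) \<partial>circ) / (4 * of_real pi))"
    if F: "test_fun F" for F
  proof (rule hermitian_test_limit[where M="\<lambda>n. toep (\<lambda>s. n - 1 - s) f", OF hankel_mat_carrier _ _ intabs _ F])
    show "(\<lambda>n. (\<Sum>i<n. \<bar>lam n i - c\<bar>) / real n) \<longlonglongrightarrow> (\<integral>x. \<bar>cmod (f x) - c\<bar> + \<bar>- cmod (f x) - c\<bar> \<partial>circ) / (4 * pi)"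
      if "\<And>n. orthonormal n n (u n)" "\<And>n i s. i < n \<Longrightarrow> s < n \<Longrightarrow>
        mat_app n (toep (\<lambda>s. n - 1 - s) f) (u n i) s = of_real (lam n i) * u n i s" for u lam c
      using that by (rule hankel_abs_limit[OF f refl])
  qed (rule hankel_mat_index toep_flip_hermitian[OF real_coeffs]; assumption)+
  have sv: "sv_distr B f {0..pi}"
    if B: "\<And>n. B n \<in> carrier_mat n n" "\<forall>n. mat_adjoint (B n) * B n = hankel_mat f n * hankel_mat f n" for B
    unfolding sv_distr_def
  proof (intro conjI allI impI)
    show "admissible B f {0..pi}" by (rule admissible_intro[OF B(1)]) (use fD in auto)
    fix F assume F: "test_fun F"
    have dim: "dim_row (B n) = n" for n using B(1)[of n] by auto
    have Fi: "integrable circ (\<lambda>x. F (of_real (cmod (f x))))" by (rule test_fun_integrable_circ[OF F absm])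
    have "(\<integral>x. F (of_real \<bar>cmod (f x)\<bar>) + F (of_real \<bar>- cmod (f x)\<bar>) \<partial>circ) / (4 * of_real pi)
        = (LINT x:{0..pi}|lebesgue. F (of_real (cmod (f x)))) / of_real pi"
      using Fi integral_circ_even[OF Fi abs_even] by simp
    then show "(\<lambda>n. (\<Sum>s\<in>#singvals_mset (B n). F (of_real s)) / of_nat (dim_row (B n)))
        \<longlonglongrightarrow> (LINT x:{0..pi}|lebesgue. F (of_real (cmod (f x)))) / of_real (measure lebesgue {0..pi})"
      using hankel_lim[OF F] B(2) by (simp add: dim mD)
  qed
  \<comment> \<open>The sum \<open>F (a x) + F (- a x)\<close> does not see the sign of
    \<open>a x\<close>. It is therefore enough that \<open>a\<close> equals \<open>|f|\<close> up to
    sign almost everywhere, which covers \<open>|f|\<close> itself and, in the even case,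
    \<open>f\<close>.\<close>
  have eigH: "eig_distr (hankel_mat f) (psi_ext {0..pi} pi a) {0..2*pi}"
    if am: "a \<in> borel_measurable circ"
      and a: "AE x in circ. a x = of_real (cmod (f x)) \<or> a x = - of_real (cmod (f x))" for a
    unfolding eig_distr_def
  proof (intro conjI allI impI)
    show "admissible (hankel_mat f) (psi_ext {0..pi} pi a) {0..2*pi}"
      by (rule admissible_intro[OF hankel_mat_carrier]) (use psi_ext_measurable[OF am] in auto)
    fix F assume F: "test_fun F"
    have nm: "(\<lambda>x. - complex_of_real (cmod (f x))) \<in> borel_measurable circ" "(\<lambda>x. - a x) \<in> borel_measurable circ"
      using absm am by auto
    note Fi = test_fun_integrable_circ[OF F absm] test_fun_integrable_circ[OF F nm(1)]
      test_fun_integrable_circ[OF F am] test_fun_integrable_circ[OF F nm(2)]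
    have G: "integrable circ (\<lambda>x. F (of_real (cmod (f x))) + F (- of_real (cmod (f x))))" using Fi by simp
    have "(\<integral>x. F (of_real (cmod (f x))) + F (of_real (- cmod (f x))) \<partial>circ)
        = 2 * (LINT x:{0..pi}|lebesgue. F (of_real (cmod (f x))) + F (- of_real (cmod (f x))))"
      using integral_circ_even[OF G abs_even[of "\<lambda>z. F z + F (- z)"]] by simp
    also have "(LINT x:{0..pi}|lebesgue. F (of_real (cmod (f x))) + F (- of_real (cmod (f x)))) = (LINT x:{0..pi}|lebesgue. F (a x) + F (- a x))"
      unfolding indicator_circ_integral
    proof (rule integral_cong_AE)
      have "indicat_real {0..} \<in> borel_measurable circ"
        by (intro borel_measurable_circ borel_measurable_indicator) simp
      then show "(\<lambda>x. indicat_real {0..} x *\<^sub>R (F (of_real (cmod (f x))) + F (- of_real (cmod (f x))))) \<in> borel_measurable circ"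
        "(\<lambda>x. indicat_real {0..} x *\<^sub>R (F (a x) + F (- a x))) \<in> borel_measurable circ"
        using Fi by (auto intro!: borel_measurable_scaleR borel_measurable_add)
      show "AE x in circ. indicat_real {0..} x *\<^sub>R (F (of_real (cmod (f x))) + F (- of_real (cmod (f x))))
          = indicat_real {0..} x *\<^sub>R (F (a x) + F (- a x))"
        using a by eventually_elim (auto simp: add.commute)
    qed
    also have "\<dots> = (LINT x:{0..2*pi}|lebesgue. F (psi_ext {0..pi} pi a x))"
      by (rule psi_ext_integral[OF am F, symmetric])
    finally have "(\<integral>x. F (of_real (cmod (f x))) + F (of_real (- cmod (f x))) \<partial>circ) / (4 * of_real pi)
        = (LINT x:{0..2*pi}|lebesgue. F (psi_ext {0..pi} pi a x)) / of_real (2 * pi)" by simp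
    then show "(\<lambda>n. (\<Sum>z\<in>#eigvals_mset (hankel_mat f n). F z) / of_nat (dim_row (hankel_mat f n)))
        \<longlonglongrightarrow> (LINT x:{0..2*pi}|lebesgue. F (psi_ext {0..pi} pi a x)) / of_real (measure lebesgue {0..2*pi})"
      using hankel_lim[OF F] by (simp only: dimH mD)
  qed
  have eigT: "eig_distr (toeplitz_mat f) f {0..pi} \<and> eig_distr (hankel_mat f) (psi_ext {0..pi} pi f) {0..2*pi}"
    if sym: "\<forall>k::int. fourier_coeff f k = fourier_coeff f (- k)"
  proof -
    have even: "AE x in circ. f (- x) = f x" by (rule AE_reflect_eq[OF f]) (use sym in blast)
    \<comment> \<open>Evenness turns the conjugate reflection symmetry into
      \<open>f x = cnj (f x)\<close>.\<close>
    have real: "AE x in circ. f x \<in> \<real>" using even refl by eventually_elim (simp add: Reals_cnj_iff)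
    have "AE x in circ. f x = of_real (cmod (f x)) \<or> f x = - of_real (cmod (f x))"
      using real by eventually_elim (auto elim!: Reals_cases simp: abs_if)
    then have 1: "eig_distr (hankel_mat f) (psi_ext {0..pi} pi f) {0..2*pi}" by (rule eigH[OF fm])
    have re: "integrable circ (\<lambda>x. Re (f x))" using f by (rule integrable_bounded_linear[OF bounded_linear_Re])
    have toep_lim: "(\<lambda>n. (\<Sum>z\<in>#eigvals_mset (toeplitz_mat f n). F z) / of_nat n) \<longlonglongrightarrow>
      (\<integral>x. F (of_real (Re (f x))) + F (of_real (Re (f x))) \<partial>circ) / (4 * of_real pi)" if F: "test_fun F" for F
    proof (rule conjunct1, rule hermitian_test_limit[where M="\<lambda>n. toep id f", OF toeplitz_mat_carrier _ _ re re _ F])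
      show "toep id f s t = cnj (toep id f t s)" for s t
        by (rule toep_hermitian[OF real_coeffs]) (use sym in blast)
      show "(\<lambda>n. (\<Sum>i<n. \<bar>lam n i - c\<bar>) / real n) \<longlonglongrightarrow> (\<integral>x. \<bar>Re (f x) - c\<bar> + \<bar>Re (f x) - c\<bar> \<partial>circ) / (4 * pi)"
        if "\<And>n. orthonormal n n (u n)" "\<And>n i s. i < n \<Longrightarrow> s < n \<Longrightarrow>
          mat_app n (toep id f) (u n i) s = of_real (lam n i) * u n i s" for u lam c
        using that by (rule toeplitz_abs_limit[OF f real])
    qed (rule toeplitz_mat_index; assumption)
    have "eig_distr (toeplitz_mat f) f {0..pi}"
      unfolding eig_distr_def
    proof (intro conjI allI impI)
      show "admissible (toeplitz_mat f) f {0..pi}" by (rule admissible_intro[OF toeplitz_mat_carrier]) (use fD in auto)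
      fix F assume F: "test_fun F"
      have Fi: "integrable circ (\<lambda>x. F (f x))" by (rule test_fun_integrable_circ[OF F fm])
      have rem: "(\<lambda>x. complex_of_real (Re (f x))) \<in> borel_measurable circ" by measurable
      have Fr: "integrable circ (\<lambda>x. F (of_real (Re (f x))))" by (rule test_fun_integrable_circ[OF F rem])
      have "(\<integral>x. F (of_real (Re (f x))) + F (of_real (Re (f x))) \<partial>circ) = (\<integral>x. F (f x) + F (f x) \<partial>circ)"
      proof (rule integral_cong_AE)
        show "AE x in circ. F (of_real (Re (f x))) + F (of_real (Re (f x))) = F (f x) + F (f x)"
          using real by eventually_elim (simp add: of_real_Re)
      qed (use Fi Fr in auto)
      also have "\<dots> = 2 * (\<integral>x. F (f x) \<partial>circ)" using Fi by simp
      also have "(\<integral>x. F (f x) \<partial>circ) = 2 * (LINT x:{0..pi}|lebesgue. F (f x))"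
      proof (rule integral_circ_even[OF Fi])
        show "AE x in circ. F (f (- x)) = F (f x)" using even by eventually_elim simp
      qed
      finally have "(\<integral>x. F (of_real (Re (f x))) + F (of_real (Re (f x))) \<partial>circ) / (4 * of_real pi)
          = (LINT x:{0..pi}|lebesgue. F (f x)) / of_real pi" by simp
      then show "(\<lambda>n. (\<Sum>z\<in>#eigvals_mset (toeplitz_mat f n). F z) / of_nat (dim_row (toeplitz_mat f n)))
          \<longlonglongrightarrow> (LINT x:{0..pi}|lebesgue. F (f x)) / of_real (measure lebesgue {0..pi})"
        using toep_lim[OF F] by (simp only: dimT mD)
    qed
    with 1 show ?thesis by simp
  qed
  have abs: "eig_distr (hankel_mat f) (psi_ext {0..pi} pi (\<lambda>x. of_real (cmod (f x)))) {0..2*pi}"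
    by (rule eigH[OF absm]) simp
  have "sv_distr (toeplitz_mat f) f {0..pi}"
    by (rule sv) (use toeplitz_mat_carrier adjoint_mult_hankel(1)[OF real_coeffs] in auto)
  moreover have "sv_distr (hankel_mat f) f {0..pi}"
    by (rule sv) (use hankel_mat_carrier adjoint_mult_hankel(2)[OF real_coeffs] in auto)
  ultimately show ?thesis
    using eigT abs unfolding Dt unfolding D_def p_def by blast
qed

end
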